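(* Let $L$ denote the generator of a continuous-time Markov process $(X_t)_{t\ge0}$ with state space $\mathcal X$ and an invariant (not necessarily reversible) probability measure $\mu$, such that $L$ and its adjoint $L^*$ in $L^2(\mu)$ have a common core $\mathcal C$. Suppose that $L$ satisfies a sector condition with constant $K>0$: $\langle f,-Lg\rangle_\mu^2\le K\langle f,-Sf\rangle_\mu\langle g,-Sg\rangle_\mu$ for all $f,g\in\mathcal C$, where $S=\frac{L+L^*}2$. Fix a time horizon $T>0$. Then there exists a universal constant $C_0=C_0(T)>0$, depending only on $T$, such that for any function $g:\mathcal X\to\mathbb R$ in the domain of $L$ and any $\ell>0$, $$P_\mu\Big(\sup_{0\le t\le T}g(X_t)\ge\ell\Big)\le\frac{C_0}{\ell}\sqrt{\langle g,g\rangle_\mu+T(K^2+1)\,\mathfrak D(g)}.$$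
   Context: $\langle\cdot,\cdot\rangle_\mu$ is the inner product of $L^2(\mu)$; $P_\mu$ is the law of $(X_t)_{t\ge 0}$ started from $\mu$; $\mathfrak D(f)=\langle f,-Lf\rangle_\mu=\langle f,-Sf\rangle_\mu\ge0$ is the Dirichlet form.
   Formalization: Adds that g(X_t), 0≤t≤T, is separable (true for right-continuous paths); else it fails: Brownian motion on the circle, g the indicator of a point. C_0 is chosen per type of state and sample space; uniformity follows by embedding countably many spaces in a disjoint union. *)

theory Defs
  imports "HOL-Probability.Probability"
begin

section \<open>Square-integrable functions and unbounded operators\<close>

text \<open>
  Elements of \<open>L\<^sup>2(\<mu>)\<close> are represented by functions. An operator is represented by its graph, a set
  of pairs of such functions, saturated under almost-everywhere equality.
\<close>

definition L2 :: "'a measure \<Rightarrow> ('a \<Rightarrow> real) set" where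
  "L2 \<mu> = {f \<in> borel_measurable \<mu>. integrable \<mu> (\<lambda>x. (f x)\<^sup>2)}"

definition L2_inner :: "'a measure \<Rightarrow> ('a \<Rightarrow> real) \<Rightarrow> ('a \<Rightarrow> real) \<Rightarrow> real" where
  "L2_inner \<mu> f g = (LINT x|\<mu>. f x * g x)"

definition L2_norm :: "'a measure \<Rightarrow> ('a \<Rightarrow> real) \<Rightarrow> real" where
  "L2_norm \<mu> f = sqrt (L2_inner \<mu> f f)"

type_synonym 'a operator = "(('a \<Rightarrow> real) \<times> ('a \<Rightarrow> real)) set"

text \<open>
  The value below is determined by the graph only up to a \<open>\<mu>\<close>-null set; it is used exclusively
  inside \<open>\<mu>\<close>-integrals.
\<close>

definition op_app :: "'a operator \<Rightarrow> ('a \<Rightarrow> real) \<Rightarrow> ('a \<Rightarrow> real)" where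
  "op_app A f = (SOME h. (f, h) \<in> A)"

definition L2_adjoint :: "'a measure \<Rightarrow> 'a operator \<Rightarrow> 'a operator" where
  "L2_adjoint \<mu> A =
    {(f, h). f \<in> L2 \<mu> \<and> h \<in> L2 \<mu> \<and> (\<forall>(u, v)\<in>A. L2_inner \<mu> v f = L2_inner \<mu> u h)}"

text \<open>A core is a linear subspace of the domain that is dense in the domain for the graph norm.\<close>

definition is_core :: "'a measure \<Rightarrow> 'a operator \<Rightarrow> ('a \<Rightarrow> real) set \<Rightarrow> bool" where
  "is_core \<mu> A C \<longleftrightarrow>
    C \<subseteq> Domain A \<and>
    (\<lambda>x. 0) \<in> C \<and>
    (\<forall>f\<in>C. \<forall>g\<in>C. (\<lambda>x. f x + g x) \<in> C) \<and>
    (\<forall>f\<in>C. \<forall>c. (\<lambda>x. c * f x) \<in> C) \<and>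
    (\<forall>(f, h)\<in>A. \<forall>\<epsilon>>0. \<exists>(u, v)\<in>A. u \<in> C \<and>
       L2_norm \<mu> (\<lambda>x. u x - f x) < \<epsilon> \<and> L2_norm \<mu> (\<lambda>x. v x - h x) < \<epsilon>)"


section \<open>Markov processes\<close>

locale transition_function =
  fixes E :: "'a measure" and \<kappa> :: "real \<Rightarrow> 'a \<Rightarrow> 'a measure"
  assumes kernel: "t \<ge> 0 \<Longrightarrow> \<kappa> t \<in> E \<rightarrow>\<^sub>M prob_algebra E"
    and kernel_0: "x \<in> space E \<Longrightarrow> \<kappa> 0 x = return E x"
    and Chapman_Kolmogorov: "s \<ge> 0 \<Longrightarrow> t \<ge> 0 \<Longrightarrow> x \<in> space E \<Longrightarrow> \<kappa> (s + t) x = \<kappa> s x \<bind> \<kappa> t"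

definition history :: "'w measure \<Rightarrow> 'a measure \<Rightarrow> (real \<Rightarrow> 'w \<Rightarrow> 'a) \<Rightarrow> real \<Rightarrow> 'w measure" where
  "history P E X s =
    sigma (space P) {X u -` A \<inter> space P | u A. 0 \<le> u \<and> u \<le> s \<and> A \<in> sets E}"

locale markov_process = transition_function E \<kappa> + prob_space P
  for E :: "'a measure" and \<kappa> :: "real \<Rightarrow> 'a \<Rightarrow> 'a measure"
    and P :: "'w measure" and X :: "real \<Rightarrow> 'w \<Rightarrow> 'a" +
  assumes X_measurable: "t \<ge> 0 \<Longrightarrow> X t \<in> P \<rightarrow>\<^sub>M E"
    and Markov_property: "s \<ge> 0 \<Longrightarrow> t \<ge> 0 \<Longrightarrow> A \<in> sets E \<Longrightarrow>
      AE \<omega> in P. real_cond_exp P (history P E X s) (\<lambda>\<omega>. indicator A (X (s + t) \<omega>)) \<omega> =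
        measure (\<kappa> t (X s \<omega>)) A"

definition invariant_measure ::
    "'a measure \<Rightarrow> (real \<Rightarrow> 'a \<Rightarrow> 'a measure) \<Rightarrow> 'a measure \<Rightarrow> bool" where
  "invariant_measure E \<kappa> \<mu> \<longleftrightarrow> \<mu> \<in> space (prob_algebra E) \<and> (\<forall>t\<ge>0. \<mu> \<bind> \<kappa> t = \<mu>)"

definition semigroup_app ::
    "(real \<Rightarrow> 'a \<Rightarrow> 'a measure) \<Rightarrow> real \<Rightarrow> ('a \<Rightarrow> real) \<Rightarrow> ('a \<Rightarrow> real)" where
  "semigroup_app \<kappa> t f = (\<lambda>x. LINT y|\<kappa> t x. f y)"

text \<open>
  For a contraction semigroup, strong continuity on \<open>L\<^sup>2(\<mu>)\<close> holds iff the generator is densely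
  defined; it is what makes the adjoint of the generator a well-defined operator.
\<close>

definition strongly_continuous_L2 ::
    "'a measure \<Rightarrow> (real \<Rightarrow> 'a \<Rightarrow> 'a measure) \<Rightarrow> bool" where
  "strongly_continuous_L2 \<mu> \<kappa> \<longleftrightarrow>
    (\<forall>f\<in>L2 \<mu>. ((\<lambda>t. L2_norm \<mu> (\<lambda>x. semigroup_app \<kappa> t f x - f x)) \<longlongrightarrow> 0) (at_right 0))"

definition L2_generator :: "'a measure \<Rightarrow> (real \<Rightarrow> 'a \<Rightarrow> 'a measure) \<Rightarrow> 'a operator" where
  "L2_generator \<mu> \<kappa> =
    {(f, h). f \<in> L2 \<mu> \<and> h \<in> L2 \<mu> \<and>
      ((\<lambda>t. L2_norm \<mu> (\<lambda>x. (semigroup_app \<kappa> t f x - f x) / t - h x)) \<longlongrightarrow> 0) (at_right 0)}"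

text \<open>\<open>S = (L + L\<^sup>*)/2\<close>, meaningful on the intersection of the two domains.\<close>

definition sym_part :: "'a measure \<Rightarrow> 'a operator \<Rightarrow> ('a \<Rightarrow> real) \<Rightarrow> ('a \<Rightarrow> real)" where
  "sym_part \<mu> A f = (\<lambda>x. (op_app A f x + op_app (L2_adjoint \<mu> A) f x) / 2)"

definition dirichlet_form :: "'a measure \<Rightarrow> 'a operator \<Rightarrow> ('a \<Rightarrow> real) \<Rightarrow> real" where
  "dirichlet_form \<mu> A f = L2_inner \<mu> f (\<lambda>x. - op_app A f x)"

definition sector_condition ::
    "'a measure \<Rightarrow> 'a operator \<Rightarrow> ('a \<Rightarrow> real) set \<Rightarrow> real \<Rightarrow> bool" where
  "sector_condition \<mu> A C K \<longleftrightarrow>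
    (\<forall>f\<in>C. \<forall>g\<in>C. (L2_inner \<mu> f (\<lambda>x. - op_app A g x))\<^sup>2 \<le>
       K * L2_inner \<mu> f (\<lambda>x. - sym_part \<mu> A f x) * L2_inner \<mu> g (\<lambda>x. - sym_part \<mu> A g x))"


section \<open>Suprema over an interval of times\<close>

text \<open>
  Separability of a real-valued process in the sense of Doob. Functions in the domain of an
  \<open>L\<^sup>2\<close>-generator are only determined almost everywhere, and changing \<open>g\<close> on a null set that is hit
  by the process changes the supremum of \<open>g(X\<^sub>t)\<close> over an uncountable set of times. Separability
  removes this ambiguity and makes the supremum measurable with respect to the completed measure;
  it holds whenever the paths of \<open>g(X\<^sub>t)\<close> are right-continuous.
\<close>

definition separable_process ::
    "'w measure \<Rightarrow> real set \<Rightarrow> (real \<Rightarrow> 'w \<Rightarrow> real) \<Rightarrow> bool" where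
  "separable_process P I Y \<longleftrightarrow>
    (\<exists>D. countable D \<and> D \<subseteq> I \<and>
      (AE \<omega> in P. \<forall>t\<in>I. \<exists>s. (\<forall>n::nat. s n \<in> D) \<and> s \<longlonglongrightarrow> t \<and>
         (\<lambda>n. Y (s n) \<omega>) \<longlonglongrightarrow> Y t \<omega>))"

lemma separable_process_sup_event:
  assumes sep: "separable_process P I Y"
    and meas: "\<And>t. t \<in> I \<Longrightarrow> Y t \<in> borel_measurable P"
  shows "{\<omega> \<in> space P. (SUP t\<in>I. ereal (Y t \<omega>)) \<ge> ereal l} \<in> sets (completion P)"
proof -
  obtain D where D: "countable D" "D \<subseteq> I"
    and ae: "AE \<omega> in P. \<forall>t\<in>I. \<exists>s. (\<forall>n::nat. s n \<in> D) \<and> s \<longlonglongrightarrow> t \<and>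
         (\<lambda>n. Y (s n) \<omega>) \<longlonglongrightarrow> Y t \<omega>"
    using sep unfolding separable_process_def by (elim exE conjE) rule
  have m: "(\<lambda>\<omega>. SUP t\<in>D. ereal (Y t \<omega>)) \<in> borel_measurable P"
    using D meas by (intro borel_measurable_SUP) auto
  have "AE \<omega> in P. (SUP t\<in>D. ereal (Y t \<omega>)) = (SUP t\<in>I. ereal (Y t \<omega>))"
    using ae
  proof eventually_elim
    case (elim \<omega>)
    have "ereal (Y t \<omega>) \<le> (SUP t\<in>D. ereal (Y t \<omega>))" if t: "t \<in> I" for t
    proof -
      obtain s where s: "\<forall>n::nat. s n \<in> D" "(\<lambda>n. Y (s n) \<omega>) \<longlonglongrightarrow> Y t \<omega>"
        using bspec[OF elim t] by blast
      have lim: "(\<lambda>n. ereal (Y (s n) \<omega>)) \<longlonglongrightarrow> ereal (Y t \<omega>)"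
        using s(2) by simp
      have le: "ereal (Y (s n) \<omega>) \<le> (SUP t\<in>D. ereal (Y t \<omega>))" for n
        using s(1) by (intro SUP_upper) simp
      show ?thesis
        by (rule LIMSEQ_le_const2[OF lim]) (use le in blast)
    qed
    then have "(SUP t\<in>I. ereal (Y t \<omega>)) \<le> (SUP t\<in>D. ereal (Y t \<omega>))"
      by (rule SUP_least)
    moreover have "(SUP t\<in>D. ereal (Y t \<omega>)) \<le> (SUP t\<in>I. ereal (Y t \<omega>))"
      using D(2) by (rule SUP_subset_mono) simp
    ultimately show ?case
      by (rule antisym[rotated])
  qed
  then obtain N where N: "N \<in> null_sets P"
    and eq: "\<And>\<omega>. \<omega> \<in> space P - N \<Longrightarrow> (SUP t\<in>D. ereal (Y t \<omega>)) = (SUP t\<in>I. ereal (Y t \<omega>))"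
    by (rule AE_E3) auto
  let ?A = "{\<omega> \<in> space P. (SUP t\<in>I. ereal (Y t \<omega>)) \<ge> ereal l}"
  let ?B = "{\<omega> \<in> space P. (SUP t\<in>D. ereal (Y t \<omega>)) \<ge> ereal l}"
  have "?A = (?B - N) \<union> (?A \<inter> N)"
    using eq by auto
  moreover have "?B - N \<in> sets P"
    using m N by (intro sets.Diff) auto
  ultimately show ?thesis
    using N by (intro sets_completionI[of ?A "?B - N" "?A \<inter> N" N]) auto
qed

lemma separable_process_right_continuous:
  assumes rc: "AE \<omega> in P. \<forall>t\<in>{0..<T}. continuous (at_right t) (\<lambda>s. Y s \<omega>)"
  shows "separable_process P {0..T} Y"
proof -
  let ?D = "{0..T} \<inter> (\<rat> \<union> {T})"
  have "\<exists>s. (\<forall>n::nat. s n \<in> ?D) \<and> s \<longlonglongrightarrow> t \<and> (\<lambda>n. Y (s n) \<omega>) \<longlonglongrightarrow> Y t \<omega>"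
    if t: "t \<in> {0..T}" and c: "\<forall>t\<in>{0..<T}. continuous (at_right t) (\<lambda>s. Y s \<omega>)" for t \<omega>
  proof (cases "t = T")
    case True
    then show ?thesis
      using t by (intro exI[of _ "\<lambda>n. T"]) auto
  next
    case False
    then have "t < T"
      using t by auto
    have "\<exists>q\<in>\<rat>. t < q \<and> q < min T (t + 1 / Suc n)" for n
      using \<open>t < T\<close> by (intro Rats_dense_in_real) auto
    then obtain s where s: "\<And>n. s n \<in> \<rat>" "\<And>n. t < s n" "\<And>n. s n < min T (t + 1 / Suc n)"
      by metis
    have "(\<lambda>n. t + 1 / Suc n) \<longlonglongrightarrow> t + 0"
      by (intro tendsto_add tendsto_const LIMSEQ_Suc lim_1_over_n)
    then have lim: "s \<longlonglongrightarrow> t"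
      using s by (intro tendsto_sandwich[of "\<lambda>n. t" s sequentially "\<lambda>n. t + 1 / Suc n"])
        (auto intro!: always_eventually less_imp_le)
    have "filterlim s (at_right t) sequentially"
      using lim s(2) by (auto simp: filterlim_at intro!: always_eventually)
    moreover have "((\<lambda>r. Y r \<omega>) \<longlongrightarrow> Y t \<omega>) (at_right t)"
      using c t \<open>t < T\<close> by (auto simp: continuous_within)
    ultimately have "(\<lambda>n. Y (s n) \<omega>) \<longlonglongrightarrow> Y t \<omega>"
      by (rule filterlim_compose[rotated])
    moreover have "s n \<in> ?D" for n
      using s(1)[of n] s(2)[of n] s(3)[of n] t by auto
    ultimately show ?thesis
      using lim by blast
  qed
  then have "AE \<omega> in P. \<forall>t\<in>{0..T}. \<exists>s. (\<forall>n::nat. s n \<in> ?D) \<and> s \<longlonglongrightarrow> t \<and>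
      (\<lambda>n. Y (s n) \<omega>) \<longlonglongrightarrow> Y t \<omega>"
    using rc by (elim eventually_mono) simp
  moreover have "countable ?D"
    by (intro countable_Int2 countable_Un countable_rat) auto
  ultimately show ?thesis
    unfolding separable_process_def by (intro exI[of _ ?D] conjI) auto
qed

end

theory Submission
  imports Defs
begin

text \<open>
  The exceedance probability is bounded through a supermartingale. Put \<open>\<gamma> = 1/T\<close>. If \<open>u \<ge> 0\<close> is
  \<open>\<gamma>\<close>-excessive, that is \<open>exp (- \<gamma> t) P\<^sub>t u \<le> u\<close> almost everywhere, then \<open>exp (- \<gamma> t) u(X\<^sub>t)\<close> is a
  supermartingale, and the probability that \<open>u(X\<^sub>t)\<close> reaches \<open>l\<close> before \<open>T\<close> is at most
  \<open>exp 1 / l\<close> times \<open>\<integral> u d\<mu>\<close>, hence at most \<open>exp 1 / l\<close> times the \<open>L\<^sup>2\<close> norm of \<open>u\<close>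
  (\<open>excessive_maximal\<close>). It therefore suffices to find an excessive \<open>u\<close> that dominates \<open>g\<close> and whose
  norm is controlled by the norm and the Dirichlet form of \<open>g\<close>. This is an obstacle problem.

  The obstacle problem is solved by penalisation. For \<open>\<alpha> > 0\<close> let \<open>u\<close> solve
  \<open>\<gamma> u - L u = \<alpha> max 0 (g - u)\<close> (\<open>penalised_obstacle\<close>). The right-hand side is nonnegative, so \<open>u\<close> is
  nonnegative and \<open>\<gamma>\<close>-excessive (\<open>excessive_of_nonneg\<close>). Testing the equation with \<open>u - g\<close> gives
  \<open>\<gamma> \<langle>u,u\<rangle> + D(u) + \<alpha> \<langle>w,w\<rangle> = \<gamma> \<langle>u,g\<rangle> - \<langle>g, L u\<rangle>\<close> with \<open>w = max 0 (g - u)\<close>. The sector condition bounds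
  the last term by \<open>sqrt (K D(g) D(u))\<close>, which the terms on the left absorb: \<open>\<langle>u,u\<rangle>\<close> is at most
  \<open>\<langle>g,g\<rangle> + T K D(g)\<close>, and \<open>\<langle>w,w\<rangle>\<close> is of order \<open>1/\<alpha>\<close> (\<open>obstacle_energy\<close>). At finitely many
  times \<open>g(X\<^sub>t)\<close> thus exceeds \<open>u(X\<^sub>t)\<close> by more than \<open>\<epsilon>\<close> only with a probability that vanishes as
  \<open>\<alpha> \<rightarrow> \<infinity>\<close>, which proves the bound for maxima over finite sets of times, with the constant
  \<open>exp 1\<close> and with \<open>K\<close> in place of \<open>K\<^sup>2 + 1\<close> (\<open>finite_maximal\<close>). Separability passes from finite
  sets to \<open>[0,T]\<close> (\<open>sup_le_of_finite\<close>), and \<open>K \<le> K\<^sup>2 + 1\<close>.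

  The supermartingale argument replaces hitting times, and the analysis takes place in the closure
  of the graph of \<open>L\<close> restricted to the common core. There the equation \<open>\<beta> u - L u = f\<close> is solved by
  minimising the residual: a minimal residual \<open>r\<close> is orthogonal to the range of \<open>\<beta> - L\<close>, so it
  satisfies \<open>L\<^sup>* r = \<beta> r\<close>; since \<open>L\<^sup>*\<close> is dissipative, because it is so on the core, \<open>r = 0\<close>
  (\<open>resolvent_exists\<close>). The penalised equation then follows by a contraction argument.
\<close>

section \<open>Square-integrable functions\<close>

lemma L2_iff: "f \<in> L2 M \<longleftrightarrow> f \<in> borel_measurable M \<and> integrable M (\<lambda>x. (f x)\<^sup>2)"
  by (simp add: L2_def)

lemma L2_measurable [measurable_dest]: "f \<in> L2 M \<Longrightarrow> f \<in> borel_measurable M"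
  by (simp add: L2_iff)

lemma L2_integrable_mult:
  assumes "f \<in> L2 M" "g \<in> L2 M"
  shows "integrable M (\<lambda>x. f x * g x)"
proof (rule Bochner_Integration.integrable_bound)
  show "integrable M (\<lambda>x. (f x)\<^sup>2 + (g x)\<^sup>2)"
    using assms by (simp add: L2_iff)
  have "norm (f x * g x) \<le> norm ((f x)\<^sup>2 + (g x)\<^sup>2)" for x
  proof -
    have "0 \<le> (\<bar>f x\<bar> - \<bar>g x\<bar>)\<^sup>2" "0 \<le> \<bar>f x\<bar> * \<bar>g x\<bar>"
      by simp_all
    then have "\<bar>f x\<bar> * \<bar>g x\<bar> \<le> (f x)\<^sup>2 + (g x)\<^sup>2"
      unfolding power2_diff power2_abs by linarith
    then show ?thesis
      by (simp add: abs_mult)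
  qed
  then show "AE x in M. norm (f x * g x) \<le> norm ((f x)\<^sup>2 + (g x)\<^sup>2)"
    by simp
qed (use assms in measurable)

lemma L2_add: "f \<in> L2 M \<Longrightarrow> g \<in> L2 M \<Longrightarrow> (\<lambda>x. f x + g x) \<in> L2 M"
  using L2_integrable_mult[of f M g] by (auto simp: L2_iff power2_sum mult.assoc)

lemma L2_cmult: "f \<in> L2 M \<Longrightarrow> (\<lambda>x. c * f x) \<in> L2 M"
  by (auto simp: L2_iff power_mult_distrib)

lemma L2_uminus: "f \<in> L2 M \<Longrightarrow> (\<lambda>x. - f x) \<in> L2 M"
  using L2_cmult[where c = "-1"] by fastforce

lemma L2_diff: "f \<in> L2 M \<Longrightarrow> g \<in> L2 M \<Longrightarrow> (\<lambda>x. f x - g x) \<in> L2 M"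
  using L2_add[of f M "\<lambda>x. - g x"] L2_uminus[of g M] by simp

lemma L2_divide: "f \<in> L2 M \<Longrightarrow> (\<lambda>x. f x / c) \<in> L2 M"
  using L2_cmult[where c = "inverse c" and f = f] by (simp add: divide_inverse mult.commute)

lemma L2_dominated:
  assumes "f \<in> borel_measurable M" "g \<in> L2 M" "AE x in M. \<bar>f x\<bar> \<le> \<bar>g x\<bar>"
  shows "f \<in> L2 M"
proof -
  have "AE x in M. norm ((f x)\<^sup>2) \<le> norm ((g x)\<^sup>2)"
    using assms(3) by eventually_elim (simp add: abs_le_square_iff[symmetric])
  then have "integrable M (\<lambda>x. (f x)\<^sup>2)"
    using assms(1,2)
    by (intro Bochner_Integration.integrable_bound[of M "\<lambda>x. (g x)\<^sup>2" "\<lambda>x. (f x)\<^sup>2"])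
      (simp_all add: L2_iff)
  with assms show ?thesis by (simp add: L2_iff)
qed

lemma L2_abs: "f \<in> L2 M \<Longrightarrow> (\<lambda>x. \<bar>f x\<bar>) \<in> L2 M"
  by (rule L2_dominated[of _ M f]) auto

lemma L2_max:
  assumes "f \<in> L2 M" "g \<in> L2 M"
  shows "(\<lambda>x. max (f x) (g x)) \<in> L2 M"
proof (rule L2_dominated)
  have "(\<lambda>x. \<bar>f x\<bar>) \<in> L2 M" "(\<lambda>x. \<bar>g x\<bar>) \<in> L2 M"
    using assms by (auto intro: L2_abs)
  then show "(\<lambda>x. \<bar>f x\<bar> + \<bar>g x\<bar>) \<in> L2 M"
    by (rule L2_add)
  show "AE x in M. \<bar>max (f x) (g x)\<bar> \<le> \<bar>\<bar>f x\<bar> + \<bar>g x\<bar>\<bar>"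
    by (intro AE_I2) linarith
qed (use assms in measurable)

lemma L2_zero: "(\<lambda>x. 0) \<in> L2 M"
  by (simp add: L2_iff)

lemma (in finite_measure) L2_const: "(\<lambda>x. c) \<in> L2 M"
  by (simp add: L2_iff)

lemma (in finite_measure) L2_integrable: "f \<in> L2 M \<Longrightarrow> integrable M f"
  using L2_integrable_mult[of f M "\<lambda>x. 1"] L2_const by simp

lemmas L2_intros = L2_add L2_diff L2_uminus L2_cmult L2_divide L2_max L2_zero

lemma L2_inner_add_left:
  "f \<in> L2 M \<Longrightarrow> g \<in> L2 M \<Longrightarrow> h \<in> L2 M \<Longrightarrow>
    L2_inner M (\<lambda>x. f x + g x) h = L2_inner M f h + L2_inner M g h"
  by (simp add: L2_inner_def distrib_right L2_integrable_mult)

lemma L2_inner_diff_left: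
  "f \<in> L2 M \<Longrightarrow> g \<in> L2 M \<Longrightarrow> h \<in> L2 M \<Longrightarrow>
    L2_inner M (\<lambda>x. f x - g x) h = L2_inner M f h - L2_inner M g h"
  by (simp add: L2_inner_def left_diff_distrib L2_integrable_mult)

lemma L2_inner_cmult_left: "L2_inner M (\<lambda>x. c * f x) h = c * L2_inner M f h"
  by (simp add: L2_inner_def mult.assoc)

lemma L2_inner_uminus_left: "L2_inner M (\<lambda>x. - f x) h = - L2_inner M f h"
  by (simp add: L2_inner_def)

lemma L2_inner_commute: "L2_inner M f g = L2_inner M g f"
  by (simp add: L2_inner_def mult.commute)

lemma L2_inner_add_right:
  "f \<in> L2 M \<Longrightarrow> g \<in> L2 M \<Longrightarrow> h \<in> L2 M \<Longrightarrow>
    L2_inner M h (\<lambda>x. f x + g x) = L2_inner M h f + L2_inner M h g"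
  using L2_inner_add_left[of f M g h] by (simp add: L2_inner_commute)

lemma L2_inner_diff_right:
  "f \<in> L2 M \<Longrightarrow> g \<in> L2 M \<Longrightarrow> h \<in> L2 M \<Longrightarrow>
    L2_inner M h (\<lambda>x. f x - g x) = L2_inner M h f - L2_inner M h g"
  using L2_inner_diff_left[of f M g h] by (simp add: L2_inner_commute)

lemma L2_inner_cmult_right: "L2_inner M h (\<lambda>x. c * f x) = c * L2_inner M h f"
  using L2_inner_cmult_left[of M c f h] by (simp add: L2_inner_commute)

lemma L2_inner_uminus_right: "L2_inner M h (\<lambda>x. - f x) = - L2_inner M h f"
  by (simp add: L2_inner_def)

lemmas L2_inner_linear =
  L2_inner_add_left L2_inner_diff_left L2_inner_cmult_left L2_inner_uminus_left
  L2_inner_add_right L2_inner_diff_right L2_inner_cmult_right L2_inner_uminus_right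

lemma L2_inner_cong_AE:
  assumes "AE x in M. f x = f' x" "AE x in M. g x = g' x"
    and "f \<in> borel_measurable M" "f' \<in> borel_measurable M" "g \<in> borel_measurable M" "g' \<in> borel_measurable M"
  shows "L2_inner M f g = L2_inner M f' g'"
  unfolding L2_inner_def using assms by (intro integral_cong_AE) auto

lemma L2_inner_self_nonneg: "0 \<le> L2_inner M f f"
  by (simp add: L2_inner_def)

lemma L2_norm_nonneg: "0 \<le> L2_norm M f"
  by (simp add: L2_norm_def L2_inner_self_nonneg)

lemma L2_norm_sq: "(L2_norm M f)\<^sup>2 = L2_inner M f f"
  by (simp add: L2_norm_def L2_inner_self_nonneg)

lemma L2_nn_integral_sq:
  "f \<in> L2 M \<Longrightarrow> (\<integral>\<^sup>+x. ennreal ((f x)\<^sup>2) \<partial>M) = ennreal ((L2_norm M f)\<^sup>2)"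
  unfolding L2_norm_sq L2_inner_def power2_eq_square[symmetric]
  by (intro nn_integral_eq_integral) (auto simp: L2_iff)

lemma L2_norm_cmult: "L2_norm M (\<lambda>x. c * f x) = \<bar>c\<bar> * L2_norm M f"
  by (simp add: L2_norm_def L2_inner_cmult_left L2_inner_cmult_right real_sqrt_mult
      mult.assoc[symmetric])

lemma L2_norm_minus_commute: "L2_norm M (\<lambda>x. f x - g x) = L2_norm M (\<lambda>x. g x - f x)"
  using L2_norm_cmult[of M "-1" "\<lambda>x. f x - g x"] by simp

lemma L2_norm_mono:
  assumes "f \<in> borel_measurable M" "g \<in> L2 M" "AE x in M. \<bar>f x\<bar> \<le> \<bar>g x\<bar>"
  shows "L2_norm M f \<le> L2_norm M g"
proof -
  have "f \<in> L2 M"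
    using assms by (rule L2_dominated)
  moreover have "AE x in M. f x * f x \<le> g x * g x"
    using assms(3) by eventually_elim (simp add: abs_le_square_iff[unfolded power2_eq_square, symmetric])
  ultimately have "L2_inner M f f \<le> L2_inner M g g"
    unfolding L2_inner_def using assms(2) by (intro integral_mono_AE L2_integrable_mult) auto
  then show ?thesis
    by (simp add: L2_norm_def)
qed

lemma L2_norm_cong_AE:
  assumes "AE x in M. f x = g x" "f \<in> borel_measurable M" "g \<in> borel_measurable M"
  shows "L2_norm M f = L2_norm M g"
  unfolding L2_norm_def using L2_inner_cong_AE[of f g M f g] assms by simp

lemma L2_norm_eq_0:
  assumes "f \<in> L2 M" "L2_norm M f = 0"
  shows "AE x in M. f x = 0"
proof -
  have "integral\<^sup>L M (\<lambda>x. f x * f x) = 0"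
    using assms by (simp add: L2_norm_def L2_inner_def)
  then have "AE x in M. f x * f x = 0"
    using integral_nonneg_eq_0_iff_AE[of M "\<lambda>x. f x * f x"] L2_integrable_mult[of f M f] assms
    by simp
  then show ?thesis
    by simp
qed

lemma L2_Cauchy_Schwarz:
  assumes "f \<in> L2 M" "g \<in> L2 M"
  shows "\<bar>L2_inner M f g\<bar> \<le> L2_norm M f * L2_norm M g"
proof (cases "L2_norm M g = 0")
  case True
  have "L2_inner M f g = L2_inner M f (\<lambda>x. 0)"
    using assms L2_norm_eq_0[OF assms(2) True] by (intro L2_inner_cong_AE) auto
  then show ?thesis
    using True by (simp add: L2_inner_def)
next
  case False
  define a b where "a = L2_inner M f g" and "b = L2_inner M g g"
  have b: "b > 0"
    using False L2_norm_nonneg[of M g] L2_norm_sq[of M g] unfolding b_def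
    by (metis order_less_le power2_eq_iff_nonneg zero_le_power2 zero_power2 order_refl)
  define c where "c = a / b"
  have "0 \<le> L2_inner M (\<lambda>x. f x - c * g x) (\<lambda>x. f x - c * g x)"
    by (rule L2_inner_self_nonneg)
  also have "\<dots> = L2_inner M f f - 2 * c * a + c * c * b"
    using assms
    by (simp add: L2_inner_linear L2_intros L2_inner_commute[of M g f] right_diff_distrib
        flip: a_def b_def)
  also have "\<dots> = L2_inner M f f - a\<^sup>2 / b"
    using b by (simp add: c_def power2_eq_square)
  finally have "a\<^sup>2 \<le> (L2_norm M f * L2_norm M g)\<^sup>2"
    using b by (simp add: field_simps L2_norm_sq power_mult_distrib flip: b_def)
  then have "\<bar>a\<bar> \<le> \<bar>L2_norm M f * L2_norm M g\<bar>"
    by (rule abs_le_square_iff[THEN iffD2])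
  then show ?thesis
    by (simp add: a_def abs_mult L2_norm_nonneg)
qed

lemma L2_norm_triangle:
  assumes "f \<in> L2 M" "g \<in> L2 M"
  shows "L2_norm M (\<lambda>x. f x + g x) \<le> L2_norm M f + L2_norm M g"
proof -
  have "(L2_norm M (\<lambda>x. f x + g x))\<^sup>2 = L2_inner M f f + 2 * L2_inner M f g + L2_inner M g g"
    using assms by (simp add: L2_norm_sq L2_inner_linear L2_intros L2_inner_commute[of M g f])
  also have "\<dots> \<le> (L2_norm M f + L2_norm M g)\<^sup>2"
    using L2_Cauchy_Schwarz[OF assms] by (simp add: power2_sum L2_norm_sq)
  finally show ?thesis
    by (rule power2_le_imp_le) (simp add: L2_norm_nonneg)
qed

lemma L2_norm_triangle_diff:
  assumes "f \<in> L2 M" "g \<in> L2 M" "h \<in> L2 M"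
  shows "L2_norm M (\<lambda>x. f x - h x) \<le> L2_norm M (\<lambda>x. f x - g x) + L2_norm M (\<lambda>x. g x - h x)"
  using L2_norm_triangle[of "\<lambda>x. f x - g x" M "\<lambda>x. g x - h x"] assms by (simp add: L2_intros)

lemma L2_norm_diff_le:
  assumes "f \<in> L2 M" "g \<in> L2 M"
  shows "L2_norm M (\<lambda>x. f x - g x) \<le> L2_norm M f + L2_norm M g"
  using L2_norm_triangle_diff[OF assms(1) L2_zero assms(2)] L2_norm_minus_commute[of M g "\<lambda>x. 0"]
  by simp

lemma L2_parallelogram:
  assumes "f \<in> L2 M" "g \<in> L2 M"
  shows "(L2_norm M (\<lambda>x. f x - g x))\<^sup>2 =
    2 * (L2_norm M f)\<^sup>2 + 2 * (L2_norm M g)\<^sup>2 - 4 * (L2_norm M (\<lambda>x. 1/2 * (f x + g x)))\<^sup>2"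
  unfolding L2_norm_cmult[of M "1/2"] using assms
  by (simp add: power_mult_distrib power_divide L2_norm_sq L2_inner_linear L2_intros
      L2_inner_commute[of M g f] add_divide_distrib)

lemma L2_norm_tendsto_0:
  assumes "\<And>n. L2_norm M (f n) \<le> b n" "b \<longlonglongrightarrow> 0"
  shows "(\<lambda>n. L2_norm M (f n)) \<longlonglongrightarrow> 0"
proof (rule Lim_null_comparison)
  show "\<forall>\<^sub>F n in sequentially. norm (L2_norm M (f n)) \<le> b n"
    using assms(1) by (simp add: L2_norm_nonneg)
qed (rule assms(2))

text \<open>
  Joint continuity of the inner product. It carries dissipativity and the sector condition from
  the core to the closure of the graph.
\<close>

lemma L2_inner_tendsto:
  assumes "\<And>n. u n \<in> L2 M" "\<And>n. v n \<in> L2 M" "u0 \<in> L2 M" "v0 \<in> L2 M"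
    and u: "(\<lambda>n. L2_norm M (\<lambda>x. u n x - u0 x)) \<longlonglongrightarrow> 0"
    and v: "(\<lambda>n. L2_norm M (\<lambda>x. v n x - v0 x)) \<longlonglongrightarrow> 0"
  shows "(\<lambda>n. L2_inner M (u n) (v n)) \<longlonglongrightarrow> L2_inner M u0 v0"
proof -
  let ?a = "\<lambda>n. L2_norm M (\<lambda>x. u n x - u0 x)" and ?b = "\<lambda>n. L2_norm M (\<lambda>x. v n x - v0 x)"
  have "norm (L2_inner M (u n) (v n) - L2_inner M u0 v0)
      \<le> ?a n * ?b n + ?a n * L2_norm M v0 + L2_norm M u0 * ?b n" for n
  proof -
    have "L2_inner M (u n) (v n) - L2_inner M u0 v0 =
        L2_inner M (\<lambda>x. u n x - u0 x) (\<lambda>x. v n x - v0 x) + L2_inner M (\<lambda>x. u n x - u0 x) v0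
        + L2_inner M u0 (\<lambda>x. v n x - v0 x)"
      using assms by (simp add: L2_inner_linear L2_intros)
    moreover have "\<bar>L2_inner M (\<lambda>x. u n x - u0 x) (\<lambda>x. v n x - v0 x)\<bar> \<le> ?a n * ?b n"
      "\<bar>L2_inner M (\<lambda>x. u n x - u0 x) v0\<bar> \<le> ?a n * L2_norm M v0"
      "\<bar>L2_inner M u0 (\<lambda>x. v n x - v0 x)\<bar> \<le> L2_norm M u0 * ?b n"
      using assms by (auto intro!: L2_Cauchy_Schwarz L2_intros)
    ultimately show ?thesis
      by simp
  qed
  moreover have "(\<lambda>n. ?a n * ?b n + ?a n * L2_norm M v0 + L2_norm M u0 * ?b n)
      \<longlonglongrightarrow> 0 * 0 + 0 * L2_norm M v0 + L2_norm M u0 * 0"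
    by (intro tendsto_intros u v)
  ultimately have "(\<lambda>n. L2_inner M (u n) (v n) - L2_inner M u0 v0) \<longlonglongrightarrow> 0"
    by (intro Lim_null_comparison[where g = "\<lambda>n. ?a n * ?b n + ?a n * L2_norm M v0 + L2_norm M u0 * ?b n"
        and f = "\<lambda>n. L2_inner M (u n) (v n) - L2_inner M u0 v0"] always_eventually) auto
  then show ?thesis
    by (simp add: LIM_zero_iff)
qed

lemma (in prob_space) L2_expectation_abs_le:
  assumes "f \<in> L2 M"
  shows "(\<integral>x. \<bar>f x\<bar> \<partial>M) \<le> L2_norm M f"
proof -
  have "(\<lambda>x. \<bar>f x\<bar>) \<in> L2 M"
    using assms by (rule L2_abs)
  then have "\<bar>L2_inner M (\<lambda>x. \<bar>f x\<bar>) (\<lambda>x. 1)\<bar> \<le> L2_norm M (\<lambda>x. \<bar>f x\<bar>) * L2_norm M (\<lambda>x. 1)"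
    by (intro L2_Cauchy_Schwarz L2_const)
  moreover have "L2_norm M (\<lambda>x. 1) = 1"
    by (simp add: L2_norm_def L2_inner_def prob_space)
  moreover have "L2_norm M (\<lambda>x. \<bar>f x\<bar>) = L2_norm M f"
    by (simp add: L2_norm_def L2_inner_def)
  ultimately show ?thesis
    by (simp add: L2_inner_def)
qed

text \<open>
  The distance of a function from the cone of nonnegative functions. As a sublinear functional
  that is Lipschitz for the \<open>L\<^sup>2\<close> norm, it makes the inequalities of potential theory stable under
  limits: an almost everywhere inequality \<open>0 \<le> f\<close> is the equation \<open>L2_neg M f = 0\<close>.
\<close>

definition L2_neg :: "'a measure \<Rightarrow> ('a \<Rightarrow> real) \<Rightarrow> real" where
  "L2_neg M f = L2_norm M (\<lambda>x. max 0 (- f x))"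

lemma L2_neg_part: "f \<in> L2 M \<Longrightarrow> (\<lambda>x. max 0 (- f x)) \<in> L2 M"
  by (intro L2_intros)

lemma L2_neg_nonneg: "0 \<le> L2_neg M f"
  by (simp add: L2_neg_def L2_norm_nonneg)

lemma L2_neg_mono:
  assumes "f \<in> L2 M" "g \<in> L2 M" "AE x in M. f x \<le> g x"
  shows "L2_neg M g \<le> L2_neg M f"
proof -
  have "AE x in M. \<bar>max 0 (- g x)\<bar> \<le> \<bar>max 0 (- f x)\<bar>"
    using assms(3) by eventually_elim auto
  then show ?thesis
    unfolding L2_neg_def using assms(1,2)
    by (intro L2_norm_mono L2_neg_part L2_measurable)
qed

lemma L2_neg_add:
  assumes "f \<in> L2 M" "g \<in> L2 M"
  shows "L2_neg M (\<lambda>x. f x + g x) \<le> L2_neg M f + L2_neg M g"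
proof -
  have "L2_neg M (\<lambda>x. f x + g x) \<le> L2_norm M (\<lambda>x. max 0 (- f x) + max 0 (- g x))"
    unfolding L2_neg_def using assms by (intro L2_norm_mono L2_measurable L2_intros AE_I2) auto
  also have "\<dots> \<le> L2_neg M f + L2_neg M g"
    unfolding L2_neg_def using assms by (intro L2_norm_triangle L2_intros)
  finally show ?thesis .
qed

lemma L2_neg_cmult:
  assumes "0 \<le> c"
  shows "L2_neg M (\<lambda>x. c * f x) = c * L2_neg M f"
proof -
  have "max 0 (- (c * f x)) = c * max 0 (- f x)" for x
    using assms by (simp add: max_mult_distrib_left)
  then show ?thesis
    using assms by (simp add: L2_neg_def L2_norm_cmult)
qed

lemma L2_neg_perturb:
  assumes "f \<in> L2 M" "g \<in> L2 M"
  shows "L2_neg M f \<le> L2_neg M g + L2_norm M (\<lambda>x. f x - g x)"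
proof -
  have "L2_neg M f \<le> L2_neg M g + L2_neg M (\<lambda>x. f x - g x)"
    using L2_neg_add[of g M "\<lambda>x. f x - g x"] assms by (simp add: L2_intros)
  also have "L2_neg M (\<lambda>x. f x - g x) \<le> L2_norm M (\<lambda>x. f x - g x)"
    unfolding L2_neg_def using assms by (intro L2_norm_mono L2_measurable L2_intros AE_I2) auto
  finally show ?thesis by simp
qed

lemma L2_neg_eq_0_iff:
  assumes "f \<in> L2 M"
  shows "L2_neg M f = 0 \<longleftrightarrow> (AE x in M. 0 \<le> f x)"
proof
  assume "L2_neg M f = 0"
  then have "AE x in M. max 0 (- f x) = 0"
    unfolding L2_neg_def using assms by (intro L2_norm_eq_0 L2_intros)
  then show "AE x in M. 0 \<le> f x"
    by eventually_elim (auto simp: max_def split: if_splits)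
next
  assume "AE x in M. 0 \<le> f x"
  then have "L2_norm M (\<lambda>x. max 0 (- f x)) = L2_norm M (\<lambda>x. 0)"
    using assms by (intro L2_norm_cong_AE) (auto elim: eventually_mono)
  then show "L2_neg M f = 0"
    by (simp add: L2_neg_def L2_norm_def L2_inner_def)
qed

lemma L2_geometric_tail:
  assumes u: "\<And>n. u n \<in> L2 M" and q: "0 \<le> q" "q < 1" and c: "0 \<le> c"
    and step: "\<And>n. L2_norm M (\<lambda>x. u (Suc n) x - u n x) \<le> c * q ^ n"
  shows "L2_norm M (\<lambda>x. u (n + k) x - u n x) \<le> c * q ^ n / (1 - q)"
proof -
  have "L2_norm M (\<lambda>x. u (n + k) x - u n x) \<le> (\<Sum>i<k. c * q ^ (n + i))"
  proof (induction k)
    case 0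
    then show ?case by (simp add: L2_norm_def L2_inner_def)
  next
    case (Suc k)
    then show ?case
      using L2_norm_triangle_diff[OF u[of "n + Suc k"] u[of "n + k"] u[of n]] step[of "n + k"] by simp
  qed
  also have "\<dots> = c * q ^ n * (\<Sum>i<k. q ^ i)"
    by (simp add: power_add sum_distrib_left mult.assoc)
  also have "\<dots> \<le> c * q ^ n * (1 / (1 - q))"
    using q c by (intro mult_left_mono) (auto simp: sum_gp_strict divide_right_mono)
  finally show ?thesis
    by simp
qed

text \<open>
  Riesz--Fischer. On a probability space the \<open>L\<^sup>1\<close> norm is dominated by the \<open>L\<^sup>2\<close> norm, so the
  increments of a fast Cauchy sequence are almost surely absolutely summable. The pointwise limit
  is also the limit in \<open>L\<^sup>2\<close> by Fatou's lemma, applied to \<open>(u\<^sub>n\<^sub>+\<^sub>k - u\<^sub>n)\<^sup>2\<close> as \<open>k \<rightarrow> \<infinity>\<close>.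
\<close>

lemma (in prob_space) L2_complete_fast:
  assumes u: "\<And>n. u n \<in> L2 M"
    and fast: "\<And>n. L2_norm M (\<lambda>x. u (Suc n) x - u n x) \<le> (1/2) ^ n"
  shows "\<exists>v \<in> L2 M. (\<lambda>n. L2_norm M (\<lambda>x. u n x - v x)) \<longlonglongrightarrow> 0"
proof -
  have [measurable]: "\<And>n. u n \<in> borel_measurable M"
    using u by auto
  have d: "(\<lambda>x. u (Suc n) x - u n x) \<in> L2 M" for n
    using u by (intro L2_intros)
  have "(\<integral>\<^sup>+x. (\<Sum>n. ennreal \<bar>u (Suc n) x - u n x\<bar>) \<partial>M)
      = (\<Sum>n. \<integral>\<^sup>+x. ennreal \<bar>u (Suc n) x - u n x\<bar> \<partial>M)"
    by (intro nn_integral_suminf) measurable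
  also have "\<dots> \<le> (\<Sum>n. ennreal ((1/2) ^ n))"
  proof (intro suminf_le)
    fix n
    have "(\<integral>\<^sup>+x. ennreal \<bar>u (Suc n) x - u n x\<bar> \<partial>M) = ennreal (\<integral>x. \<bar>u (Suc n) x - u n x\<bar> \<partial>M)"
      using L2_integrable[OF d[of n]] by (intro nn_integral_eq_integral integrable_abs) auto
    then show "(\<integral>\<^sup>+x. ennreal \<bar>u (Suc n) x - u n x\<bar> \<partial>M) \<le> ennreal ((1/2) ^ n)"
      using L2_expectation_abs_le[OF d[of n]] fast[of n] by (simp add: ennreal_leI)
  qed auto
  also have "\<dots> = ennreal (\<Sum>n. (1/2) ^ n)"
    by (intro suminf_ennreal2) (auto intro!: summable_geometric)
  finally have "(\<integral>\<^sup>+x. (\<Sum>n. ennreal \<bar>u (Suc n) x - u n x\<bar>) \<partial>M) \<noteq> \<infinity>"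
    by (auto simp: top_unique)
  then have "AE x in M. (\<Sum>n. ennreal \<bar>u (Suc n) x - u n x\<bar>) \<noteq> \<infinity>"
    by (intro nn_integral_PInf_AE) auto
  then have conv: "AE x in M. convergent (\<lambda>n. u n x)"
  proof eventually_elim
    case (elim x)
    then have "summable (\<lambda>n. \<bar>u (Suc n) x - u n x\<bar>)"
      by (intro summable_suminf_not_top) (auto simp: top_ennreal_def)
    then have "summable (\<lambda>n. u (Suc n) x - u n x)"
      by (rule summable_rabs_cancel)
    then have "(\<lambda>n. (\<Sum>i<n. u (Suc i) x - u i x) + u 0 x)
        \<longlonglongrightarrow> (\<Sum>i. u (Suc i) x - u i x) + u 0 x"
      by (intro tendsto_add tendsto_const summable_LIMSEQ)
    moreover have "(\<Sum>i<n. u (Suc i) x - u i x) + u 0 x = u n x" for n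
      using sum_lessThan_telescope[of "\<lambda>n. u n x" n] by simp
    ultimately show ?case
      by (auto intro!: convergentI)
  qed
  define v where "v x = lim (\<lambda>n. u n x)" for x
  have [measurable]: "v \<in> borel_measurable M"
    unfolding v_def by measurable
  have lim: "AE x in M. (\<lambda>n. u n x) \<longlonglongrightarrow> v x"
    using conv unfolding v_def by eventually_elim (simp add: convergent_LIMSEQ_iff)
  have cauchy: "L2_norm M (\<lambda>x. u (n + k) x - u n x) \<le> 2 * (1/2) ^ n" for n k
    using L2_geometric_tail[of u M "1/2" 1 n k] u fast by simp
  have fatou: "(\<integral>\<^sup>+x. ennreal ((u n x - v x)\<^sup>2) \<partial>M) \<le> ennreal ((2 * (1/2) ^ n)\<^sup>2)" for n
  proof -
    have "(\<integral>\<^sup>+x. ennreal ((u n x - v x)\<^sup>2) \<partial>M)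
        = (\<integral>\<^sup>+x. liminf (\<lambda>k. ennreal ((u (n + k) x - u n x)\<^sup>2)) \<partial>M)"
    proof (intro nn_integral_cong_AE)
      show "AE x in M. ennreal ((u n x - v x)\<^sup>2) = liminf (\<lambda>k. ennreal ((u (n + k) x - u n x)\<^sup>2))"
        using lim
      proof eventually_elim
        case (elim x)
        have "(\<lambda>k. u (n + k) x) \<longlonglongrightarrow> v x"
          using LIMSEQ_ignore_initial_segment[OF elim, of n] by (simp add: add.commute)
        then have "(\<lambda>k. ennreal ((u (n + k) x - u n x)\<^sup>2)) \<longlonglongrightarrow> ennreal ((v x - u n x)\<^sup>2)"
          by (intro tendsto_intros)
        then have "liminf (\<lambda>k. ennreal ((u (n + k) x - u n x)\<^sup>2)) = ennreal ((v x - u n x)\<^sup>2)"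
          by (rule lim_imp_Liminf[OF sequentially_bot])
        then show ?case
          by (simp only: power2_commute[of "u n x" "v x"])
      qed
    qed
    also have "\<dots> \<le> liminf (\<lambda>k. \<integral>\<^sup>+x. ennreal ((u (n + k) x - u n x)\<^sup>2) \<partial>M)"
      by (intro nn_integral_liminf) measurable
    also have "\<dots> \<le> liminf (\<lambda>k::nat. ennreal ((2 * (1/2) ^ n)\<^sup>2))"
    proof (intro Liminf_mono always_eventually allI)
      fix k
      have "(\<lambda>x. u (n + k) x - u n x) \<in> L2 M"
        using u by (intro L2_intros)
      then have "(\<integral>\<^sup>+x. ennreal ((u (n + k) x - u n x)\<^sup>2) \<partial>M)
          = ennreal ((L2_norm M (\<lambda>x. u (n + k) x - u n x))\<^sup>2)"
        by (rule L2_nn_integral_sq)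
      also have "\<dots> \<le> ennreal ((2 * (1/2) ^ n)\<^sup>2)"
        by (intro ennreal_leI power_mono cauchy L2_norm_nonneg)
      finally show "(\<integral>\<^sup>+x. ennreal ((u (n + k) x - u n x)\<^sup>2) \<partial>M) \<le> ennreal ((2 * (1/2) ^ n)\<^sup>2)" .
    qed
    finally show ?thesis
      by (simp add: Liminf_const)
  qed
  have diff: "(\<lambda>x. u n x - v x) \<in> L2 M" for n
    using fatou[of n] by (auto simp: L2_iff integrable_iff_bounded intro: le_less_trans)
  have vL2: "v \<in> L2 M"
    using L2_diff[OF u[of 0] diff[of 0]] by simp
  have "L2_norm M (\<lambda>x. u n x - v x) \<le> 2 * (1/2) ^ n" for n
  proof -
    have "ennreal ((L2_norm M (\<lambda>x. u n x - v x))\<^sup>2) = (\<integral>\<^sup>+x. ennreal ((u n x - v x)\<^sup>2) \<partial>M)"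
      using L2_nn_integral_sq[OF diff[of n]] by simp
    also have "\<dots> \<le> ennreal ((2 * (1/2) ^ n)\<^sup>2)"
      by (rule fatou)
    finally have "(L2_norm M (\<lambda>x. u n x - v x))\<^sup>2 \<le> (2 * (1/2) ^ n)\<^sup>2"
      by (subst (asm) ennreal_le_iff) (rule zero_le_power2)
    then show ?thesis
      by (rule power2_le_imp_le) simp
  qed
  moreover have "(\<lambda>n. 2 * (1/2::real) ^ n) \<longlonglongrightarrow> 2 * 0"
    by (intro tendsto_intros LIMSEQ_power_zero) auto
  ultimately have "(\<lambda>n. L2_norm M (\<lambda>x. u n x - v x)) \<longlonglongrightarrow> 0"
    using L2_norm_tendsto_0[of M _ "\<lambda>n. 2 * (1/2::real) ^ n"] by simp
  with vL2 show ?thesis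
    by blast
qed

lemma (in prob_space) L2_complete:
  assumes u: "\<And>n. u n \<in> L2 M"
    and cauchy: "\<And>e. e > 0 \<Longrightarrow> \<exists>n0. \<forall>m\<ge>n0. \<forall>n\<ge>n0. L2_norm M (\<lambda>x. u m x - u n x) < e"
  shows "\<exists>v \<in> L2 M. (\<lambda>n. L2_norm M (\<lambda>x. u n x - v x)) \<longlonglongrightarrow> 0"
proof -
  obtain n0 where n0: "\<And>k m n. n0 k \<le> m \<Longrightarrow> n0 k \<le> n \<Longrightarrow>
      L2_norm M (\<lambda>x. u m x - u n x) < (1/2) ^ k"
  proof -
    have "\<forall>k. \<exists>n0. \<forall>m\<ge>n0. \<forall>n\<ge>n0. L2_norm M (\<lambda>x. u m x - u n x) < (1/2) ^ k"
      using cauchy by simp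
    then show ?thesis
      using that by (auto dest!: choice)
  qed
  define r where "r k = k + (\<Sum>i\<le>k. n0 i)" for k
  have r: "n0 k \<le> r k" "r k \<le> r (Suc k)" "k \<le> r k" for k
    by (auto simp: r_def intro!: trans_le_add2 member_le_sum)
  have "L2_norm M (\<lambda>x. u (r (Suc k)) x - u (r k) x) \<le> (1/2) ^ k" for k
    using n0[of k "r (Suc k)" "r k"] r(1)[of k] r(2)[of k] by linarith
  then obtain v where v: "v \<in> L2 M" "(\<lambda>k. L2_norm M (\<lambda>x. u (r k) x - v x)) \<longlonglongrightarrow> 0"
    using L2_complete_fast[of "\<lambda>k. u (r k)"] u by blast
  have "(\<lambda>n. L2_norm M (\<lambda>x. u n x - v x)) \<longlonglongrightarrow> 0"
  proof (rule LIMSEQ_I)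
    fix e :: real assume "e > 0"
    then obtain n1 where n1: "\<And>m n. n1 \<le> m \<Longrightarrow> n1 \<le> n \<Longrightarrow> L2_norm M (\<lambda>x. u m x - u n x) < e / 2"
      using cauchy[of "e / 2"] by auto
    obtain k0 where k0: "\<And>k. k \<ge> k0 \<Longrightarrow> L2_norm M (\<lambda>x. u (r k) x - v x) < e / 2"
      using LIMSEQ_D[OF v(2), of "e / 2"] \<open>e > 0\<close> by (auto simp: abs_of_nonneg L2_norm_nonneg)
    have "L2_norm M (\<lambda>x. u n x - v x) < e" if "n \<ge> n1" for n
      using L2_norm_triangle_diff[OF u[of n] u[of "r (max n1 k0)"] v(1)] n1[OF that, of "r (max n1 k0)"]
        k0[of "max n1 k0"] r(3)[of "max n1 k0"] by simp
    then show "\<exists>no. \<forall>n\<ge>no. norm (L2_norm M (\<lambda>x. u n x - v x) - 0) < e"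
      by (auto simp: L2_norm_nonneg abs_of_nonneg)
  qed
  with v show ?thesis by blast
qed

section \<open>The semigroup on square-integrable functions\<close>

locale stationary_semigroup = transition_function E \<kappa>
  for E :: "'a measure" and \<kappa> :: "real \<Rightarrow> 'a \<Rightarrow> 'a measure" +
  fixes \<mu> :: "'a measure"
  assumes invariant: "invariant_measure E \<kappa> \<mu>"
begin

lemma sets_mu [measurable_cong]: "sets \<mu> = sets E"
  using invariant by (auto simp: invariant_measure_def space_prob_algebra)

lemma space_mu: "space \<mu> = space E"
  using sets_mu by (rule sets_eq_imp_space_eq)

sublocale \<mu>: prob_space \<mu>
  using invariant by (auto simp: invariant_measure_def space_prob_algebra)

lemma kernel_subprob: "t \<ge> 0 \<Longrightarrow> \<kappa> t \<in> E \<rightarrow>\<^sub>M subprob_algebra E"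
  using kernel by (rule measurable_prob_algebraD)

lemma kernel_mu: "t \<ge> 0 \<Longrightarrow> \<kappa> t \<in> \<mu> \<rightarrow>\<^sub>M subprob_algebra E"
  using kernel_subprob measurable_cong_sets[OF sets_mu refl] by blast

lemma prob_space_kernel: "t \<ge> 0 \<Longrightarrow> x \<in> space E \<Longrightarrow> prob_space (\<kappa> t x)"
  using measurable_space[OF kernel] by (auto simp: space_prob_algebra)

lemma sets_kernel: "t \<ge> 0 \<Longrightarrow> x \<in> space E \<Longrightarrow> sets (\<kappa> t x) = sets E"
  using measurable_space[OF kernel] by (auto simp: space_prob_algebra)

lemma borel_measurable_mu: "borel_measurable \<mu> = borel_measurable E"
  by (rule measurable_cong_sets[OF sets_mu refl])

lemma borel_measurable_kernel:
  "t \<ge> 0 \<Longrightarrow> x \<in> space E \<Longrightarrow> borel_measurable (\<kappa> t x) = borel_measurable E"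
  by (rule measurable_cong_sets[OF sets_kernel refl])

lemma nn_integral_invariant:
  assumes "t \<ge> 0" "f \<in> borel_measurable E"
  shows "(\<integral>\<^sup>+x. \<integral>\<^sup>+y. f y \<partial>\<kappa> t x \<partial>\<mu>) = (\<integral>\<^sup>+x. f x \<partial>\<mu>)"
  using nn_integral_bind[OF assms(2) kernel_mu[OF assms(1)]] invariant assms(1)
  by (simp add: invariant_measure_def)

lemma nn_integral_kernel_measurable:
  assumes "t \<ge> 0" "f \<in> borel_measurable E"
  shows "(\<lambda>x. \<integral>\<^sup>+y. f y \<partial>\<kappa> t x) \<in> borel_measurable E"
  by (rule measurable_compose[OF kernel_subprob[OF assms(1)]
        nn_integral_measurable_subprob_algebra[OF assms(2)]])

text \<open>
  By invariance the \<open>\<mu>\<close>-average of the masses \<open>\<kappa> t x N\<close> is the \<open>\<mu>\<close>-mass of \<open>N\<close>. This makes the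
  semigroup act on classes of functions modulo almost everywhere equality.
\<close>

lemma AE_kernel:
  assumes t: "t \<ge> 0" and "AE y in \<mu>. Q y"
  shows "AE x in \<mu>. AE y in \<kappa> t x. Q y"
proof -
  obtain N where N: "N \<in> null_sets \<mu>" "{y \<in> space \<mu>. \<not> Q y} \<subseteq> N"
    using assms(2) by (auto simp: eventually_ae_filter)
  then have NE: "N \<in> sets E"
    using sets_mu by auto
  then have ind: "(\<lambda>x. indicator N x :: ennreal) \<in> borel_measurable E"
    by measurable
  have "(\<integral>\<^sup>+x. \<integral>\<^sup>+y. indicator N y \<partial>\<kappa> t x \<partial>\<mu>) = 0"
    using nn_integral_invariant[OF t ind] N(1) by (simp add: null_setsD1 null_setsD2)
  then have "AE x in \<mu>. (\<integral>\<^sup>+y. indicator N y \<partial>\<kappa> t x) = 0"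
    using nn_integral_kernel_measurable[OF t ind]
    by (subst (asm) nn_integral_0_iff_AE) (auto simp: borel_measurable_mu)
  then show ?thesis
    using AE_space
  proof eventually_elim
    case (elim x)
    then have x: "x \<in> space E"
      by (simp add: space_mu)
    then have "N \<in> sets (\<kappa> t x)" "space (\<kappa> t x) = space \<mu>"
      using NE sets_kernel[OF t x] sets_eq_imp_space_eq[OF sets_kernel[OF t x]] by (auto simp: space_mu)
    moreover from this have "emeasure (\<kappa> t x) N = 0"
      using elim by simp
    ultimately show ?case
      using N by (intro AE_I[of _ _ N]) auto
  qed
qed

lemma AE_L2_kernel:
  assumes t: "t \<ge> 0" and f: "f \<in> L2 \<mu>"
  shows "AE x in \<mu>. f \<in> L2 (\<kappa> t x)"
proof -
  have fE [measurable]: "f \<in> borel_measurable E"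
    using L2_measurable[OF f] by (simp add: borel_measurable_mu)
  have m: "(\<lambda>y. ennreal ((f y)\<^sup>2)) \<in> borel_measurable E"
    by measurable
  have "(\<integral>\<^sup>+x. \<integral>\<^sup>+y. ennreal ((f y)\<^sup>2) \<partial>\<kappa> t x \<partial>\<mu>) \<noteq> \<infinity>"
    by (simp add: nn_integral_invariant[OF t m] L2_nn_integral_sq[OF f])
  then have "AE x in \<mu>. (\<integral>\<^sup>+y. ennreal ((f y)\<^sup>2) \<partial>\<kappa> t x) \<noteq> \<infinity>"
    using nn_integral_kernel_measurable[OF t m] by (intro nn_integral_PInf_AE) (auto simp: borel_measurable_mu)
  then show ?thesis
    using AE_space
  proof eventually_elim
    case (elim x)
    then have x: "x \<in> space E"
      by (simp add: space_mu)
    have "f \<in> borel_measurable (\<kappa> t x)"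
      unfolding borel_measurable_kernel[OF t x] by (rule fE)
    with elim show ?case
      by (auto simp: L2_iff integrable_iff_bounded less_top)
  qed
qed

lemma semigroup_measurable:
  assumes "t \<ge> 0" "f \<in> L2 \<mu>"
  shows "semigroup_app \<kappa> t f \<in> borel_measurable \<mu>"
  unfolding semigroup_app_def
  using measurable_compose[OF kernel_mu[OF assms(1)] integral_measurable_subprob_algebra[of f E]]
    L2_measurable[OF assms(2)] by (simp add: borel_measurable_mu)

text \<open>
  Jensen's inequality for the probability measure \<open>\<kappa> t x\<close>, integrated against the invariant \<open>\<mu>\<close>.
  The bound on the upper integral yields square-integrability and contractivity at once.
\<close>

lemma semigroup_sq_le:
  assumes t: "t \<ge> 0" and f: "f \<in> L2 \<mu>"
  shows "(\<integral>\<^sup>+x. ennreal ((semigroup_app \<kappa> t f x)\<^sup>2) \<partial>\<mu>) \<le> ennreal ((L2_norm \<mu> f)\<^sup>2)"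
proof -
  have m: "(\<lambda>y. ennreal ((f y)\<^sup>2)) \<in> borel_measurable E"
    using L2_measurable[OF f] by (simp add: borel_measurable_mu)
  have "AE x in \<mu>. ennreal ((semigroup_app \<kappa> t f x)\<^sup>2) \<le> (\<integral>\<^sup>+y. ennreal ((f y)\<^sup>2) \<partial>\<kappa> t x)"
    using AE_L2_kernel[OF t f] AE_space
  proof eventually_elim
    case (elim x)
    then interpret prob_space "\<kappa> t x"
      using prob_space_kernel[OF t, of x] by (simp add: space_mu)
    have "\<bar>\<integral>y. f y \<partial>\<kappa> t x\<bar> \<le> L2_norm (\<kappa> t x) f"
      by (rule order_trans[OF integral_abs_bound L2_expectation_abs_le[OF elim(1)]])
    then have "(semigroup_app \<kappa> t f x)\<^sup>2 \<le> (L2_norm (\<kappa> t x) f)\<^sup>2"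
      unfolding semigroup_app_def abs_le_square_iff[symmetric] by (simp add: L2_norm_nonneg)
    then show ?case
      by (simp add: L2_nn_integral_sq[OF elim(1)] ennreal_leI)
  qed
  then have "(\<integral>\<^sup>+x. ennreal ((semigroup_app \<kappa> t f x)\<^sup>2) \<partial>\<mu>)
      \<le> (\<integral>\<^sup>+x. \<integral>\<^sup>+y. ennreal ((f y)\<^sup>2) \<partial>\<kappa> t x \<partial>\<mu>)"
    by (rule nn_integral_mono_AE)
  then show ?thesis
    by (simp add: nn_integral_invariant[OF t m] L2_nn_integral_sq[OF f])
qed

lemma semigroup_L2:
  assumes "t \<ge> 0" "f \<in> L2 \<mu>"
  shows "semigroup_app \<kappa> t f \<in> L2 \<mu>"
  using semigroup_sq_le[OF assms] semigroup_measurable[OF assms]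
  by (auto simp: L2_iff integrable_iff_bounded intro: le_less_trans)

lemma semigroup_contraction:
  assumes "t \<ge> 0" "f \<in> L2 \<mu>"
  shows "L2_norm \<mu> (semigroup_app \<kappa> t f) \<le> L2_norm \<mu> f"
  using semigroup_sq_le[OF assms] L2_nn_integral_sq[OF semigroup_L2[OF assms]]
  by (intro power2_le_imp_le[OF _ L2_norm_nonneg]) simp

lemma AE_integrable_kernel:
  assumes t: "t \<ge> 0" and f: "f \<in> L2 \<mu>"
  shows "AE x in \<mu>. integrable (\<kappa> t x) f"
  using AE_L2_kernel[OF t f] AE_space
proof eventually_elim
  case (elim x)
  then interpret prob_space "\<kappa> t x"
    using prob_space_kernel[OF t, of x] by (simp add: space_mu)
  show ?case
    by (rule L2_integrable[OF elim(1)])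
qed

lemma semigroup_add:
  assumes "t \<ge> 0" "f \<in> L2 \<mu>" "g \<in> L2 \<mu>"
  shows "AE x in \<mu>. semigroup_app \<kappa> t (\<lambda>y. f y + g y) x
    = semigroup_app \<kappa> t f x + semigroup_app \<kappa> t g x"
  using AE_integrable_kernel[OF assms(1,2)] AE_integrable_kernel[OF assms(1,3)]
  by eventually_elim (simp add: semigroup_app_def)

lemma semigroup_diff:
  assumes "t \<ge> 0" "f \<in> L2 \<mu>" "g \<in> L2 \<mu>"
  shows "AE x in \<mu>. semigroup_app \<kappa> t (\<lambda>y. f y - g y) x
    = semigroup_app \<kappa> t f x - semigroup_app \<kappa> t g x"
  using AE_integrable_kernel[OF assms(1,2)] AE_integrable_kernel[OF assms(1,3)]
  by eventually_elim (simp add: semigroup_app_def)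

lemma semigroup_cmult: "semigroup_app \<kappa> t (\<lambda>y. c * f y) x = c * semigroup_app \<kappa> t f x"
  by (simp add: semigroup_app_def)

lemma semigroup_mono:
  assumes "t \<ge> 0" "f \<in> L2 \<mu>" "g \<in> L2 \<mu>" "AE x in \<mu>. f x \<le> g x"
  shows "AE x in \<mu>. semigroup_app \<kappa> t f x \<le> semigroup_app \<kappa> t g x"
  using AE_integrable_kernel[OF assms(1,2)] AE_integrable_kernel[OF assms(1,3)]
    AE_kernel[OF assms(1,4)]
  by eventually_elim (auto simp: semigroup_app_def intro!: integral_mono_AE)

text \<open>
  The semigroup is positive as well as contractive, so it does not increase the negative part:
  \<open>(P\<^sub>t f)\<^sup>- \<le> P\<^sub>t f\<^sup>-\<close>.
\<close>

lemma semigroup_neg: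
  assumes t: "t \<ge> 0" and f: "f \<in> L2 \<mu>"
  shows "L2_neg \<mu> (semigroup_app \<kappa> t f) \<le> L2_neg \<mu> f"
proof -
  let ?m = "\<lambda>x. max 0 (- f x)"
  have m: "?m \<in> L2 \<mu>"
    using f by (rule L2_neg_part)
  have "AE x in \<mu>. 0 \<le> semigroup_app \<kappa> t ?m x"
    by (auto simp: semigroup_app_def)
  moreover have "AE x in \<mu>. semigroup_app \<kappa> t (\<lambda>y. - 1 * f y) x \<le> semigroup_app \<kappa> t ?m x"
    using f m by (intro semigroup_mono t L2_cmult) auto
  ultimately have "AE x in \<mu>. \<bar>max 0 (- semigroup_app \<kappa> t f x)\<bar> \<le> \<bar>semigroup_app \<kappa> t ?m x\<bar>"
    unfolding semigroup_cmult by eventually_elim auto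
  then have "L2_neg \<mu> (semigroup_app \<kappa> t f) \<le> L2_norm \<mu> (semigroup_app \<kappa> t ?m)"
    unfolding L2_neg_def using semigroup_L2[OF t f] semigroup_L2[OF t m]
    by (intro L2_norm_mono) auto
  also have "\<dots> \<le> L2_neg \<mu> f"
    unfolding L2_neg_def using m by (rule semigroup_contraction[OF t])
  finally show ?thesis .
qed

text \<open>
  Chapman--Kolmogorov for functions that need not be bounded. Only nonnegative integrands can be
  disintegrated without further conditions, so the positive and the negative part are treated
  separately; the values at points where one of them has infinite integral do not matter, as such
  points form a null set.
\<close>

lemma semigroup_comp:
  assumes s: "s \<ge> 0" and t: "t \<ge> 0" and f: "f \<in> L2 \<mu>"
  shows "AE x in \<mu>. semigroup_app \<kappa> (s + t) f x = semigroup_app \<kappa> s (semigroup_app \<kappa> t f) x"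
proof -
  have fE [measurable]: "f \<in> borel_measurable E"
    using L2_measurable[OF f] by (simp add: borel_measurable_mu)
  have st: "s + t \<ge> 0"
    using s t by simp
  show ?thesis
    using AE_integrable_kernel[OF st f] AE_space
  proof eventually_elim
    case (elim x)
    then have x: "x \<in> space E"
      by (simp add: space_mu)
    let ?\<eta> = "\<kappa> s x"
    define a b where "a y = (\<integral>\<^sup>+z. ennreal (f z) \<partial>\<kappa> t y)" and "b y = (\<integral>\<^sup>+z. ennreal (- f z) \<partial>\<kappa> t y)" for y
    have [measurable_cong]: "sets ?\<eta> = sets E"
      by (rule sets_kernel[OF s x])
    have [measurable]: "a \<in> borel_measurable E" "b \<in> borel_measurable E"
      unfolding a_def b_def by (auto intro!: nn_integral_kernel_measurable t)
    have k: "\<kappa> t \<in> ?\<eta> \<rightarrow>\<^sub>M subprob_algebra E"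
      using kernel_subprob[OF t] by measurable
    have ab: "(\<integral>\<^sup>+z. ennreal (f z) \<partial>\<kappa> (s + t) x) = (\<integral>\<^sup>+y. a y \<partial>?\<eta>)"
      "(\<integral>\<^sup>+z. ennreal (- f z) \<partial>\<kappa> (s + t) x) = (\<integral>\<^sup>+y. b y \<partial>?\<eta>)"
      unfolding a_def b_def Chapman_Kolmogorov[OF s t x] by (auto intro!: nn_integral_bind[OF _ k])
    have fin: "(\<integral>\<^sup>+y. a y \<partial>?\<eta>) \<noteq> \<infinity>" "(\<integral>\<^sup>+y. b y \<partial>?\<eta>) \<noteq> \<infinity>"
      using elim(1) by (simp_all add: real_integrable_def flip: ab)
    have ae: "AE y in ?\<eta>. a y \<noteq> \<infinity>" "AE y in ?\<eta>. b y \<noteq> \<infinity>"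
      by (intro nn_integral_PInf_AE fin; measurable)+
    have a: "integrable ?\<eta> (\<lambda>y. enn2real (a y))" "(\<integral>y. enn2real (a y) \<partial>?\<eta>) = enn2real (\<integral>\<^sup>+y. a y \<partial>?\<eta>)"
    proof -
      have "(\<integral>\<^sup>+y. ennreal (enn2real (a y)) \<partial>?\<eta>) = (\<integral>\<^sup>+y. a y \<partial>?\<eta>)"
        using ae(1) by (intro nn_integral_cong_AE) (auto elim!: eventually_mono simp: less_top)
      then show "integrable ?\<eta> (\<lambda>y. enn2real (a y))" "(\<integral>y. enn2real (a y) \<partial>?\<eta>) = enn2real (\<integral>\<^sup>+y. a y \<partial>?\<eta>)"
        using fin(1) by (auto simp: integrable_iff_bounded integral_eq_nn_integral less_top)
    qed
    have b: "integrable ?\<eta> (\<lambda>y. enn2real (b y))" "(\<integral>y. enn2real (b y) \<partial>?\<eta>) = enn2real (\<integral>\<^sup>+y. b y \<partial>?\<eta>)"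
    proof -
      have "(\<integral>\<^sup>+y. ennreal (enn2real (b y)) \<partial>?\<eta>) = (\<integral>\<^sup>+y. b y \<partial>?\<eta>)"
        using ae(2) by (intro nn_integral_cong_AE) (auto elim!: eventually_mono simp: less_top)
      then show "integrable ?\<eta> (\<lambda>y. enn2real (b y))" "(\<integral>y. enn2real (b y) \<partial>?\<eta>) = enn2real (\<integral>\<^sup>+y. b y \<partial>?\<eta>)"
        using fin(2) by (auto simp: integrable_iff_bounded integral_eq_nn_integral less_top)
    qed
    have "AE y in ?\<eta>. semigroup_app \<kappa> t f y = enn2real (a y) - enn2real (b y)"
      using ae AE_space
    proof eventually_elim
      case (elim y)
      then have y: "y \<in> space E"
        using sets_eq_imp_space_eq[OF sets_kernel[OF s x]] by simp
      have "f \<in> borel_measurable (\<kappa> t y)"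
        unfolding borel_measurable_kernel[OF t y] by (rule fE)
      then have "integrable (\<kappa> t y) f"
        using elim by (simp add: real_integrable_def a_def b_def)
      then show ?case
        unfolding semigroup_app_def a_def b_def by (rule real_lebesgue_integral_def)
    qed
    moreover have "semigroup_app \<kappa> t f \<in> borel_measurable ?\<eta>"
      using semigroup_measurable[OF t f] borel_measurable_kernel[OF s x] by (simp add: borel_measurable_mu)
    ultimately have "semigroup_app \<kappa> s (semigroup_app \<kappa> t f) x
        = (\<integral>y. enn2real (a y) - enn2real (b y) \<partial>?\<eta>)"
      unfolding semigroup_app_def[of \<kappa> s] by (intro integral_cong_AE) auto
    also have "\<dots> = enn2real (\<integral>\<^sup>+y. a y \<partial>?\<eta>) - enn2real (\<integral>\<^sup>+y. b y \<partial>?\<eta>)"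
      using a b by simp
    also have "\<dots> = semigroup_app \<kappa> (s + t) f x"
      unfolding semigroup_app_def using real_lebesgue_integral_def[OF elim(1)] ab by simp
    finally show ?case ..
  qed
qed

end

section \<open>The generator\<close>

context stationary_semigroup
begin

abbreviation L :: "'a operator" where
  "L \<equiv> L2_generator \<mu> \<kappa>"

lemma generator_L2: "(u, v) \<in> L \<Longrightarrow> u \<in> L2 \<mu>" "(u, v) \<in> L \<Longrightarrow> v \<in> L2 \<mu>"
  by (auto simp: L2_generator_def)

lemma generator_tendsto:
  "(u, v) \<in> L \<Longrightarrow>
    ((\<lambda>t. L2_norm \<mu> (\<lambda>x. (semigroup_app \<kappa> t u x - u x) / t - v x)) \<longlongrightarrow> 0) (at_right 0)"
  by (auto simp: L2_generator_def)

lemma quotient_L2: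
  "t \<ge> 0 \<Longrightarrow> u \<in> L2 \<mu> \<Longrightarrow> (\<lambda>x. (semigroup_app \<kappa> t u x - u x) / t) \<in> L2 \<mu>"
  by (intro L2_intros semigroup_L2)

lemma generator_unique:
  assumes "(u, v) \<in> L" "(u, v') \<in> L"
  shows "AE x in \<mu>. v x = v' x"
proof -
  let ?q = "\<lambda>t x. (semigroup_app \<kappa> t u x - u x) / t"
  note L2s = generator_L2[OF assms(1)] generator_L2[OF assms(2)]
  have "\<forall>\<^sub>F t in at_right 0. L2_norm \<mu> (\<lambda>x. v x - v' x)
      \<le> L2_norm \<mu> (\<lambda>x. ?q t x - v x) + L2_norm \<mu> (\<lambda>x. ?q t x - v' x)"
    using eventually_at_right_less[of 0]
  proof eventually_elim
    case (elim t)
    then have "?q t \<in> L2 \<mu>"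
      by (intro quotient_L2 L2s) simp
    then show ?case
      using L2_norm_triangle_diff[OF L2s(2) _ L2s(4)] L2_norm_minus_commute[of \<mu> v "?q t"] by fastforce
  qed
  moreover have "((\<lambda>t. L2_norm \<mu> (\<lambda>x. ?q t x - v x) + L2_norm \<mu> (\<lambda>x. ?q t x - v' x)) \<longlongrightarrow> 0 + 0) (at_right 0)"
    using assms by (intro tendsto_add generator_tendsto)
  ultimately have "L2_norm \<mu> (\<lambda>x. v x - v' x) \<le> 0 + 0"
    by (intro tendsto_lowerbound) auto
  then have "L2_norm \<mu> (\<lambda>x. v x - v' x) = 0"
    using L2_norm_nonneg[of \<mu> "\<lambda>x. v x - v' x"] by simp
  then have "AE x in \<mu>. v x - v' x = 0"
    using L2s by (intro L2_norm_eq_0 L2_intros)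
  then show ?thesis
    by simp
qed

lemma generator_op_app:
  assumes "(u, v) \<in> L"
  shows "(u, op_app L u) \<in> L" "f \<in> L2 \<mu> \<Longrightarrow> L2_inner \<mu> f (op_app L u) = L2_inner \<mu> f v"
proof -
  show *: "(u, op_app L u) \<in> L"
    unfolding op_app_def by (rule someI[of "\<lambda>h. (u, h) \<in> L", OF assms])
  show "f \<in> L2 \<mu> \<Longrightarrow> L2_inner \<mu> f (op_app L u) = L2_inner \<mu> f v"
    using generator_unique[OF * assms] generator_L2[OF *] generator_L2[OF assms]
    by (intro L2_inner_cong_AE) auto
qed

lemma generator_lincomb:
  assumes "(u, v) \<in> L" "(a, b) \<in> L"
  shows "(\<lambda>x. u x + c * a x, \<lambda>x. v x + c * b x) \<in> L"
proof -
  note L2s = generator_L2[OF assms(1)] generator_L2[OF assms(2)]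
  let ?q = "\<lambda>f t x. (semigroup_app \<kappa> t f x - f x) / t"
  let ?f = "\<lambda>x. u x + c * a x" and ?h = "\<lambda>x. v x + c * b x"
  let ?b = "\<lambda>t. L2_norm \<mu> (\<lambda>x. ?q u t x - v x) + \<bar>c\<bar> * L2_norm \<mu> (\<lambda>x. ?q a t x - b x)"
  have mem: "?f \<in> L2 \<mu>" "?h \<in> L2 \<mu>"
    by (intro L2_intros L2s)+
  have "\<forall>\<^sub>F t in at_right 0. norm (L2_norm \<mu> (\<lambda>x. ?q ?f t x - ?h x)) \<le> ?b t"
    using eventually_at_right_less[of 0]
  proof eventually_elim
    case (elim t)
    have q: "?q u t \<in> L2 \<mu>" "?q a t \<in> L2 \<mu>" "?q ?f t \<in> L2 \<mu>"
      using elim by (intro quotient_L2 L2s mem; simp)+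
    have "AE x in \<mu>. ?q ?f t x - ?h x = (?q u t x - v x) + c * (?q a t x - b x)"
      using semigroup_add[OF _ L2s(1) L2_cmult[OF L2s(3)], of t c] elim
      by (auto simp: semigroup_cmult elim!: eventually_mono) (simp add: field_simps)
    then have "L2_norm \<mu> (\<lambda>x. ?q ?f t x - ?h x)
        = L2_norm \<mu> (\<lambda>x. (?q u t x - v x) + c * (?q a t x - b x))"
      using q mem L2s by (intro L2_norm_cong_AE L2_measurable L2_add L2_diff L2_cmult)
    also have "\<dots> \<le> ?b t"
      unfolding L2_norm_cmult[symmetric] using q L2s
      by (intro L2_norm_triangle L2_diff L2_cmult)
    finally show ?case
      by (simp add: L2_norm_nonneg)
  qed
  moreover have "(?b \<longlongrightarrow> 0) (at_right 0)"
    using tendsto_add[OF generator_tendsto[OF assms(1)]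
        tendsto_mult_right_zero[OF generator_tendsto[OF assms(2)], of "\<bar>c\<bar>"]] by simp
  ultimately have "((\<lambda>t. L2_norm \<mu> (\<lambda>x. ?q ?f t x - ?h x)) \<longlongrightarrow> 0) (at_right 0)"
    by (rule Lim_null_comparison)
  then show ?thesis
    using mem by (simp add: L2_generator_def)
qed

text \<open>
  Contractivity gives \<open>\<langle>u, P\<^sub>t u - u\<rangle> \<le> 0\<close>; divide by \<open>t\<close> and let \<open>t \<rightarrow> 0\<close>.
\<close>

lemma generator_dissipative:
  assumes "(u, v) \<in> L"
  shows "L2_inner \<mu> u v \<le> 0"
proof -
  note L2s = generator_L2[OF assms(1)]
  let ?q = "\<lambda>t x. (semigroup_app \<kappa> t u x - u x) / t"
  have "\<forall>\<^sub>F t in at_right 0. L2_inner \<mu> u v \<le> L2_norm \<mu> u * L2_norm \<mu> (\<lambda>x. ?q t x - v x)"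
    using eventually_at_right_less[of 0]
  proof eventually_elim
    case (elim t)
    have P: "semigroup_app \<kappa> t u \<in> L2 \<mu>"
      using elim L2s by (intro semigroup_L2) auto
    have q: "?q t \<in> L2 \<mu>"
      using elim L2s by (intro quotient_L2) auto
    have "L2_inner \<mu> u (semigroup_app \<kappa> t u) \<le> L2_norm \<mu> u * L2_norm \<mu> (semigroup_app \<kappa> t u)"
      using L2_Cauchy_Schwarz[OF L2s(1) P] by simp
    also have "\<dots> \<le> L2_norm \<mu> u * L2_norm \<mu> u"
      using elim L2s by (intro mult_left_mono semigroup_contraction L2_norm_nonneg) auto
    finally have "L2_inner \<mu> u (\<lambda>x. semigroup_app \<kappa> t u x - u x) \<le> 0"
      using P L2s by (simp add: L2_inner_linear L2_norm_sq[symmetric] power2_eq_square)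
    then have "L2_inner \<mu> u (\<lambda>x. 1 / t * (semigroup_app \<kappa> t u x - u x)) \<le> 0"
      using elim unfolding L2_inner_cmult_right by (simp add: divide_nonpos_pos)
    then have "L2_inner \<mu> u (?q t) \<le> 0"
      by simp
    moreover have "- (L2_inner \<mu> u (?q t) - L2_inner \<mu> u v) \<le> L2_norm \<mu> u * L2_norm \<mu> (\<lambda>x. ?q t x - v x)"
      using L2_Cauchy_Schwarz[OF L2s(1) L2_diff[OF q L2s(2)]] L2_inner_diff_right[OF q L2s(2,1)] by simp
    ultimately show ?case
      by simp
  qed
  moreover have "((\<lambda>t. L2_norm \<mu> u * L2_norm \<mu> (\<lambda>x. ?q t x - v x)) \<longlongrightarrow> L2_norm \<mu> u * 0) (at_right 0)"
    using assms by (intro tendsto_mult tendsto_const generator_tendsto)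
  ultimately have "L2_inner \<mu> u v \<le> L2_norm \<mu> u * 0"
    by (intro tendsto_lowerbound) auto
  then show ?thesis
    by simp
qed

text \<open>
  With \<open>Q\<^sub>t = exp (- \<gamma> t) P\<^sub>t\<close> one has formally \<open>u - Q\<^sub>t u = \<integral>\<^sub>0\<^sup>t Q\<^sub>s (\<gamma> u - L u) ds\<close>, so the negative part
  of \<open>u - Q\<^sub>t u\<close> is bounded by \<open>t\<close> times that of \<open>\<gamma> u - L u\<close>. Integrals of curves in \<open>L\<^sup>2\<close> are avoided:
  as \<open>Q\<^sub>s\<close> does not increase negative parts, \<open>t \<mapsto> L2_neg (u - Q\<^sub>t u)\<close> satisfies \<open>p (m s) \<le> m p s\<close>, and its
  slope at \<open>0\<close> is at most \<open>L2_neg (\<gamma> u - L u)\<close> because \<open>(u - Q\<^sub>s u)/s \<rightarrow> \<gamma> u - L u\<close>.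
\<close>

lemma excessive_defect_le:
  assumes "(u, v) \<in> L" and t: "0 \<le> t" and \<gamma>: "0 \<le> \<gamma>"
  shows "L2_neg \<mu> (\<lambda>x. u x - exp (- \<gamma> * t) * semigroup_app \<kappa> t u x)
    \<le> t * L2_neg \<mu> (\<lambda>x. \<gamma> * u x - v x)"
proof -
  note L2s = generator_L2[OF assms(1)]
  define Q where "Q s x = exp (- \<gamma> * s) * semigroup_app \<kappa> s u x" for s x
  define p where "p s = L2_neg \<mu> (\<lambda>x. u x - Q s x)" for s
  define e where "e s = L2_norm \<mu> (\<lambda>x. (semigroup_app \<kappa> s u x - u x) / s - v x)
    + \<bar>(1 - exp (- \<gamma> * s)) / s - \<gamma>\<bar> * L2_norm \<mu> u + \<bar>1 - exp (- \<gamma> * s)\<bar> * L2_norm \<mu> v" for s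
  have QL2: "Q s \<in> L2 \<mu>" if "s \<ge> 0" for s
    unfolding Q_def using that L2s by (intro L2_intros semigroup_L2)
  \<comment> \<open>The difference quotient of \<open>Q\<close> differs from \<open>\<gamma> u - v\<close> by at most \<open>e s\<close> in norm.\<close>
  have rate: "p s \<le> s * (L2_neg \<mu> (\<lambda>x. \<gamma> * u x - v x) + e s)" if s: "s > 0" for s
  proof -
    let ?E = "exp (- \<gamma> * s)"
    let ?q = "\<lambda>x. (semigroup_app \<kappa> s u x - u x) / s"
    have q: "?q \<in> L2 \<mu>"
      using s L2s by (intro quotient_L2) auto
    have "(\<lambda>x. s * ((1 / s) * (u x - Q s x))) = (\<lambda>x. u x - Q s x)"
      using s by simp
    then have "p s = s * L2_neg \<mu> (\<lambda>x. (1 / s) * (u x - Q s x))"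
      using s unfolding p_def by (subst L2_neg_cmult[symmetric]) simp_all
    also have "L2_neg \<mu> (\<lambda>x. (1 / s) * (u x - Q s x)) \<le> L2_neg \<mu> (\<lambda>x. \<gamma> * u x - v x)
        + L2_norm \<mu> (\<lambda>x. (1 / s) * (u x - Q s x) - (\<gamma> * u x - v x))"
      using s L2s QL2 by (intro L2_neg_perturb L2_diff L2_cmult) auto
    also have "(\<lambda>x. (1 / s) * (u x - Q s x) - (\<gamma> * u x - v x))
        = (\<lambda>x. (- ?E) * (?q x - v x) + (((1 - ?E) / s - \<gamma>) * u x + (1 - ?E) * v x))"
      using s by (intro ext) (simp add: Q_def field_simps)
    also have "L2_norm \<mu> \<dots> \<le> L2_norm \<mu> (\<lambda>x. (- ?E) * (?q x - v x))
        + L2_norm \<mu> (\<lambda>x. ((1 - ?E) / s - \<gamma>) * u x + (1 - ?E) * v x)"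
      using q L2s by (intro L2_norm_triangle L2_add L2_diff L2_cmult)
    also have "L2_norm \<mu> (\<lambda>x. ((1 - ?E) / s - \<gamma>) * u x + (1 - ?E) * v x)
        \<le> \<bar>(1 - ?E) / s - \<gamma>\<bar> * L2_norm \<mu> u + \<bar>1 - ?E\<bar> * L2_norm \<mu> v"
      unfolding L2_norm_cmult[symmetric] using L2s by (intro L2_norm_triangle L2_cmult)
    also have "L2_norm \<mu> (\<lambda>x. (- ?E) * (?q x - v x)) \<le> L2_norm \<mu> (\<lambda>x. ?q x - v x)"
      unfolding L2_norm_cmult using s \<gamma> by (intro mult_left_le_one_le L2_norm_nonneg) auto
    finally show ?thesis
      using s by (simp add: e_def add.assoc)
  qed
  \<comment> \<open>Telescoping: \<open>u - Q\<^bsub>(m+1)s\<^esub> u = (u - Q\<^bsub>ms\<^esub> u) + Q\<^bsub>ms\<^esub> (u - Q\<^sub>s u)\<close>.\<close>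
  have additive: "p (real m * s) \<le> real m * p s" if s: "s \<ge> 0" for m s
  proof (induction m)
    case 0
    have "AE x in \<mu>. u x - Q 0 x = 0"
      using AE_space
    proof eventually_elim
      case (elim x)
      then have "x \<in> space E" by (simp add: space_mu)
      moreover have "u \<in> borel_measurable E"
        using L2_measurable[OF L2s(1)] by (simp add: borel_measurable_mu)
      ultimately show ?case
        by (simp add: Q_def semigroup_app_def kernel_0 integral_return)
    qed
    then have "L2_neg \<mu> (\<lambda>x. u x - Q 0 x) = 0"
      using L2s QL2 by (subst L2_neg_eq_0_iff) (auto intro!: L2_diff elim: eventually_mono)
    then show ?case
      by (simp add: p_def)
  next
    case (Suc m)
    let ?d = "\<lambda>x. u x - Q s x" and ?r = "real m * s"
    have r: "?r \<ge> 0" using s by simp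
    have d: "?d \<in> L2 \<mu>"
      using L2s QL2 s by (intro L2_diff)
    have Pd: "semigroup_app \<kappa> ?r ?d \<in> L2 \<mu>"
      by (intro semigroup_L2 r d)
    have "AE x in \<mu>. exp (- \<gamma> * ?r) * semigroup_app \<kappa> ?r ?d x = Q ?r x - Q (real (Suc m) * s) x"
      using semigroup_diff[OF r L2s(1) QL2[OF s]] semigroup_comp[OF r s L2s(1)]
    proof eventually_elim
      case (elim x)
      have "semigroup_app \<kappa> ?r (Q s) x = exp (- \<gamma> * s) * semigroup_app \<kappa> (real (Suc m) * s) u x"
        unfolding Q_def semigroup_cmult elim(2)[symmetric] by (simp add: algebra_simps)
      moreover have "exp (- \<gamma> * ?r) * exp (- \<gamma> * s) = exp (- \<gamma> * (real (Suc m) * s))"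
        by (simp add: exp_add[symmetric] algebra_simps)
      ultimately show ?case
        unfolding elim(1) by (simp add: Q_def right_diff_distrib mult.assoc[symmetric])
    qed
    then have "AE x in \<mu>. (u x - Q ?r x) + exp (- \<gamma> * ?r) * semigroup_app \<kappa> ?r ?d x
        \<le> u x - Q (real (Suc m) * s) x"
      by eventually_elim simp
    then have "p (real (Suc m) * s)
        \<le> L2_neg \<mu> (\<lambda>x. (u x - Q ?r x) + exp (- \<gamma> * ?r) * semigroup_app \<kappa> ?r ?d x)"
      unfolding p_def using s r L2s Pd
      by (intro L2_neg_mono L2_add L2_diff L2_cmult QL2) auto
    also have "\<dots> \<le> p ?r + L2_neg \<mu> (\<lambda>x. exp (- \<gamma> * ?r) * semigroup_app \<kappa> ?r ?d x)"
      unfolding p_def using s r L2s Pd by (intro L2_neg_add L2_diff L2_cmult QL2)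
    also have "L2_neg \<mu> (\<lambda>x. exp (- \<gamma> * ?r) * semigroup_app \<kappa> ?r ?d x)
        = exp (- \<gamma> * ?r) * L2_neg \<mu> (semigroup_app \<kappa> ?r ?d)"
      by (rule L2_neg_cmult) simp
    also have "\<dots> \<le> 1 * p s"
      unfolding p_def using r \<gamma>
      by (intro mult_mono semigroup_neg d L2_neg_nonneg) auto
    finally show ?case
      using Suc.IH by (simp add: algebra_simps)
  qed
  show ?thesis
  proof (cases "t = 0")
    case True
    then show ?thesis
      using additive[of 0 0] by (simp add: p_def Q_def)
  next
    case False
    with t have t: "t > 0" by simp
    define s where "s n = t * inverse (real (Suc n))" for n
    have s: "s n > 0" "real (Suc n) * s n = t" for n
      using t by (auto simp: s_def)
    have "((\<lambda>h. (exp (- \<gamma> * (0 + h)) - exp (- \<gamma> * 0)) / h) \<longlongrightarrow> - \<gamma>) (at 0)"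
      by (rule DERIV_D) (auto intro!: derivative_eq_intros)
    then have "((\<lambda>h. (exp (- \<gamma> * h) - 1) / h) \<longlongrightarrow> - \<gamma>) (at_right 0)"
      by (simp add: filterlim_at_split)
    then have "((\<lambda>h. - ((exp (- \<gamma> * h) - 1) / h)) \<longlongrightarrow> - (- \<gamma>)) (at_right 0)"
      by (rule tendsto_minus)
    then have D: "((\<lambda>h. (1 - exp (- \<gamma> * h)) / h) \<longlongrightarrow> \<gamma>) (at_right 0)"
      by (simp add: minus_divide_left)
    have "(e \<longlongrightarrow> 0 + \<bar>\<gamma> - \<gamma>\<bar> * L2_norm \<mu> u + \<bar>1 - exp (- \<gamma> * 0)\<bar> * L2_norm \<mu> v) (at_right 0)"
      unfolding e_def by (intro tendsto_intros generator_tendsto[OF assms(1)] D)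
    moreover have "s \<longlonglongrightarrow> 0"
      unfolding s_def by (rule tendsto_mult_right_zero[OF LIMSEQ_inverse_real_of_nat])
    then have "filterlim s (at_right 0) sequentially"
      using s(1) by (auto simp: filterlim_at less_imp_neq[THEN not_sym] intro!: always_eventually)
    ultimately have "(\<lambda>n. e (s n)) \<longlonglongrightarrow> 0"
      by (auto intro: filterlim_compose)
    then have "(\<lambda>n. t * (L2_neg \<mu> (\<lambda>x. \<gamma> * u x - v x) + e (s n)))
        \<longlonglongrightarrow> t * (L2_neg \<mu> (\<lambda>x. \<gamma> * u x - v x) + 0)"
      by (intro tendsto_intros)
    moreover have "p t \<le> t * (L2_neg \<mu> (\<lambda>x. \<gamma> * u x - v x) + e (s n))" for n
    proof -
      have "p t \<le> real (Suc n) * p (s n)"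
        using additive[of "s n" "Suc n"] s[of n] by simp
      also have "\<dots> \<le> real (Suc n) * (s n * (L2_neg \<mu> (\<lambda>x. \<gamma> * u x - v x) + e (s n)))"
        by (intro mult_left_mono rate s) simp
      finally show ?thesis
        by (simp only: mult.assoc[symmetric] s)
    qed
    ultimately have "p t \<le> t * (L2_neg \<mu> (\<lambda>x. \<gamma> * u x - v x) + 0)"
      by (intro LIMSEQ_le_const) auto
    then show ?thesis
      by (simp add: p_def Q_def)
  qed
qed

end

section \<open>The closure of the generator on the core\<close>

lemma is_core_approx:
  assumes core: "is_core M A C" and fh: "(f, h) \<in> A" and "\<epsilon> > 0"
  obtains u v where "(u, v) \<in> A" "u \<in> C"
    "L2_norm M (\<lambda>x. u x - f x) < \<epsilon>" "L2_norm M (\<lambda>x. v x - h x) < \<epsilon>"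
proof -
  have "\<forall>(f, h)\<in>A. \<forall>\<epsilon>>0. \<exists>(u, v)\<in>A. u \<in> C \<and>
       L2_norm M (\<lambda>x. u x - f x) < \<epsilon> \<and> L2_norm M (\<lambda>x. v x - h x) < \<epsilon>"
    using core unfolding is_core_def by (elim conjE)
  from bspec[OF this fh] \<open>\<epsilon> > 0\<close> that show thesis
    by auto
qed

locale sectorial_core = stationary_semigroup E \<kappa> \<mu>
  for E :: "'a measure" and \<kappa> :: "real \<Rightarrow> 'a \<Rightarrow> 'a measure" and \<mu> :: "'a measure" +
  fixes C :: "('a \<Rightarrow> real) set" and K :: real
  assumes core: "is_core \<mu> (L2_generator \<mu> \<kappa>) C"
    and core_adjoint: "is_core \<mu> (L2_adjoint \<mu> (L2_generator \<mu> \<kappa>)) C"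
    and sector: "sector_condition \<mu> (L2_generator \<mu> \<kappa>) C K"
    and K_pos: "K > 0"
begin

definition core_graph :: "'a operator" where
  "core_graph = {(u, v) \<in> L. u \<in> C}"

text \<open>
  The graph closure replaces the domain of \<open>L\<close>. It contains \<open>L\<close> by the core property and is closed
  by construction, while everything that survives limits in the graph norm, in particular the
  sector condition, holds on it because it holds on the core.
\<close>

definition core_closure :: "'a operator" where
  "core_closure = {(u, v). u \<in> L2 \<mu> \<and> v \<in> L2 \<mu> \<and> (\<forall>\<epsilon>>0. \<exists>(a, b)\<in>core_graph.
    L2_norm \<mu> (\<lambda>x. a x - u x) < \<epsilon> \<and> L2_norm \<mu> (\<lambda>x. b x - v x) < \<epsilon>)}"

lemma core_graph_L: "(u, v) \<in> core_graph \<Longrightarrow> (u, v) \<in> L"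
  by (simp add: core_graph_def)

lemma core_graph_L2: "(u, v) \<in> core_graph \<Longrightarrow> u \<in> L2 \<mu>" "(u, v) \<in> core_graph \<Longrightarrow> v \<in> L2 \<mu>"
  by (auto simp: core_graph_def intro: generator_L2)

lemma core_closure_L2: "(u, v) \<in> core_closure \<Longrightarrow> u \<in> L2 \<mu>" "(u, v) \<in> core_closure \<Longrightarrow> v \<in> L2 \<mu>"
  by (auto simp: core_closure_def)

lemma core_graph_lincomb:
  assumes "(u, v) \<in> core_graph" "(a, b) \<in> core_graph"
  shows "(\<lambda>x. u x + c * a x, \<lambda>x. v x + c * b x) \<in> core_graph"
proof -
  have "u \<in> C" "(\<lambda>x. c * a x) \<in> C"
    using assms core by (auto simp: core_graph_def is_core_def)
  then have "(\<lambda>x. u x + c * a x) \<in> C"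
    using core by (simp add: is_core_def)
  then show ?thesis
    using assms generator_lincomb by (simp add: core_graph_def)
qed

lemma core_graph_zero: "\<exists>v. (\<lambda>x. 0, v) \<in> core_graph"
  using core by (auto simp: core_graph_def is_core_def)

lemma generator_core_closure:
  assumes "(u, v) \<in> L"
  shows "(u, v) \<in> core_closure"
proof -
  have "\<exists>(a, b)\<in>core_graph. L2_norm \<mu> (\<lambda>x. a x - u x) < \<epsilon> \<and> L2_norm \<mu> (\<lambda>x. b x - v x) < \<epsilon>" if \<epsilon>: "\<epsilon> > 0" for \<epsilon>
  proof -
    obtain a b where "(a, b) \<in> L" "a \<in> C"
      "L2_norm \<mu> (\<lambda>x. a x - u x) < \<epsilon>" "L2_norm \<mu> (\<lambda>x. b x - v x) < \<epsilon>"
      using is_core_approx[OF core assms \<epsilon>] by blast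
    then show ?thesis
      by (intro bexI[of _ "(a, b)"]) (simp_all add: core_graph_def)
  qed
  then show ?thesis
    using generator_L2[OF assms] by (simp add: core_closure_def)
qed

lemma core_closure_sequence:
  assumes "(u, v) \<in> core_closure"
  obtains U V where "\<And>n. (U n, V n) \<in> core_graph"
    "(\<lambda>n. L2_norm \<mu> (\<lambda>x. U n x - u x)) \<longlonglongrightarrow> 0" "(\<lambda>n. L2_norm \<mu> (\<lambda>x. V n x - v x)) \<longlonglongrightarrow> 0"
proof -
  have "\<forall>n. \<exists>p. p \<in> core_graph \<and> L2_norm \<mu> (\<lambda>x. fst p x - u x) < inverse (real (Suc n))
      \<and> L2_norm \<mu> (\<lambda>x. snd p x - v x) < inverse (real (Suc n))"
  proof
    fix n
    have "inverse (real (Suc n)) > 0"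
      by simp
    then obtain a b where "(a, b) \<in> core_graph" "L2_norm \<mu> (\<lambda>x. a x - u x) < inverse (real (Suc n))"
      "L2_norm \<mu> (\<lambda>x. b x - v x) < inverse (real (Suc n))"
      using assms unfolding core_closure_def by blast
    then show "\<exists>p. p \<in> core_graph \<and> L2_norm \<mu> (\<lambda>x. fst p x - u x) < inverse (real (Suc n))
      \<and> L2_norm \<mu> (\<lambda>x. snd p x - v x) < inverse (real (Suc n))"
      by (intro exI[of _ "(a, b)"]) simp
  qed
  then obtain p where p: "\<And>n. p n \<in> core_graph"
    "\<And>n. L2_norm \<mu> (\<lambda>x. fst (p n) x - u x) < inverse (real (Suc n))"
    "\<And>n. L2_norm \<mu> (\<lambda>x. snd (p n) x - v x) < inverse (real (Suc n))"
    by - (drule choice, blast)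
  show thesis
  proof (rule that)
    show "(fst (p n), snd (p n)) \<in> core_graph" for n
      using p(1) by simp
    show "(\<lambda>n. L2_norm \<mu> (\<lambda>x. fst (p n) x - u x)) \<longlonglongrightarrow> 0"
      "(\<lambda>n. L2_norm \<mu> (\<lambda>x. snd (p n) x - v x)) \<longlonglongrightarrow> 0"
      by (rule L2_norm_tendsto_0[OF less_imp_le LIMSEQ_inverse_real_of_nat], rule p)+
  qed
qed

lemma core_closure_closed:
  assumes UV: "\<And>n. (U n, V n) \<in> core_closure" and uv: "u \<in> L2 \<mu>" "v \<in> L2 \<mu>"
    and lim: "(\<lambda>n. L2_norm \<mu> (\<lambda>x. U n x - u x)) \<longlonglongrightarrow> 0" "(\<lambda>n. L2_norm \<mu> (\<lambda>x. V n x - v x)) \<longlonglongrightarrow> 0"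
  shows "(u, v) \<in> core_closure"
proof -
  have "\<exists>(a, b)\<in>core_graph. L2_norm \<mu> (\<lambda>x. a x - u x) < \<epsilon> \<and> L2_norm \<mu> (\<lambda>x. b x - v x) < \<epsilon>" if "\<epsilon> > 0" for \<epsilon>
  proof -
    have "\<forall>\<^sub>F n in sequentially. L2_norm \<mu> (\<lambda>x. U n x - u x) < \<epsilon> / 2"
      "\<forall>\<^sub>F n in sequentially. L2_norm \<mu> (\<lambda>x. V n x - v x) < \<epsilon> / 2"
      using order_tendstoD(2)[OF lim(1), of "\<epsilon> / 2"] order_tendstoD(2)[OF lim(2), of "\<epsilon> / 2"] that
      by simp_all
    then have "\<forall>\<^sub>F n in sequentially. L2_norm \<mu> (\<lambda>x. U n x - u x) < \<epsilon> / 2 \<and>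
        L2_norm \<mu> (\<lambda>x. V n x - v x) < \<epsilon> / 2"
      by eventually_elim simp
    then obtain n where n: "L2_norm \<mu> (\<lambda>x. U n x - u x) < \<epsilon> / 2" "L2_norm \<mu> (\<lambda>x. V n x - v x) < \<epsilon> / 2"
      by (auto dest: eventually_happens)
    have "\<epsilon> / 2 > 0" using that by simp
    then obtain a b where ab: "(a, b) \<in> core_graph" "L2_norm \<mu> (\<lambda>x. a x - U n x) < \<epsilon> / 2"
      "L2_norm \<mu> (\<lambda>x. b x - V n x) < \<epsilon> / 2"
      using UV[of n] unfolding core_closure_def by blast
    have "L2_norm \<mu> (\<lambda>x. a x - u x) < \<epsilon>"
      using n ab L2_norm_triangle_diff[OF core_graph_L2(1)[OF ab(1)] core_closure_L2(1)[OF UV[of n]] uv(1)] by simp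
    moreover have "L2_norm \<mu> (\<lambda>x. b x - v x) < \<epsilon>"
      using n ab L2_norm_triangle_diff[OF core_graph_L2(2)[OF ab(1)] core_closure_L2(2)[OF UV[of n]] uv(2)] by simp
    ultimately show ?thesis
      using ab(1) by auto
  qed
  then show ?thesis
    using uv by (simp add: core_closure_def)
qed

lemma core_graph_core_closure: "(u, v) \<in> core_graph \<Longrightarrow> (u, v) \<in> core_closure"
  by (intro generator_core_closure core_graph_L)

lemma core_closure_diff:
  assumes "(u, v) \<in> core_closure" "(a, b) \<in> core_closure"
  shows "(\<lambda>x. u x - a x, \<lambda>x. v x - b x) \<in> core_closure"
proof -
  obtain U V where UV: "\<And>n. (U n, V n) \<in> core_graph"
    "(\<lambda>n. L2_norm \<mu> (\<lambda>x. U n x - u x)) \<longlonglongrightarrow> 0" "(\<lambda>n. L2_norm \<mu> (\<lambda>x. V n x - v x)) \<longlonglongrightarrow> 0"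
    using core_closure_sequence[OF assms(1)] by blast
  obtain A B where AB: "\<And>n. (A n, B n) \<in> core_graph"
    "(\<lambda>n. L2_norm \<mu> (\<lambda>x. A n x - a x)) \<longlonglongrightarrow> 0" "(\<lambda>n. L2_norm \<mu> (\<lambda>x. B n x - b x)) \<longlonglongrightarrow> 0"
    using core_closure_sequence[OF assms(2)] by blast
  note L2s = core_closure_L2[OF assms(1)] core_closure_L2[OF assms(2)] core_graph_L2[OF UV(1)] core_graph_L2[OF AB(1)]
  have 1: "(\<lambda>n. L2_norm \<mu> (\<lambda>x. (U n x - A n x) - (u x - a x))) \<longlonglongrightarrow> 0"
  proof (rule L2_norm_tendsto_0)
    show "L2_norm \<mu> (\<lambda>x. (U n x - A n x) - (u x - a x))
      \<le> L2_norm \<mu> (\<lambda>x. U n x - u x) + L2_norm \<mu> (\<lambda>x. A n x - a x)" for n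
      using L2_norm_diff_le[of "\<lambda>x. U n x - u x" \<mu> "\<lambda>x. A n x - a x"] L2s
      by (simp add: L2_intros algebra_simps)
  qed (use tendsto_add[OF UV(2) AB(2)] in simp)
  have 2: "(\<lambda>n. L2_norm \<mu> (\<lambda>x. (V n x - B n x) - (v x - b x))) \<longlonglongrightarrow> 0"
  proof (rule L2_norm_tendsto_0)
    show "L2_norm \<mu> (\<lambda>x. (V n x - B n x) - (v x - b x))
      \<le> L2_norm \<mu> (\<lambda>x. V n x - v x) + L2_norm \<mu> (\<lambda>x. B n x - b x)" for n
      using L2_norm_diff_le[of "\<lambda>x. V n x - v x" \<mu> "\<lambda>x. B n x - b x"] L2s
      by (simp add: L2_intros algebra_simps)
  qed (use tendsto_add[OF UV(3) AB(3)] in simp)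
  have 3: "(\<lambda>x. U n x - A n x, \<lambda>x. V n x - B n x) \<in> core_closure" for n
    using core_graph_lincomb[OF UV(1) AB(1), of n "-1" n] by (simp add: core_graph_core_closure)
  show ?thesis
    by (rule core_closure_closed[OF 3 _ _ 1 2]) (intro L2_diff L2s)+
qed

lemma core_closure_dissipative:
  assumes "(u, v) \<in> core_closure"
  shows "L2_inner \<mu> u v \<le> 0"
proof -
  obtain U V where UV: "\<And>n. (U n, V n) \<in> core_graph"
    "(\<lambda>n. L2_norm \<mu> (\<lambda>x. U n x - u x)) \<longlonglongrightarrow> 0" "(\<lambda>n. L2_norm \<mu> (\<lambda>x. V n x - v x)) \<longlonglongrightarrow> 0"
    using core_closure_sequence[OF assms(1)] by blast
  have "(\<lambda>n. L2_inner \<mu> (U n) (V n)) \<longlonglongrightarrow> L2_inner \<mu> u v"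
    by (intro L2_inner_tendsto UV core_graph_L2[OF UV(1)] core_closure_L2[OF assms])
  then show ?thesis
    by (rule LIMSEQ_le_const2) (auto intro: generator_dissipative core_graph_L UV)
qed

lemma adjoint_symmetric:
  assumes "f \<in> C" "(f, h) \<in> L2_adjoint \<mu> L" "(f, f') \<in> L"
  shows "L2_inner \<mu> f h = L2_inner \<mu> f f'"
  using assms by (auto simp: L2_adjoint_def L2_inner_commute[of \<mu> f' f])

text \<open>
  On the core the symmetric part enters only through the Dirichlet form:
  \<open>\<langle>f, S f\<rangle> = (\<langle>f, L f\<rangle> + \<langle>f, L\<^sup>* f\<rangle>) / 2 = \<langle>f, L f\<rangle>\<close>. The signs cancel on both sides.
\<close>

lemma sector_core_graph:
  assumes f: "(f, f') \<in> core_graph" and g: "(g, g') \<in> core_graph"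
  shows "(L2_inner \<mu> f g')\<^sup>2 \<le> K * L2_inner \<mu> f f' * L2_inner \<mu> g g'"
proof -
  have sym: "L2_inner \<mu> f (\<lambda>x. - sym_part \<mu> L f x) = - L2_inner \<mu> f f'" if f: "(f, f') \<in> core_graph" for f f'
  proof -
    have fC: "f \<in> C" "(f, f') \<in> L" "f \<in> L2 \<mu>"
      using f core_graph_L2[OF f] by (auto simp: core_graph_def)
    then obtain h where "(f, h) \<in> L2_adjoint \<mu> L"
      using core_adjoint by (auto simp: is_core_def)
    then have adj: "(f, op_app (L2_adjoint \<mu> L) f) \<in> L2_adjoint \<mu> L"
      unfolding op_app_def by (rule someI[of "\<lambda>h. (f, h) \<in> L2_adjoint \<mu> L"])
    then have L2s: "op_app (L2_adjoint \<mu> L) f \<in> L2 \<mu>" "op_app L f \<in> L2 \<mu>"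
      using generator_L2(2)[OF generator_op_app(1)[OF fC(2)]] by (auto simp: L2_adjoint_def)
    have "L2_inner \<mu> f (\<lambda>x. 1/2 * (op_app L f x + op_app (L2_adjoint \<mu> L) f x)) = L2_inner \<mu> f f'"
      unfolding L2_inner_cmult_right L2_inner_add_right[OF L2s(2,1) fC(3)]
      using generator_op_app(2)[OF fC(2,3)] adjoint_symmetric[OF fC(1) adj fC(2)] by simp
    then show ?thesis
      unfolding L2_inner_uminus_right by (simp add: sym_part_def)
  qed
  have "(L2_inner \<mu> f (\<lambda>x. - op_app L g x))\<^sup>2
      \<le> K * L2_inner \<mu> f (\<lambda>x. - sym_part \<mu> L f x) * L2_inner \<mu> g (\<lambda>x. - sym_part \<mu> L g x)"
    using sector f g by (auto simp: sector_condition_def core_graph_def)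
  then show ?thesis
    unfolding sym[OF f] sym[OF g]
    using generator_op_app(2)[OF core_graph_L[OF g] core_graph_L2(1)[OF f]] by (simp add: L2_inner_uminus_right)
qed

lemma sector_core_closure:
  assumes f: "(f, f') \<in> core_closure" and g: "(g, g') \<in> core_closure"
  shows "(L2_inner \<mu> f g')\<^sup>2 \<le> K * L2_inner \<mu> f f' * L2_inner \<mu> g g'"
proof -
  obtain U V where UV: "\<And>n. (U n, V n) \<in> core_graph"
    "(\<lambda>n. L2_norm \<mu> (\<lambda>x. U n x - f x)) \<longlonglongrightarrow> 0" "(\<lambda>n. L2_norm \<mu> (\<lambda>x. V n x - f' x)) \<longlonglongrightarrow> 0"
    using core_closure_sequence[OF f] by blast
  obtain A B where AB: "\<And>n. (A n, B n) \<in> core_graph"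
    "(\<lambda>n. L2_norm \<mu> (\<lambda>x. A n x - g x)) \<longlonglongrightarrow> 0" "(\<lambda>n. L2_norm \<mu> (\<lambda>x. B n x - g' x)) \<longlonglongrightarrow> 0"
    using core_closure_sequence[OF g] by blast
  note L2s = core_closure_L2[OF f] core_closure_L2[OF g] core_graph_L2[OF UV(1)] core_graph_L2[OF AB(1)]
  have "(\<lambda>n. (L2_inner \<mu> (U n) (B n))\<^sup>2) \<longlonglongrightarrow> (L2_inner \<mu> f g')\<^sup>2"
    by (intro tendsto_power L2_inner_tendsto UV AB L2s)
  moreover have "(\<lambda>n. K * L2_inner \<mu> (U n) (V n) * L2_inner \<mu> (A n) (B n))
      \<longlonglongrightarrow> K * L2_inner \<mu> f f' * L2_inner \<mu> g g'"
    by (intro tendsto_mult tendsto_const L2_inner_tendsto UV AB L2s)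
  ultimately show ?thesis
    by (rule LIMSEQ_le) (auto intro: sector_core_graph UV AB)
qed

lemma core_closure_accretive:
  assumes "(u, v) \<in> core_closure" "\<beta> \<ge> 0"
  shows "\<beta> * L2_norm \<mu> u \<le> L2_norm \<mu> (\<lambda>x. \<beta> * u x - v x)"
proof (cases "L2_norm \<mu> u = 0")
  case False
  note L2s = core_closure_L2[OF assms(1)]
  have "\<beta> * (L2_norm \<mu> u * L2_norm \<mu> u) = \<beta> * L2_inner \<mu> u u"
    by (simp add: L2_norm_sq[symmetric] power2_eq_square)
  also have "\<dots> \<le> L2_inner \<mu> u (\<lambda>x. \<beta> * u x - v x)"
    using core_closure_dissipative[OF assms(1)] L2s by (simp add: L2_inner_linear L2_intros)
  also have "\<dots> \<le> L2_norm \<mu> u * L2_norm \<mu> (\<lambda>x. \<beta> * u x - v x)"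
    using L2_Cauchy_Schwarz[of u \<mu> "\<lambda>x. \<beta> * u x - v x"] L2s by (simp add: L2_intros)
  finally show ?thesis
    using False L2_norm_nonneg[of \<mu> u] by (simp add: mult.left_commute)
qed (simp add: L2_norm_nonneg)

text \<open>
  The adjoint inherits dissipativity because \<open>C\<close> is a core for it too, and
  \<open>\<langle>a, L\<^sup>* a\<rangle> = \<langle>a, L a\<rangle> \<le> 0\<close> for \<open>a\<close> in \<open>C\<close>.
\<close>

lemma adjoint_dissipative:
  assumes "(r, h) \<in> L2_adjoint \<mu> L"
  shows "L2_inner \<mu> r h \<le> 0"
proof -
  have L2s: "r \<in> L2 \<mu>" "h \<in> L2 \<mu>"
    using assms by (auto simp: L2_adjoint_def)
  have "\<forall>n. \<exists>p. p \<in> L2_adjoint \<mu> L \<and> fst p \<in> C \<and> L2_norm \<mu> (\<lambda>x. fst p x - r x) < inverse (real (Suc n))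
      \<and> L2_norm \<mu> (\<lambda>x. snd p x - h x) < inverse (real (Suc n))"
  proof
    fix n
    have "inverse (real (Suc n)) > 0" by simp
    then obtain a b where "(a, b) \<in> L2_adjoint \<mu> L" "a \<in> C"
      "L2_norm \<mu> (\<lambda>x. a x - r x) < inverse (real (Suc n))"
      "L2_norm \<mu> (\<lambda>x. b x - h x) < inverse (real (Suc n))"
      using is_core_approx[OF core_adjoint assms] by blast
    then show "\<exists>p. p \<in> L2_adjoint \<mu> L \<and> fst p \<in> C \<and> L2_norm \<mu> (\<lambda>x. fst p x - r x) < inverse (real (Suc n))
      \<and> L2_norm \<mu> (\<lambda>x. snd p x - h x) < inverse (real (Suc n))"
      by (intro exI[of _ "(a, b)"]) simp
  qed
  then obtain p where p: "\<And>n. p n \<in> L2_adjoint \<mu> L" "\<And>n. fst (p n) \<in> C"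
    "\<And>n. L2_norm \<mu> (\<lambda>x. fst (p n) x - r x) < inverse (real (Suc n))"
    "\<And>n. L2_norm \<mu> (\<lambda>x. snd (p n) x - h x) < inverse (real (Suc n))"
    by - (drule choice, blast)
  have pL2: "fst (p n) \<in> L2 \<mu>" "snd (p n) \<in> L2 \<mu>" for n
    using p(1)[of n] by (auto simp: L2_adjoint_def)
  have "(\<lambda>n. L2_inner \<mu> (fst (p n)) (snd (p n))) \<longlonglongrightarrow> L2_inner \<mu> r h"
    by (intro L2_inner_tendsto pL2 L2s L2_norm_tendsto_0[OF less_imp_le LIMSEQ_inverse_real_of_nat] p)
  moreover have "L2_inner \<mu> (fst (p n)) (snd (p n)) \<le> 0" for n
  proof -
    obtain a' where "(fst (p n), a') \<in> L"
      using p(2)[of n] core by (auto simp: is_core_def)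
    then show ?thesis
      using adjoint_symmetric[of "fst (p n)" "snd (p n)" a'] p(1,2)[of n] generator_dissipative by simp
  qed
  ultimately show ?thesis
    by (intro LIMSEQ_le_const2) auto
qed

section \<open>The resolvent equation\<close>

text \<open>
  The residuals \<open>f - (\<beta> a - L a)\<close> with \<open>a\<close> in the core form an affine subspace. By the parallelogram
  identity a minimising sequence of residuals is Cauchy, and by accretivity so are the underlying
  \<open>a\<close> and \<open>L a\<close>. The limiting residual \<open>\<rho>\<close> is orthogonal to the range of \<open>\<beta> - L\<close>, which says that
  \<open>(\<rho>, \<beta> \<rho>)\<close> belongs to the adjoint; dissipativity of the adjoint forces \<open>\<rho> = 0\<close>.
\<close>

lemma resolvent_exists:
  assumes \<beta>: "\<beta> > 0" and f: "f \<in> L2 \<mu>"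
  shows "\<exists>(u, v)\<in>core_closure. AE x in \<mu>. \<beta> * u x - v x = f x"
proof -
  define R where "R p = (\<lambda>x. f x - (\<beta> * fst p x - snd p x))" for p :: "('a \<Rightarrow> real) \<times> ('a \<Rightarrow> real)"
  have RL2: "R p \<in> L2 \<mu>" if "p \<in> core_graph" for p
    using that f core_graph_L2[of "fst p" "snd p"] unfolding R_def by (auto intro!: L2_intros)
  define d where "d = Inf ((\<lambda>p. (L2_norm \<mu> (R p))\<^sup>2) ` core_graph)"
  have bdd: "bdd_below ((\<lambda>p. (L2_norm \<mu> (R p))\<^sup>2) ` core_graph)"
    by (rule bdd_belowI[of _ 0]) auto
  have d_le: "d \<le> (L2_norm \<mu> (R p))\<^sup>2" if "p \<in> core_graph" for p
    unfolding d_def using that by (intro cInf_lower bdd) auto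
  have "\<exists>p\<in>core_graph. (L2_norm \<mu> (R p))\<^sup>2 < d + inverse (real (Suc n))" for n
  proof -
    have "(\<lambda>p. (L2_norm \<mu> (R p))\<^sup>2) ` core_graph \<noteq> {}"
      using core_graph_zero by auto
    moreover have "d < d + inverse (real (Suc n))"
      by simp
    ultimately show ?thesis
      using cInf_lessD[of "(\<lambda>p. (L2_norm \<mu> (R p))\<^sup>2) ` core_graph" "d + inverse (real (Suc n))"]
      unfolding d_def by auto
  qed
  then obtain p where p: "\<And>n. p n \<in> core_graph" "\<And>n. (L2_norm \<mu> (R (p n)))\<^sup>2 < d + inverse (real (Suc n))"
    by metis
  define U V where "U n = fst (p n)" and "V n = snd (p n)" for n
  have UV: "(U n, V n) \<in> core_graph" for n
    using p(1) by (simp add: U_def V_def)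
  note UVL2 = core_graph_L2[OF UV]
  define r where "r n = R (p n)" for n
  have r_def': "r n = (\<lambda>x. f x - (\<beta> * U n x - V n x))" for n
    by (simp add: r_def R_def U_def V_def)
  have rL2: "r n \<in> L2 \<mu>" for n
    unfolding r_def by (intro RL2 p)
  have r_close: "(L2_norm \<mu> (\<lambda>x. r m x - r n x))\<^sup>2 \<le> 2 * inverse (real (Suc m)) + 2 * inverse (real (Suc n))" for m n
  proof -
    have mid: "(\<lambda>x. 1/2 * (U m x + U n x), \<lambda>x. 1/2 * (V m x + V n x)) \<in> core_graph"
    proof -
      obtain z where z: "(\<lambda>x. 0, z) \<in> core_graph"
        using core_graph_zero by blast
      have zz: "(\<lambda>x. 0, \<lambda>x. 0) \<in> core_graph"
        using core_graph_lincomb[OF z z, of "-1"] by simp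
      show ?thesis
        using core_graph_lincomb[OF zz core_graph_lincomb[OF UV UV], of "1/2" m 1 n] by simp
    qed
    have "(\<lambda>x. 1/2 * (r m x + r n x)) = R (\<lambda>x. 1/2 * (U m x + U n x), \<lambda>x. 1/2 * (V m x + V n x))"
      by (intro ext) (simp add: r_def' R_def field_simps)
    then have "d \<le> (L2_norm \<mu> (\<lambda>x. 1/2 * (r m x + r n x)))\<^sup>2"
      using d_le[OF mid] by simp
    then show ?thesis
      using L2_parallelogram[OF rL2[of m] rL2[of n]] p(2)[of m] p(2)[of n] unfolding r_def by simp
  qed
  have r_cauchy: "\<exists>n0. \<forall>m\<ge>n0. \<forall>n\<ge>n0. L2_norm \<mu> (\<lambda>x. r m x - r n x) < e" if "e > 0" for e
  proof -
    have "e\<^sup>2 / 4 > 0" using that by simp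
    then obtain n0 where n0: "inverse (real (Suc n0)) < e\<^sup>2 / 4"
      using reals_Archimedean by blast
    have "L2_norm \<mu> (\<lambda>x. r m x - r n x) < e" if "m \<ge> n0" "n \<ge> n0" for m n
    proof -
      have "inverse (real (Suc m)) \<le> inverse (real (Suc n0))" "inverse (real (Suc n)) \<le> inverse (real (Suc n0))"
        using that by (simp_all add: le_imp_inverse_le)
      then have "(L2_norm \<mu> (\<lambda>x. r m x - r n x))\<^sup>2 < e\<^sup>2"
        using r_close[of m n] n0 by linarith
      then show ?thesis
        using \<open>e > 0\<close> by (intro power2_less_imp_less[of _ e]) auto
    qed
    then show ?thesis by blast
  qed
  have U_le: "\<beta> * L2_norm \<mu> (\<lambda>x. U m x - U n x) \<le> L2_norm \<mu> (\<lambda>x. r m x - r n x)" for m n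
  proof -
    have "\<beta> * L2_norm \<mu> (\<lambda>x. U m x - U n x)
        \<le> L2_norm \<mu> (\<lambda>x. \<beta> * (U m x - U n x) - (V m x - V n x))"
      using \<beta> by (intro core_closure_accretive core_closure_diff core_graph_core_closure UV) auto
    also have "(\<lambda>x. \<beta> * (U m x - U n x) - (V m x - V n x)) = (\<lambda>x. r n x - r m x)"
      by (intro ext) (simp add: r_def' algebra_simps)
    finally show ?thesis
      by (simp add: L2_norm_minus_commute[of \<mu> "r n"])
  qed
  have "\<exists>u\<in>L2 \<mu>. (\<lambda>n. L2_norm \<mu> (\<lambda>x. U n x - u x)) \<longlonglongrightarrow> 0"
  proof (rule \<mu>.L2_complete[OF UVL2(1)])
    fix e :: real assume "e > 0"
    then have "\<beta> * e > 0" using \<beta> by simp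
    then obtain n0 where n0: "\<And>m n. m \<ge> n0 \<Longrightarrow> n \<ge> n0 \<Longrightarrow> L2_norm \<mu> (\<lambda>x. r m x - r n x) < \<beta> * e"
      using r_cauchy by blast
    have "L2_norm \<mu> (\<lambda>x. U m x - U n x) < e" if "m \<ge> n0" "n \<ge> n0" for m n
      using le_less_trans[OF U_le n0[OF that]] \<beta> by simp
    then show "\<exists>n0. \<forall>m\<ge>n0. \<forall>n\<ge>n0. L2_norm \<mu> (\<lambda>x. U m x - U n x) < e"
      by blast
  qed
  then obtain u where u: "u \<in> L2 \<mu>" "(\<lambda>n. L2_norm \<mu> (\<lambda>x. U n x - u x)) \<longlonglongrightarrow> 0"
    by blast
  obtain \<rho> where \<rho>: "\<rho> \<in> L2 \<mu>" "(\<lambda>n. L2_norm \<mu> (\<lambda>x. r n x - \<rho> x)) \<longlonglongrightarrow> 0"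
    using \<mu>.L2_complete[OF rL2 r_cauchy] by blast
  define v where "v x = \<rho> x - (f x - \<beta> * u x)" for x
  have vL2: "v \<in> L2 \<mu>"
    unfolding v_def by (intro L2_intros \<rho> f u)
  have "(\<lambda>n. L2_norm \<mu> (\<lambda>x. V n x - v x)) \<longlonglongrightarrow> 0"
  proof (rule L2_norm_tendsto_0)
    fix n
    have "(\<lambda>x. V n x - v x) = (\<lambda>x. (r n x - \<rho> x) + \<beta> * (U n x - u x))"
      by (intro ext) (simp add: r_def' v_def algebra_simps)
    moreover have "L2_norm \<mu> (\<lambda>x. (r n x - \<rho> x) + \<beta> * (U n x - u x))
        \<le> L2_norm \<mu> (\<lambda>x. r n x - \<rho> x) + L2_norm \<mu> (\<lambda>x. \<beta> * (U n x - u x))"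
      by (intro L2_norm_triangle L2_intros rL2 \<rho> UVL2 u)
    ultimately show "L2_norm \<mu> (\<lambda>x. V n x - v x)
        \<le> L2_norm \<mu> (\<lambda>x. r n x - \<rho> x) + \<beta> * L2_norm \<mu> (\<lambda>x. U n x - u x)"
      using \<beta> by (simp add: L2_norm_cmult)
  next
    show "(\<lambda>n. L2_norm \<mu> (\<lambda>x. r n x - \<rho> x) + \<beta> * L2_norm \<mu> (\<lambda>x. U n x - u x)) \<longlonglongrightarrow> 0"
      using tendsto_add[OF \<rho>(2) tendsto_mult[OF tendsto_const u(2), of \<beta>]] by simp
  qed
  then have uv: "(u, v) \<in> core_closure"
    by (intro core_closure_closed[OF core_graph_core_closure[OF UV] u(1) vL2 u(2)])
  \<comment> \<open>First-order condition at the minimum. The quadratic in \<open>t\<close> is nonnegative and vanishes at \<open>0\<close>.\<close>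
  have orth0: "L2_inner \<mu> \<rho> (\<lambda>x. \<beta> * a x - b x) = 0" if ab: "(a, b) \<in> core_graph" for a b
  proof -
    define c where "c x = \<beta> * a x - b x" for x
    have cL2: "c \<in> L2 \<mu>"
      unfolding c_def by (intro L2_intros core_graph_L2[OF ab])
    have quad: "0 \<le> t\<^sup>2 * L2_inner \<mu> c c - 2 * t * L2_inner \<mu> \<rho> c" for t
    proof -
      have "0 \<le> t\<^sup>2 * L2_inner \<mu> c c - 2 * t * L2_inner \<mu> (r n) c + inverse (real (Suc n))" for n
      proof -
        have "(\<lambda>x. r n x - t * c x) = R (\<lambda>x. U n x + t * a x, \<lambda>x. V n x + t * b x)"
          by (intro ext) (simp add: r_def' R_def c_def algebra_simps)
        then have "d \<le> (L2_norm \<mu> (\<lambda>x. r n x - t * c x))\<^sup>2"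
          using d_le[OF core_graph_lincomb[OF UV ab]] by simp
        also have "\<dots> = (L2_norm \<mu> (r n))\<^sup>2 - 2 * t * L2_inner \<mu> (r n) c + t\<^sup>2 * L2_inner \<mu> c c"
          unfolding L2_norm_sq using rL2 cL2
          by (simp add: L2_inner_linear L2_intros L2_inner_commute[of \<mu> c "r n"] power2_eq_square
              right_diff_distrib)
        finally show ?thesis
          using p(2)[of n] unfolding r_def by simp
      qed
      moreover have "(\<lambda>n. t\<^sup>2 * L2_inner \<mu> c c - 2 * t * L2_inner \<mu> (r n) c + inverse (real (Suc n)))
          \<longlonglongrightarrow> t\<^sup>2 * L2_inner \<mu> c c - 2 * t * L2_inner \<mu> \<rho> c + 0"
        by (intro tendsto_add tendsto_diff tendsto_mult tendsto_const LIMSEQ_inverse_real_of_nat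
            L2_inner_tendsto rL2 \<rho> cL2) (simp add: L2_norm_def L2_inner_def)
      ultimately have "0 \<le> t\<^sup>2 * L2_inner \<mu> c c - 2 * t * L2_inner \<mu> \<rho> c + 0"
        by (intro LIMSEQ_le_const) auto
      then show ?thesis by simp
    qed
    define A B where "A = L2_inner \<mu> c c" and "B = L2_inner \<mu> \<rho> c"
    have A: "A \<ge> 0"
      unfolding A_def by (rule L2_inner_self_nonneg)
    \<comment> \<open>The denominator \<open>A + 1\<close> avoids a case distinction on \<open>A = 0\<close>.\<close>
    have "0 \<le> (B / (A + 1))\<^sup>2 * A - 2 * (B / (A + 1)) * B"
      using quad[of "B / (A + 1)"] unfolding A_def B_def .
    also have "\<dots> = - (B / (A + 1))\<^sup>2 * (A + 2)"
      using A by (simp add: field_simps power2_eq_square add_nonneg_eq_0_iff)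
    finally have "(B / (A + 1))\<^sup>2 * (A + 2) \<le> 0"
      by simp
    then have "B = 0"
      using A by (auto simp: mult_le_0_iff)
    then show ?thesis
      unfolding B_def c_def .
  qed
  have "L2_inner \<mu> b \<rho> = L2_inner \<mu> a (\<lambda>x. \<beta> * \<rho> x)" if ab: "(a, b) \<in> L" for a b
  proof -
    have abG: "(a, b) \<in> core_closure"
      using ab by (rule generator_core_closure)
    obtain A B where AB: "\<And>n. (A n, B n) \<in> core_graph"
      "(\<lambda>n. L2_norm \<mu> (\<lambda>x. A n x - a x)) \<longlonglongrightarrow> 0" "(\<lambda>n. L2_norm \<mu> (\<lambda>x. B n x - b x)) \<longlonglongrightarrow> 0"
      using core_closure_sequence[OF abG] by blast
    note L2s = core_closure_L2[OF abG] core_graph_L2[OF AB(1)]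
    have "(\<lambda>n. \<beta> * L2_inner \<mu> (A n) \<rho> - L2_inner \<mu> (B n) \<rho>) \<longlonglongrightarrow> \<beta> * L2_inner \<mu> a \<rho> - L2_inner \<mu> b \<rho>"
      by (intro tendsto_diff tendsto_mult tendsto_const L2_inner_tendsto L2s AB \<rho>)
        (simp_all add: L2_norm_def L2_inner_def)
    moreover have "\<beta> * L2_inner \<mu> (A n) \<rho> - L2_inner \<mu> (B n) \<rho> = 0" for n
      using orth0[OF AB(1)[of n]] L2s \<rho>
      by (simp add: L2_inner_linear L2_intros L2_inner_commute[of \<mu> \<rho> "A n"] L2_inner_commute[of \<mu> \<rho> "B n"])
    ultimately have "\<beta> * L2_inner \<mu> a \<rho> - L2_inner \<mu> b \<rho> = 0"
      by (simp add: LIMSEQ_const_iff)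
    then show ?thesis
      by (simp add: L2_inner_cmult_right)
  qed
  then have "(\<rho>, \<lambda>x. \<beta> * \<rho> x) \<in> L2_adjoint \<mu> L"
    using \<rho> by (auto simp: L2_adjoint_def intro: L2_cmult)
  then have "\<beta> * L2_inner \<mu> \<rho> \<rho> \<le> 0"
    using adjoint_dissipative[of \<rho> "\<lambda>x. \<beta> * \<rho> x"] by (simp add: L2_inner_cmult_right)
  then have "L2_inner \<mu> \<rho> \<rho> = 0"
    using \<beta> L2_inner_self_nonneg[of \<mu> \<rho>] by (simp add: mult_le_0_iff)
  then have "AE x in \<mu>. \<rho> x = 0"
    using \<rho> by (intro L2_norm_eq_0) (simp_all add: L2_norm_def)
  then have "AE x in \<mu>. \<beta> * u x - v x = f x"
    by eventually_elim (simp add: v_def)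
  with uv show ?thesis
    by blast
qed

end

section \<open>The penalised obstacle problem\<close>

context sectorial_core
begin

lemma excessive_defect_closure:
  assumes "(u, v) \<in> core_closure" "0 \<le> t" "0 \<le> \<gamma>"
  shows "L2_neg \<mu> (\<lambda>x. u x - exp (- \<gamma> * t) * semigroup_app \<kappa> t u x)
    \<le> t * L2_neg \<mu> (\<lambda>x. \<gamma> * u x - v x)"
proof -
  obtain U V where UV: "\<And>n. (U n, V n) \<in> core_graph"
    "(\<lambda>n. L2_norm \<mu> (\<lambda>x. U n x - u x)) \<longlonglongrightarrow> 0" "(\<lambda>n. L2_norm \<mu> (\<lambda>x. V n x - v x)) \<longlonglongrightarrow> 0"
    using core_closure_sequence[OF assms(1)] by blast
  note L2s = core_closure_L2[OF assms(1)] core_graph_L2[OF UV(1)]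
  define Q where "Q f x = exp (- \<gamma> * t) * semigroup_app \<kappa> t f x" for f x
  have QL2: "Q f \<in> L2 \<mu>" if "f \<in> L2 \<mu>" for f
    unfolding Q_def using that assms by (intro L2_cmult semigroup_L2)
  let ?a = "\<lambda>n. L2_norm \<mu> (\<lambda>x. U n x - u x)" and ?b = "\<lambda>n. L2_norm \<mu> (\<lambda>x. V n x - v x)"
  let ?R = "t * L2_neg \<mu> (\<lambda>x. \<gamma> * u x - v x)"
  have "L2_neg \<mu> (\<lambda>x. u x - Q u x) \<le> (?R + t * (\<gamma> * ?a n + ?b n)) + (?a n + ?a n)" for n
  proof -
    have "L2_neg \<mu> (\<lambda>x. u x - Q u x)
        \<le> L2_neg \<mu> (\<lambda>x. U n x - Q (U n) x) + L2_norm \<mu> (\<lambda>x. (u x - Q u x) - (U n x - Q (U n) x))"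
      by (intro L2_neg_perturb L2_diff QL2 L2s)
    also have "L2_norm \<mu> (\<lambda>x. (u x - Q u x) - (U n x - Q (U n) x)) \<le> ?a n + ?a n"
    proof -
      have "L2_norm \<mu> (\<lambda>x. (u x - Q u x) - (U n x - Q (U n) x))
          \<le> L2_norm \<mu> (\<lambda>x. u x - U n x) + L2_norm \<mu> (\<lambda>x. Q u x - Q (U n) x)"
        using L2_norm_diff_le[of "\<lambda>x. u x - U n x" \<mu> "\<lambda>x. Q u x - Q (U n) x"] L2s QL2
        by (simp add: L2_diff algebra_simps)
      also have "L2_norm \<mu> (\<lambda>x. Q u x - Q (U n) x)
          = L2_norm \<mu> (\<lambda>x. exp (- \<gamma> * t) * semigroup_app \<kappa> t (\<lambda>y. u y - U n y) x)"
      proof (rule L2_norm_cong_AE)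
        show "AE x in \<mu>. Q u x - Q (U n) x = exp (- \<gamma> * t) * semigroup_app \<kappa> t (\<lambda>y. u y - U n y) x"
          using semigroup_diff[OF assms(2) L2s(1) L2s(3)[of n]]
          by eventually_elim (simp add: Q_def right_diff_distrib)
      qed (intro L2_measurable L2_diff L2_cmult QL2 semigroup_L2 L2s assms)+
      also have "\<dots> = exp (- \<gamma> * t) * L2_norm \<mu> (semigroup_app \<kappa> t (\<lambda>y. u y - U n y))"
        by (simp add: L2_norm_cmult)
      also have "\<dots> \<le> 1 * L2_norm \<mu> (\<lambda>x. u x - U n x)"
        using assms by (intro mult_mono semigroup_contraction L2_diff L2s L2_norm_nonneg) auto
      finally show ?thesis
        by (simp add: L2_norm_minus_commute[of \<mu> u])
    qed
    also have "L2_neg \<mu> (\<lambda>x. U n x - Q (U n) x) \<le> t * L2_neg \<mu> (\<lambda>x. \<gamma> * U n x - V n x)"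
      unfolding Q_def by (intro excessive_defect_le core_graph_L UV assms)
    also have "\<dots> \<le> t * (L2_neg \<mu> (\<lambda>x. \<gamma> * u x - v x) + (\<gamma> * ?a n + ?b n))"
    proof (rule mult_left_mono[OF _ assms(2)])
      have "L2_neg \<mu> (\<lambda>x. \<gamma> * U n x - V n x) \<le> L2_neg \<mu> (\<lambda>x. \<gamma> * u x - v x)
          + L2_norm \<mu> (\<lambda>x. (\<gamma> * U n x - V n x) - (\<gamma> * u x - v x))"
        by (intro L2_neg_perturb L2_diff L2_cmult L2s)
      also have "L2_norm \<mu> (\<lambda>x. (\<gamma> * U n x - V n x) - (\<gamma> * u x - v x))
          \<le> L2_norm \<mu> (\<lambda>x. \<gamma> * (U n x - u x)) + ?b n"
        using L2_norm_diff_le[of "\<lambda>x. \<gamma> * (U n x - u x)" \<mu> "\<lambda>x. V n x - v x"] L2s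
        by (simp add: L2_diff L2_cmult algebra_simps)
      also have "L2_norm \<mu> (\<lambda>x. \<gamma> * (U n x - u x)) = \<gamma> * ?a n"
        using assms by (simp add: L2_norm_cmult)
      finally show "L2_neg \<mu> (\<lambda>x. \<gamma> * U n x - V n x)
          \<le> L2_neg \<mu> (\<lambda>x. \<gamma> * u x - v x) + (\<gamma> * ?a n + ?b n)"
        by simp
    qed
    finally show ?thesis
      by (simp add: distrib_left)
  qed
  moreover have "(\<lambda>n. (?R + t * (\<gamma> * ?a n + ?b n)) + (?a n + ?a n))
      \<longlonglongrightarrow> (?R + t * (\<gamma> * 0 + 0)) + (0 + 0)"
    by (intro tendsto_add tendsto_mult tendsto_const UV)
  ultimately have "L2_neg \<mu> (\<lambda>x. u x - Q u x) \<le> (?R + t * (\<gamma> * 0 + 0)) + (0 + 0)"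
    by (intro LIMSEQ_le_const) auto
  then show ?thesis
    by (simp add: Q_def)
qed

text \<open>
  A vanishing negative part of \<open>\<gamma> u - L u\<close> makes the defect of excessivity vanish for every \<open>t\<close>.
  Nonnegativity of \<open>u\<close> follows by taking \<open>t = 1\<close>: the negative part of \<open>u\<close> is bounded by
  \<open>exp (- \<gamma>)\<close> times itself.
\<close>

lemma excessive_of_nonneg:
  assumes "(u, v) \<in> core_closure" "0 < \<gamma>" and pos: "AE x in \<mu>. 0 \<le> \<gamma> * u x - v x"
  shows "0 \<le> t \<Longrightarrow> AE x in \<mu>. exp (- \<gamma> * t) * semigroup_app \<kappa> t u x \<le> u x"
    and "AE x in \<mu>. 0 \<le> u x"
proof -
  note L2s = core_closure_L2[OF assms(1)]
  have "(\<lambda>x. \<gamma> * u x - v x) \<in> L2 \<mu>"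
    by (intro L2_diff L2_cmult L2s)
  then have 0: "L2_neg \<mu> (\<lambda>x. \<gamma> * u x - v x) = 0"
    using pos by (simp add: L2_neg_eq_0_iff)
  have mem: "(\<lambda>x. u x - exp (- \<gamma> * t) * semigroup_app \<kappa> t u x) \<in> L2 \<mu>" if "0 \<le> t" for t
    by (intro L2_diff L2_cmult semigroup_L2 L2s that)
  have defect: "L2_neg \<mu> (\<lambda>x. u x - exp (- \<gamma> * t) * semigroup_app \<kappa> t u x) = 0" if "0 \<le> t" for t
    using excessive_defect_closure[OF assms(1) that, of \<gamma>] assms(2) 0
      L2_neg_nonneg[of \<mu> "\<lambda>x. u x - exp (- \<gamma> * t) * semigroup_app \<kappa> t u x"] by simp
  show "AE x in \<mu>. exp (- \<gamma> * t) * semigroup_app \<kappa> t u x \<le> u x" if "0 \<le> t"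
    using defect[OF that] L2_neg_eq_0_iff[OF mem[OF that]] by simp
  have "L2_neg \<mu> u \<le> exp (- \<gamma>) * L2_neg \<mu> u"
  proof -
    let ?P = "\<lambda>x. exp (- \<gamma> * 1) * semigroup_app \<kappa> 1 u x"
    have P: "?P \<in> L2 \<mu>"
      by (intro L2_cmult semigroup_L2 L2s) simp
    have "L2_neg \<mu> u \<le> L2_neg \<mu> (\<lambda>x. u x - ?P x) + L2_neg \<mu> ?P"
      using L2_neg_add[OF mem[of 1] P] by simp
    also have "\<dots> = exp (- \<gamma>) * L2_neg \<mu> (semigroup_app \<kappa> 1 u)"
      using defect[of 1] by (simp add: L2_neg_cmult)
    also have "\<dots> \<le> exp (- \<gamma>) * L2_neg \<mu> u"
      by (intro mult_left_mono semigroup_neg L2s) auto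
    finally show ?thesis .
  qed
  then have "(1 - exp (- \<gamma>)) * L2_neg \<mu> u \<le> 0"
    by (simp add: algebra_simps)
  moreover have "1 - exp (- \<gamma>) > 0"
    using assms(2) by simp
  ultimately have "L2_neg \<mu> u = 0"
    using L2_neg_nonneg[of \<mu> u] by (simp add: mult_le_0_iff)
  then show "AE x in \<mu>. 0 \<le> u x"
    using L2_neg_eq_0_iff[OF L2s(1)] by simp
qed

text \<open>
  Adding \<open>\<alpha> u\<close> to both sides turns the equation into \<open>(\<gamma> + \<alpha>) u - L u = \<alpha> max u g\<close>. Its right-hand side
  is Lipschitz in \<open>u\<close> with constant \<open>\<alpha>\<close>, and the resolvent at \<open>\<gamma> + \<alpha>\<close> has norm at most
  \<open>1 / (\<gamma> + \<alpha>)\<close>, so Picard iteration contracts by the factor \<open>\<alpha> / (\<gamma> + \<alpha>) < 1\<close>.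
\<close>

lemma penalised_obstacle:
  assumes \<gamma>: "\<gamma> > 0" and \<alpha>: "\<alpha> > 0" and g: "g \<in> L2 \<mu>"
  shows "\<exists>(u, v)\<in>core_closure. AE x in \<mu>. \<gamma> * u x - v x = \<alpha> * max 0 (g x - u x)"
proof -
  define \<beta> where "\<beta> = \<gamma> + \<alpha>"
  have \<beta>: "\<beta> > 0" using \<gamma> \<alpha> by (simp add: \<beta>_def)
  define q where "q = \<alpha> / \<beta>"
  have q: "0 \<le> q" "q < 1"
    using \<gamma> \<alpha> by (auto simp: q_def \<beta>_def)
  define F where "F u x = \<alpha> * max (u x) (g x)" for u x
  have FL2: "F u \<in> L2 \<mu>" if "u \<in> L2 \<mu>" for u
    unfolding F_def using that g by (intro L2_cmult L2_max)
  have F_lip: "L2_norm \<mu> (\<lambda>x. F u x - F w x) \<le> \<alpha> * L2_norm \<mu> (\<lambda>x. u x - w x)"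
    if "u \<in> L2 \<mu>" "w \<in> L2 \<mu>" for u w
  proof -
    have "L2_norm \<mu> (\<lambda>x. max (u x) (g x) - max (w x) (g x)) \<le> L2_norm \<mu> (\<lambda>x. u x - w x)"
      using that g
      by (intro L2_norm_mono L2_measurable L2_diff L2_max AE_I2) (auto simp: max_def)
    then have "\<alpha> * L2_norm \<mu> (\<lambda>x. max (u x) (g x) - max (w x) (g x)) \<le> \<alpha> * L2_norm \<mu> (\<lambda>x. u x - w x)"
      using \<alpha> by simp
    moreover have "(\<lambda>x. F u x - F w x) = (\<lambda>x. \<alpha> * (max (u x) (g x) - max (w x) (g x)))"
      by (intro ext) (simp add: F_def right_diff_distrib)
    ultimately show ?thesis
      using \<alpha> by (simp add: L2_norm_cmult)
  qed
  have "\<forall>f. \<exists>p. f \<in> L2 \<mu> \<longrightarrow> p \<in> core_closure \<and> (AE x in \<mu>. \<beta> * fst p x - snd p x = f x)"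
    using resolvent_exists[OF \<beta>] by fastforce
  then obtain S where S: "\<And>f. f \<in> L2 \<mu> \<Longrightarrow> S f \<in> core_closure"
    "\<And>f. f \<in> L2 \<mu> \<Longrightarrow> AE x in \<mu>. \<beta> * fst (S f) x - snd (S f) x = f x"
    by - (drule choice, blast)
  define U where "U n = ((\<lambda>u. fst (S (F u))) ^^ n) (\<lambda>_. 0)" for n
  have U_Suc: "U (Suc n) = fst (S (F (U n)))" for n
    by (simp add: U_def)
  define V where "V n = snd (S (F (U n)))" for n
  have UL2: "U n \<in> L2 \<mu>" for n
  proof (induction n)
    case 0
    then show ?case by (simp add: U_def L2_zero)
  next
    case (Suc n)
    then show ?case
      using S(1)[OF FL2[OF Suc]] core_closure_L2(1)[of "fst (S (F (U n)))" "snd (S (F (U n)))"] by (simp add: U_Suc)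
  qed
  have UV: "(U (Suc n), V n) \<in> core_closure" for n
    using S(1)[OF FL2[OF UL2]] by (simp add: U_Suc V_def)
  have VL2: "V n \<in> L2 \<mu>" for n
    using core_closure_L2(2)[OF UV] .
  have eq: "AE x in \<mu>. \<beta> * U (Suc n) x - V n x = F (U n) x" for n
    using S(2)[OF FL2[OF UL2]] by (simp add: U_Suc V_def)
  have step: "L2_norm \<mu> (\<lambda>x. U (Suc n) x - U n x) \<le> L2_norm \<mu> (\<lambda>x. U 1 x - U 0 x) * q ^ n" for n
  proof (induction n)
    case (Suc n)
    have "\<beta> * L2_norm \<mu> (\<lambda>x. U (Suc (Suc n)) x - U (Suc n) x)
        \<le> L2_norm \<mu> (\<lambda>x. \<beta> * (U (Suc (Suc n)) x - U (Suc n) x) - (V (Suc n) x - V n x))"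
      using \<beta> by (intro core_closure_accretive core_closure_diff UV) simp
    also have "\<dots> = L2_norm \<mu> (\<lambda>x. F (U (Suc n)) x - F (U n) x)"
    proof (rule L2_norm_cong_AE)
      show "AE x in \<mu>. \<beta> * (U (Suc (Suc n)) x - U (Suc n) x) - (V (Suc n) x - V n x)
          = F (U (Suc n)) x - F (U n) x"
        using eq[of "Suc n"] eq[of n] by eventually_elim (simp add: algebra_simps)
    qed (intro L2_measurable L2_diff L2_cmult UL2 VL2 FL2)+
    also have "\<dots> \<le> \<alpha> * L2_norm \<mu> (\<lambda>x. U (Suc n) x - U n x)"
      by (intro F_lip UL2)
    finally have "L2_norm \<mu> (\<lambda>x. U (Suc (Suc n)) x - U (Suc n) x)
        \<le> q * L2_norm \<mu> (\<lambda>x. U (Suc n) x - U n x)"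
      using \<beta> by (simp add: q_def field_simps)
    also have "\<dots> \<le> q * (L2_norm \<mu> (\<lambda>x. U 1 x - U 0 x) * q ^ n)"
      by (intro mult_left_mono Suc q)
    finally show ?case
      by (simp add: algebra_simps)
  qed simp
  define c where "c = L2_norm \<mu> (\<lambda>x. U 1 x - U 0 x) / (1 - q)"
  have c: "c \<ge> 0"
    using q by (simp add: c_def L2_norm_nonneg)
  have tail: "L2_norm \<mu> (\<lambda>x. U m x - U n x) \<le> c * q ^ n" if "n \<le> m" for m n
    using L2_geometric_tail[OF UL2 q L2_norm_nonneg step, of n "m - n"] that by (simp add: c_def)
  have c0: "(\<lambda>n. c * q ^ n) \<longlonglongrightarrow> 0"
    using q by (intro tendsto_mult_right_zero LIMSEQ_power_zero) auto
  have "\<exists>u\<in>L2 \<mu>. (\<lambda>n. L2_norm \<mu> (\<lambda>x. U n x - u x)) \<longlonglongrightarrow> 0"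
  proof (rule \<mu>.L2_complete[OF UL2])
    fix e :: real assume "e > 0"
    then obtain n0 where n0: "\<And>n. n \<ge> n0 \<Longrightarrow> c * q ^ n < e"
      using order_tendstoD(2)[OF c0] by (auto simp: eventually_sequentially)
    have "L2_norm \<mu> (\<lambda>x. U m x - U n x) < e" if mn: "m \<ge> n0" "n \<ge> n0" for m n
    proof (cases "n \<le> m")
      case True
      then show ?thesis
        using tail[OF True] n0[OF mn(2)] by simp
    next
      case False
      then show ?thesis
        using tail[of m n] n0[OF mn(1)] L2_norm_minus_commute[of \<mu> "U m" "U n"] by simp
    qed
    then show "\<exists>n0. \<forall>m\<ge>n0. \<forall>n\<ge>n0. L2_norm \<mu> (\<lambda>x. U m x - U n x) < e"
      by blast
  qed
  then obtain u where u: "u \<in> L2 \<mu>" "(\<lambda>n. L2_norm \<mu> (\<lambda>x. U n x - u x)) \<longlonglongrightarrow> 0"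
    by blast
  have uS: "(\<lambda>n. L2_norm \<mu> (\<lambda>x. U (Suc n) x - u x)) \<longlonglongrightarrow> 0"
    using LIMSEQ_Suc[OF u(2)] .
  define v where "v x = \<beta> * u x - F u x" for x
  have vL2: "v \<in> L2 \<mu>"
    unfolding v_def by (intro L2_diff L2_cmult FL2 u)
  have "(\<lambda>n. L2_norm \<mu> (\<lambda>x. V n x - v x)) \<longlonglongrightarrow> 0"
  proof (rule L2_norm_tendsto_0)
    fix n
    have "L2_norm \<mu> (\<lambda>x. V n x - v x) = L2_norm \<mu> (\<lambda>x. \<beta> * (U (Suc n) x - u x) - (F (U n) x - F u x))"
    proof (rule L2_norm_cong_AE)
      show "AE x in \<mu>. V n x - v x = \<beta> * (U (Suc n) x - u x) - (F (U n) x - F u x)"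
        using eq[of n] by eventually_elim (simp add: v_def algebra_simps)
    qed (intro L2_measurable L2_diff L2_cmult UL2 VL2 FL2 u vL2)+
    also have "\<dots> \<le> L2_norm \<mu> (\<lambda>x. \<beta> * (U (Suc n) x - u x)) + L2_norm \<mu> (\<lambda>x. F (U n) x - F u x)"
      by (intro L2_norm_diff_le L2_diff L2_cmult FL2 UL2 u)
    also have "L2_norm \<mu> (\<lambda>x. \<beta> * (U (Suc n) x - u x)) = \<beta> * L2_norm \<mu> (\<lambda>x. U (Suc n) x - u x)"
      using \<beta> by (simp add: L2_norm_cmult)
    also have "L2_norm \<mu> (\<lambda>x. F (U n) x - F u x) \<le> \<alpha> * L2_norm \<mu> (\<lambda>x. U n x - u x)"
      by (intro F_lip UL2 u)
    finally show "L2_norm \<mu> (\<lambda>x. V n x - v x)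
        \<le> \<beta> * L2_norm \<mu> (\<lambda>x. U (Suc n) x - u x) + \<alpha> * L2_norm \<mu> (\<lambda>x. U n x - u x)"
      by simp
  next
    show "(\<lambda>n. \<beta> * L2_norm \<mu> (\<lambda>x. U (Suc n) x - u x) + \<alpha> * L2_norm \<mu> (\<lambda>x. U n x - u x)) \<longlonglongrightarrow> 0"
      using tendsto_add[OF tendsto_mult_right_zero[OF uS] tendsto_mult_right_zero[OF u(2)]] by simp
  qed
  then have "(u, v) \<in> core_closure"
    by (rule core_closure_closed[OF UV u(1) vL2 uS])
  moreover have "\<gamma> * u x - v x = \<alpha> * max 0 (g x - u x)" for x
    by (simp add: v_def F_def \<beta>_def max_def algebra_simps)
  ultimately show ?thesis
    by auto
qed

text \<open>
  The energy estimate. Here \<open>Du\<close> and \<open>Dg\<close> are the Dirichlet forms of \<open>u\<close> and \<open>g\<close>. The two indefinite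
  terms are split by \<open>2 a b \<le> a\<^sup>2 + b\<^sup>2\<close>, the second one after the sector condition:
  \<open>2 \<bar>\<langle>g, L u\<rangle>\<bar> \<le> 2 sqrt (K Dg Du) \<le> K Dg + Du\<close>. Only \<open>Dg\<close> acquires the factor \<open>K\<close>.
\<close>

lemma obstacle_energy:
  assumes \<gamma>: "\<gamma> > 0" and uv: "(u, v) \<in> core_closure" and gg: "(g, g') \<in> core_closure"
    and eq: "AE x in \<mu>. \<gamma> * u x - v x = \<alpha> * max 0 (g x - u x)"
  shows "\<gamma> * (L2_norm \<mu> u)\<^sup>2 + 2 * \<alpha> * (L2_norm \<mu> (\<lambda>x. max 0 (g x - u x)))\<^sup>2
    \<le> \<gamma> * (L2_norm \<mu> g)\<^sup>2 - K * L2_inner \<mu> g g'"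
proof -
  note L2s = core_closure_L2[OF uv] core_closure_L2[OF gg]
  define w where "w x = max 0 (g x - u x)" for x
  have w: "w \<in> L2 \<mu>"
    unfolding w_def by (intro L2_max L2_zero L2_diff L2s)
  define Du Dg where "Du = - L2_inner \<mu> u v" and "Dg = - L2_inner \<mu> g g'"
  have nonneg: "Du \<ge> 0" "Dg \<ge> 0"
    using core_closure_dissipative[OF uv] core_closure_dissipative[OF gg] by (simp_all add: Du_def Dg_def)
  have "L2_inner \<mu> (\<lambda>x. \<gamma> * u x - v x) (\<lambda>x. u x - g x) = L2_inner \<mu> (\<lambda>x. - \<alpha> * w x) w"
    unfolding L2_inner_def
  proof (rule integral_cong_AE)
    show "AE x in \<mu>. (\<gamma> * u x - v x) * (u x - g x) = - \<alpha> * w x * w x"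
      using eq by eventually_elim (auto simp: w_def max_def algebra_simps)
  qed (intro borel_measurable_integrable L2_integrable_mult L2_diff L2_cmult L2s w)+
  then have "\<gamma> * L2_inner \<mu> u u - \<gamma> * L2_inner \<mu> u g + Du + L2_inner \<mu> g v = - \<alpha> * (L2_norm \<mu> w)\<^sup>2"
    using L2s
    by (simp add: L2_inner_linear L2_diff L2_cmult L2_norm_sq Du_def L2_inner_commute[of \<mu> v u] L2_inner_commute[of \<mu> v g] right_diff_distrib)
  then have main: "\<gamma> * (L2_norm \<mu> u)\<^sup>2 + Du + \<alpha> * (L2_norm \<mu> w)\<^sup>2 = \<gamma> * L2_inner \<mu> u g - L2_inner \<mu> g v"
    by (simp add: L2_norm_sq)
  have "2 * L2_inner \<mu> u g \<le> (L2_norm \<mu> u)\<^sup>2 + (L2_norm \<mu> g)\<^sup>2"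
  proof -
    have "0 \<le> (L2_norm \<mu> u - L2_norm \<mu> g)\<^sup>2" by simp
    then show ?thesis
      using L2_Cauchy_Schwarz[OF L2s(1,3)] unfolding power2_diff by linarith
  qed
  then have 1: "\<gamma> * (2 * L2_inner \<mu> u g) \<le> \<gamma> * ((L2_norm \<mu> u)\<^sup>2 + (L2_norm \<mu> g)\<^sup>2)"
    using \<gamma> by simp
  have "(2 * L2_inner \<mu> g v)\<^sup>2 \<le> 4 * (K * Dg * Du)"
    using sector_core_closure[OF gg uv] by (simp add: Dg_def Du_def)
  also have "\<dots> \<le> (K * Dg + Du)\<^sup>2"
  proof -
    have "0 \<le> (K * Dg - Du)\<^sup>2" by simp
    then show ?thesis unfolding power2_diff power2_sum by linarith
  qed
  finally have "\<bar>2 * L2_inner \<mu> g v\<bar> \<le> \<bar>K * Dg + Du\<bar>"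
    by (rule abs_le_square_iff[THEN iffD2])
  then have 2: "- (2 * L2_inner \<mu> g v) \<le> K * Dg + Du"
    using nonneg K_pos by simp
  show ?thesis
    using main 1 2 nonneg unfolding w_def[symmetric] Dg_def by (simp add: distrib_left)
qed

end

section \<open>The maximal inequality for excessive functions\<close>

locale stationary_markov_process =
  markov_process E \<kappa> P X + stationary_semigroup E \<kappa> \<mu>
  for E :: "'a measure" and \<kappa> :: "real \<Rightarrow> 'a \<Rightarrow> 'a measure"
    and P :: "'w measure" and X :: "real \<Rightarrow> 'w \<Rightarrow> 'a" and \<mu> :: "'a measure" +
  assumes initial: "distr P E (X 0) = \<mu>"
begin

abbreviation \<F> :: "real \<Rightarrow> 'w measure" where
  "\<F> \<equiv> history P E X"

lemma space_history: "space (\<F> s) = space P"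
  by (simp add: history_def space_measure_of_conv)

lemma sets_history:
  "sets (\<F> s) = sigma_sets (space P) {X u -` A \<inter> space P | u A. 0 \<le> u \<and> u \<le> s \<and> A \<in> sets E}"
  unfolding history_def by (rule sets_measure_of) auto

lemma history_mono: "s \<le> t \<Longrightarrow> sets (\<F> s) \<subseteq> sets (\<F> t)"
  unfolding sets_history by (rule sigma_sets_mono') (blast intro: order_trans)

lemma history_X: "0 \<le> t \<Longrightarrow> A \<in> sets E \<Longrightarrow> X t -` A \<inter> space P \<in> sets (\<F> t)"
  unfolding sets_history by (intro sigma_sets.Basic) auto

lemma history_subalgebra: "subalgebra P (\<F> s)"
proof -
  have "sigma_sets (space P) {X u -` A \<inter> space P | u A. 0 \<le> u \<and> u \<le> s \<and> A \<in> sets E} \<subseteq> sets P"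
    by (intro sets.sigma_sets_subset) (auto intro: measurable_sets[OF X_measurable])
  then show ?thesis
    by (simp add: subalgebra_def space_history sets_history)
qed

lemma history_events: "A \<in> sets (\<F> s) \<Longrightarrow> A \<in> sets P"
  using history_subalgebra by (auto simp: subalgebra_def)

lemma X_space: "0 \<le> t \<Longrightarrow> \<omega> \<in> space P \<Longrightarrow> X t \<omega> \<in> space E"
  using measurable_space[OF X_measurable] .

lemma Markov_set:
  assumes s: "0 \<le> s" and t: "0 \<le> t" and A: "A \<in> sets (\<F> s)" and B: "B \<in> sets E"
  shows "(\<integral>\<^sup>+\<omega>. indicator B (X (s + t) \<omega>) * indicator A \<omega> \<partial>P)
    = (\<integral>\<^sup>+\<omega>. emeasure (\<kappa> t (X s \<omega>)) B * indicator A \<omega> \<partial>P)"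
proof -
  interpret F: finite_measure_subalgebra P "\<F> s"
    by unfold_locales (rule history_subalgebra)
  have [measurable]: "A \<in> sets P" "B \<in> sets E" "X (s + t) \<in> P \<rightarrow>\<^sub>M E" "X s \<in> P \<rightarrow>\<^sub>M E"
    using A B s t by (auto intro: history_events X_measurable)
  have m [measurable]: "(\<lambda>\<omega>. measure (\<kappa> t (X s \<omega>)) B) \<in> borel_measurable P"
    using measurable_compose[OF measurable_compose[OF X_measurable[OF s] kernel[OF t]]
        measurable_measure_prob_algebra[OF B]] .
  have bound: "measure (\<kappa> t (X s \<omega>)) B \<le> 1" if "\<omega> \<in> space P" for \<omega>
    using prob_space.prob_le_1[OF prob_space_kernel[OF t X_space[OF s that]]] .
  have int1: "integrable P (\<lambda>\<omega>. indicator B (X (s + t) \<omega>) :: real)"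
    by (rule integrable_const_bound[of _ 1]) auto
  have int2: "integrable P (\<lambda>\<omega>. measure (\<kappa> t (X s \<omega>)) B)"
    using bound by (intro integrable_const_bound[of _ 1]) auto
  have "(\<integral>\<omega>\<in>A. indicator B (X (s + t) \<omega>) \<partial>P) =
      (\<integral>\<omega>\<in>A. real_cond_exp P (\<F> s) (\<lambda>\<omega>. indicator B (X (s + t) \<omega>)) \<omega> \<partial>P)"
    by (rule F.real_cond_exp_intA[OF int1 A])
  also have "\<dots> = (\<integral>\<omega>\<in>A. measure (\<kappa> t (X s \<omega>)) B \<partial>P)"
    unfolding set_lebesgue_integral_def using Markov_property[OF s t B]
    by (intro integral_cong_AE) (auto elim!: eventually_mono)
  finally have eq: "(\<integral>\<omega>. indicator A \<omega> * indicator B (X (s + t) \<omega>) \<partial>P)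
      = (\<integral>\<omega>. indicator A \<omega> * measure (\<kappa> t (X s \<omega>)) B \<partial>P)"
    by (simp add: set_lebesgue_integral_def)
  have "(\<integral>\<^sup>+\<omega>. indicator B (X (s + t) \<omega>) * indicator A \<omega> \<partial>P)
      = (\<integral>\<^sup>+\<omega>. ennreal (indicator A \<omega> * indicator B (X (s + t) \<omega>)) \<partial>P)"
    by (intro nn_integral_cong) (auto split: split_indicator)
  also have "\<dots> = ennreal (\<integral>\<omega>. indicator A \<omega> * indicator B (X (s + t) \<omega>) \<partial>P)"
    using integrable_mult_indicator[OF _ int1, of A]
    by (intro nn_integral_eq_integral) (auto simp: history_events)
  also have "\<dots> = ennreal (\<integral>\<omega>. indicator A \<omega> * measure (\<kappa> t (X s \<omega>)) B \<partial>P)"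
    by (simp only: eq)
  also have "\<dots> = (\<integral>\<^sup>+\<omega>. ennreal (indicator A \<omega> * measure (\<kappa> t (X s \<omega>)) B) \<partial>P)"
    using integrable_mult_indicator[OF _ int2, of A]
    by (intro nn_integral_eq_integral[symmetric]) auto
  also have "\<dots> = (\<integral>\<^sup>+\<omega>. emeasure (\<kappa> t (X s \<omega>)) B * indicator A \<omega> \<partial>P)"
  proof (rule nn_integral_cong)
    fix \<omega> assume "\<omega> \<in> space P"
    then interpret K: prob_space "\<kappa> t (X s \<omega>)"
      by (intro prob_space_kernel t X_space s)
    show "ennreal (indicator A \<omega> * measure (\<kappa> t (X s \<omega>)) B) = emeasure (\<kappa> t (X s \<omega>)) B * indicator A \<omega>"
      by (simp add: K.emeasure_eq_measure split: split_indicator)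
  qed
  finally show ?thesis .
qed

text \<open>
  The Markov property for nonnegative functions of the future and events of the past: both sides
  integrate \<open>f\<close>, against measures that agree on all sets.
\<close>

lemma Markov_nn_integral:
  assumes s: "0 \<le> s" and t: "0 \<le> t" and A: "A \<in> sets (\<F> s)" and f: "f \<in> borel_measurable E"
  shows "(\<integral>\<^sup>+\<omega>. f (X (s + t) \<omega>) * indicator A \<omega> \<partial>P)
    = (\<integral>\<^sup>+\<omega>. (\<integral>\<^sup>+y. f y \<partial>\<kappa> t (X s \<omega>)) * indicator A \<omega> \<partial>P)"
proof -
  have [measurable]: "A \<in> sets P" "X (s + t) \<in> P \<rightarrow>\<^sub>M E" "X s \<in> P \<rightarrow>\<^sub>M E"
    using A s t by (auto intro: history_events X_measurable)
  define M1 where "M1 = distr (density P (indicator A)) E (X (s + t))"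
  define M2 where "M2 = distr (density P (indicator A)) E (X s)"
  have nonempty: "space M2 \<noteq> {}"
    using not_empty X_space[OF s] by (auto simp: M2_def)
  have k2: "\<kappa> t \<in> M2 \<rightarrow>\<^sub>M subprob_algebra E"
    using kernel_subprob[OF t] by (simp add: M2_def)
  have "M1 = M2 \<bind> \<kappa> t"
  proof (rule measure_eqI)
    show "sets M1 = sets (M2 \<bind> \<kappa> t)"
      using sets_bind_measurable[OF k2 nonempty] by (simp add: M1_def)
    fix B assume "B \<in> sets M1"
    then have B [measurable]: "B \<in> sets E"
      by (simp add: M1_def)
    have "emeasure M1 B = (\<integral>\<^sup>+x. indicator B x \<partial>M1)"
      by (simp add: M1_def)
    also have "\<dots> = (\<integral>\<^sup>+\<omega>. indicator B (X (s + t) \<omega>) * indicator A \<omega> \<partial>P)"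
      by (simp add: M1_def nn_integral_distr nn_integral_density mult.commute del: nn_integral_indicator)
    also have "\<dots> = (\<integral>\<^sup>+\<omega>. emeasure (\<kappa> t (X s \<omega>)) B * indicator A \<omega> \<partial>P)"
      by (rule Markov_set[OF s t A B])
    also have "\<dots> = (\<integral>\<^sup>+x. emeasure (\<kappa> t x) B \<partial>M2)"
      using measurable_emeasure_kernel[OF kernel_subprob[OF t] B]
        measurable_compose[OF X_measurable[OF s] measurable_emeasure_kernel[OF kernel_subprob[OF t] B]]
      by (simp add: M2_def nn_integral_distr nn_integral_density mult.commute)
    also have "\<dots> = emeasure (M2 \<bind> \<kappa> t) B"
      by (rule emeasure_bind[OF nonempty k2 B, symmetric])
    finally show "emeasure M1 B = emeasure (M2 \<bind> \<kappa> t) B" .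
  qed
  then have "(\<integral>\<^sup>+x. f x \<partial>M1) = (\<integral>\<^sup>+x. \<integral>\<^sup>+y. f y \<partial>\<kappa> t x \<partial>M2)"
    using nn_integral_bind[OF f k2] by simp
  moreover have "(\<integral>\<^sup>+x. f x \<partial>M1) = (\<integral>\<^sup>+\<omega>. f (X (s + t) \<omega>) * indicator A \<omega> \<partial>P)"
    using f by (simp add: M1_def nn_integral_distr nn_integral_density mult.commute)
  moreover have "(\<integral>\<^sup>+x. \<integral>\<^sup>+y. f y \<partial>\<kappa> t x \<partial>M2)
      = (\<integral>\<^sup>+\<omega>. (\<integral>\<^sup>+y. f y \<partial>\<kappa> t (X s \<omega>)) * indicator A \<omega> \<partial>P)"
    using nn_integral_kernel_measurable[OF t f]
      measurable_compose[OF X_measurable[OF s] nn_integral_kernel_measurable[OF t f]]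
    by (simp add: M2_def nn_integral_distr nn_integral_density mult.commute)
  ultimately show ?thesis
    by simp
qed

lemma nn_integral_X:
  assumes t: "0 \<le> t" and f: "f \<in> borel_measurable E"
  shows "(\<integral>\<^sup>+\<omega>. f (X t \<omega>) \<partial>P) = (\<integral>\<^sup>+x. f x \<partial>\<mu>)"
proof -
  have "space P \<in> sets (\<F> 0)"
    using sets.top[of "\<F> 0"] by (simp add: space_history)
  from Markov_nn_integral[OF order_refl t this f]
  have "(\<integral>\<^sup>+\<omega>. f (X t \<omega>) \<partial>P) = (\<integral>\<^sup>+\<omega>. (\<integral>\<^sup>+y. f y \<partial>\<kappa> t (X 0 \<omega>)) \<partial>P)"
    by (simp cong: nn_integral_cong)
  also have "\<dots> = (\<integral>\<^sup>+x. (\<integral>\<^sup>+y. f y \<partial>\<kappa> t x) \<partial>\<mu>)"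
    unfolding initial[symmetric] using nn_integral_kernel_measurable[OF t f] X_measurable[of 0]
    by (simp add: nn_integral_distr)
  also have "\<dots> = (\<integral>\<^sup>+x. f x \<partial>\<mu>)"
    by (rule nn_integral_invariant[OF t f])
  finally show ?thesis .
qed

lemma distr_X:
  assumes t: "0 \<le> t"
  shows "distr P E (X t) = \<mu>"
proof (rule measure_eqI)
  fix B assume "B \<in> sets (distr P E (X t))"
  then have B: "B \<in> sets E" "B \<in> sets \<mu>"
    by (simp_all add: sets_mu)
  have "emeasure (distr P E (X t)) B = (\<integral>\<^sup>+x. indicator B x \<partial>distr P E (X t))"
    using B by simp
  also have "\<dots> = (\<integral>\<^sup>+\<omega>. indicator B (X t \<omega>) \<partial>P)"
    using B X_measurable[OF t] by (simp add: nn_integral_distr del: nn_integral_indicator)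
  also have "\<dots> = emeasure \<mu> B"
    using nn_integral_X[OF t, of "indicator B"] B by simp
  finally show "emeasure (distr P E (X t)) B = emeasure \<mu> B" .
qed (simp add: sets_mu)

lemma AE_X:
  assumes "0 \<le> t" "AE x in \<mu>. Q x"
  shows "AE \<omega> in P. Q (X t \<omega>)"
  using assms(2) unfolding distr_X[OF assms(1), symmetric]
  by (rule AE_distrD[OF X_measurable[OF assms(1)]])

text \<open>
  Doob's maximal inequality for the supermartingale \<open>exp (- \<gamma> t) w(X\<^sub>t)\<close> along an increasing list of
  times. The induction peels off the earliest time \<open>t\<close>: on the part \<open>B\<close> of \<open>A\<close> where \<open>w(X\<^sub>t)\<close> has reached
  \<open>c\<close> the bound is immediate, and on the remainder, which is again an event of the past of \<open>t\<close>, the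
  induction hypothesis applies. Both parts recombine to the integral over \<open>A\<close> at time \<open>t\<close>, which the
  supermartingale property compares with time \<open>s\<close>.
\<close>

lemma supermartingale_maximal:
  fixes w :: "'a \<Rightarrow> ennreal"
  assumes w: "w \<in> borel_measurable E" and \<gamma>: "0 \<le> \<gamma>"
    and exc: "\<And>t. 0 \<le> t \<Longrightarrow> AE x in \<mu>. ennreal (exp (- \<gamma> * t)) * (\<integral>\<^sup>+y. w y \<partial>\<kappa> t x) \<le> w x"
    and ts: "sorted (s # ts)" "0 \<le> s" "\<forall>t\<in>set ts. t \<le> T" and A: "A \<in> sets (\<F> s)"
  shows "c * ennreal (exp (- \<gamma> * T)) * emeasure P {\<omega>\<in>A. \<exists>t\<in>set ts. c \<le> w (X t \<omega>)}
    \<le> (\<integral>\<^sup>+\<omega>. ennreal (exp (- \<gamma> * s)) * w (X s \<omega>) * indicator A \<omega> \<partial>P)"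
  using ts A
proof (induction ts arbitrary: s A)
  case Nil
  then show ?case by simp
next
  case (Cons t ts)
  then have t: "0 \<le> t" "s \<le> t" "t \<le> T" and ts: "sorted (t # ts)" "\<forall>t\<in>set ts. t \<le> T"
    by auto
  have tspos: "0 \<le> r" if "r \<in> set ts" for r
    using ts(1) t(1) that by auto
  have A [measurable]: "A \<in> sets P" and At: "A \<in> sets (\<F> t)"
    using Cons.prems history_events history_mono[OF t(2)] by auto
  have [measurable]: "X t \<in> P \<rightarrow>\<^sub>M E" "X s \<in> P \<rightarrow>\<^sub>M E"
    using t Cons.prems by (auto intro: X_measurable)
  note w [measurable]
  define B where "B = X t -` {x \<in> space E. c \<le> w x} \<inter> space P"
  have Bt: "B \<in> sets (\<F> t)"
    unfolding B_def by (rule history_X[OF t(1)]) measurable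
  have AB: "A \<inter> B \<in> sets (\<F> t)" "A - B \<in> sets (\<F> t)"
    using At Bt by auto
  then have [measurable]: "A \<inter> B \<in> sets P" "A - B \<in> sets P"
    using history_events by auto
  have B_iff: "\<omega> \<in> B \<longleftrightarrow> c \<le> w (X t \<omega>)" if "\<omega> \<in> A" for \<omega>
    using sets.sets_into_space[OF A] that X_space[OF t(1)] by (auto simp: B_def)
  let ?e = "\<lambda>t. ennreal (exp (- \<gamma> * t))"
  let ?I = "\<lambda>t A. \<integral>\<^sup>+\<omega>. ?e t * w (X t \<omega>) * indicator A \<omega> \<partial>P"
  have later: "{\<omega>\<in>A - B. \<exists>t\<in>set ts. c \<le> w (X t \<omega>)} \<in> sets P"
  proof -
    have "{\<omega> \<in> space P. c \<le> w (X r \<omega>)} \<in> sets P" if "r \<in> set ts" for r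
      using X_measurable[OF tspos[OF that]] by measurable
    then have "(\<Union>r\<in>set ts. {\<omega> \<in> space P. c \<le> w (X r \<omega>)}) \<in> sets P"
      by (intro sets.finite_UN) auto
    moreover have "{\<omega>\<in>A - B. \<exists>t\<in>set ts. c \<le> w (X t \<omega>)}
        = (A - B) \<inter> (\<Union>r\<in>set ts. {\<omega> \<in> space P. c \<le> w (X r \<omega>)})"
      using sets.sets_into_space[OF A] by auto
    ultimately show ?thesis
      by simp
  qed
  have "{\<omega>\<in>A. \<exists>t\<in>set (t # ts). c \<le> w (X t \<omega>)} = (A \<inter> B) \<union> {\<omega>\<in>A - B. \<exists>t\<in>set ts. c \<le> w (X t \<omega>)}"
    using B_iff by auto
  then have "emeasure P {\<omega>\<in>A. \<exists>t\<in>set (t # ts). c \<le> w (X t \<omega>)}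
      = emeasure P (A \<inter> B) + emeasure P {\<omega>\<in>A - B. \<exists>t\<in>set ts. c \<le> w (X t \<omega>)}"
    using later by (simp only:) (intro plus_emeasure[symmetric], auto)
  then have "c * ?e T * emeasure P {\<omega>\<in>A. \<exists>t\<in>set (t # ts). c \<le> w (X t \<omega>)}
      = c * ?e T * emeasure P (A \<inter> B) + c * ?e T * emeasure P {\<omega>\<in>A - B. \<exists>t\<in>set ts. c \<le> w (X t \<omega>)}"
    by (simp add: distrib_left)
  also have "\<dots> \<le> ?I t (A \<inter> B) + ?I t (A - B)"
  proof (rule add_mono)
    have "c * ?e T * emeasure P (A \<inter> B) = (\<integral>\<^sup>+\<omega>. c * ?e T * indicator (A \<inter> B) \<omega> \<partial>P)"
      by (simp add: nn_integral_cmult_indicator)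
    also have "\<dots> \<le> ?I t (A \<inter> B)"
    proof (rule nn_integral_mono)
      fix \<omega>
      have "?e T \<le> ?e t"
        using t \<gamma> by (intro ennreal_leI) (simp add: mult_left_mono)
      then have "c * ?e T \<le> ?e t * w (X t \<omega>)" if "\<omega> \<in> A \<inter> B"
        using B_iff that by (subst mult.commute) (intro mult_mono, auto)
      then show "c * ?e T * indicator (A \<inter> B) \<omega> \<le> ?e t * w (X t \<omega>) * indicator (A \<inter> B) \<omega>"
        by (simp split: split_indicator)
    qed
    finally show "c * ?e T * emeasure P (A \<inter> B) \<le> ?I t (A \<inter> B)" .
    show "c * ?e T * emeasure P {\<omega>\<in>A - B. \<exists>t\<in>set ts. c \<le> w (X t \<omega>)} \<le> ?I t (A - B)"
      by (rule Cons.IH[OF ts(1) t(1) ts(2) AB(2)])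
  qed
  also have "\<dots> = ?I t A"
    by (subst nn_integral_add[symmetric]) (auto intro!: nn_integral_cong split: split_indicator)
  also have "\<dots> = ?e t * (\<integral>\<^sup>+\<omega>. w (X (s + (t - s)) \<omega>) * indicator A \<omega> \<partial>P)"
    by (subst nn_integral_cmult[symmetric]) (auto simp: mult.assoc)
  also have "\<dots> = ?e t * (\<integral>\<^sup>+\<omega>. (\<integral>\<^sup>+y. w y \<partial>\<kappa> (t - s) (X s \<omega>)) * indicator A \<omega> \<partial>P)"
    using t Cons.prems by (subst Markov_nn_integral[OF _ _ _ w]) auto
  also have "\<dots> = (\<integral>\<^sup>+\<omega>. ?e t * ((\<integral>\<^sup>+y. w y \<partial>\<kappa> (t - s) (X s \<omega>)) * indicator A \<omega>) \<partial>P)"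
    using t measurable_compose[OF X_measurable nn_integral_kernel_measurable[OF _ w], of s "t - s"] Cons.prems
    by (intro nn_integral_cmult[symmetric] borel_measurable_times borel_measurable_indicator A) auto
  also have "\<dots> \<le> ?I s A"
  proof (rule nn_integral_mono_AE)
    have "0 \<le> t - s" "0 \<le> s"
      using t Cons.prems by auto
    from AE_X[OF this(2) exc[OF this(1)]]
    show "AE \<omega> in P. ?e t * ((\<integral>\<^sup>+y. w y \<partial>\<kappa> (t - s) (X s \<omega>)) * indicator A \<omega>)
        \<le> ?e s * w (X s \<omega>) * indicator A \<omega>"
    proof eventually_elim
      case (elim \<omega>)
      have "?e t = ?e s * ?e (t - s)"
        by (simp add: ennreal_mult[symmetric] exp_add[symmetric] algebra_simps)
      then have "?e t * (\<integral>\<^sup>+y. w y \<partial>\<kappa> (t - s) (X s \<omega>)) \<le> ?e s * w (X s \<omega>)"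
        using mult_left_mono[OF elim, of "?e s"] by (simp add: mult.assoc)
      then show ?case
        by (simp split: split_indicator)
    qed
  qed
  finally show ?case .
qed

end

section \<open>From excessive functions to functions in the domain\<close>

locale sectorial_markov_process =
  stationary_markov_process E \<kappa> P X \<mu> + sectorial_core E \<kappa> \<mu> C K
  for E :: "'a measure" and \<kappa> :: "real \<Rightarrow> 'a \<Rightarrow> 'a measure"
    and P :: "'w measure" and X :: "real \<Rightarrow> 'w \<Rightarrow> 'a" and \<mu> :: "'a measure"
    and C :: "('a \<Rightarrow> real) set" and K :: real

context stationary_markov_process
begin

lemma L2_X_measurable: "f \<in> L2 \<mu> \<Longrightarrow> 0 \<le> t \<Longrightarrow> (\<lambda>\<omega>. f (X t \<omega>)) \<in> borel_measurable P"
  using L2_measurable[of f \<mu>] measurable_compose[OF X_measurable] by (simp add: borel_measurable_mu)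

lemma exceedance_event: "f \<in> L2 \<mu> \<Longrightarrow> 0 \<le> t \<Longrightarrow> {\<omega> \<in> space P. c \<le> f (X t \<omega>)} \<in> events"
  using L2_X_measurable by measurable

lemma exceedance_event_finite:
  assumes "f \<in> L2 \<mu>" "finite F" "F \<subseteq> {0..}"
  shows "{\<omega> \<in> space P. \<exists>t\<in>F. c \<le> f (X t \<omega>)} \<in> events"
proof -
  have "(\<Union>t\<in>F. {\<omega> \<in> space P. c \<le> f (X t \<omega>)}) \<in> events"
    using assms by (intro sets.finite_UN exceedance_event) auto
  moreover have "{\<omega> \<in> space P. \<exists>t\<in>F. c \<le> f (X t \<omega>)} = (\<Union>t\<in>F. {\<omega> \<in> space P. c \<le> f (X t \<omega>)})"
    by auto
  ultimately show ?thesis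
    by simp
qed

lemma excessive_maximal:
  assumes u: "u \<in> L2 \<mu>" and \<gamma>: "0 \<le> \<gamma>" and pos: "AE x in \<mu>. 0 \<le> u x"
    and exc: "\<And>t. 0 \<le> t \<Longrightarrow> AE x in \<mu>. exp (- \<gamma> * t) * semigroup_app \<kappa> t u x \<le> u x"
    and F: "finite F" "F \<subseteq> {0..T}" and c: "0 < c"
  shows "prob {\<omega> \<in> space P. \<exists>t\<in>F. c \<le> u (X t \<omega>)} \<le> exp (\<gamma> * T) / c * L2_norm \<mu> u"
proof -
  have uE [measurable]: "u \<in> borel_measurable E"
    using L2_measurable[OF u] by (simp add: borel_measurable_mu)
  define S where "S = {\<omega> \<in> space P. \<exists>t\<in>F. c \<le> u (X t \<omega>)}"
  have exc': "AE x in \<mu>. ennreal (exp (- \<gamma> * t)) * (\<integral>\<^sup>+y. ennreal (u y) \<partial>\<kappa> t x) \<le> ennreal (u x)"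
    if t: "0 \<le> t" for t
    using exc[OF t] AE_kernel[OF t pos] AE_integrable_kernel[OF t u]
  proof eventually_elim
    case (elim x)
    have "(\<integral>\<^sup>+y. ennreal (u y) \<partial>\<kappa> t x) = ennreal (semigroup_app \<kappa> t u x)"
      unfolding semigroup_app_def using elim by (intro nn_integral_eq_integral)
    then show ?case
      using elim(1) by (simp add: ennreal_mult'[symmetric] ennreal_leI)
  qed
  have "ennreal c * ennreal (exp (- \<gamma> * T)) *
      emeasure P {\<omega>\<in>space P. \<exists>t\<in>set (sorted_list_of_set F). ennreal c \<le> ennreal (u (X t \<omega>))}
    \<le> (\<integral>\<^sup>+\<omega>. ennreal (exp (- \<gamma> * 0)) * ennreal (u (X 0 \<omega>)) * indicator (space P) \<omega> \<partial>P)"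
  proof (rule supermartingale_maximal[OF _ \<gamma> exc'])
    show "space P \<in> sets (\<F> 0)"
      using sets.top[of "\<F> 0"] by (simp add: space_history)
  qed (use F in auto)
  also have "{\<omega>\<in>space P. \<exists>t\<in>set (sorted_list_of_set F). ennreal c \<le> ennreal (u (X t \<omega>))} = S"
  proof -
    have "ennreal c \<le> ennreal y \<longleftrightarrow> c \<le> y" for y
      using c by (auto simp: ennreal_le_iff2)
    then show ?thesis
      using F by (simp add: S_def)
  qed
  also have "(\<integral>\<^sup>+\<omega>. ennreal (exp (- \<gamma> * 0)) * ennreal (u (X 0 \<omega>)) * indicator (space P) \<omega> \<partial>P)
      = (\<integral>\<^sup>+\<omega>. ennreal (u (X 0 \<omega>)) \<partial>P)"
    by (intro nn_integral_cong) simp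
  also have "\<dots> = (\<integral>\<^sup>+x. ennreal (u x) \<partial>\<mu>)"
    by (rule nn_integral_X) auto
  also have "\<dots> = ennreal (\<integral>x. u x \<partial>\<mu>)"
    using pos \<mu>.L2_integrable[OF u] by (intro nn_integral_eq_integral)
  also have "(\<integral>x. u x \<partial>\<mu>) \<le> L2_norm \<mu> u"
    using \<mu>.L2_expectation_abs_le[OF u] integral_abs_bound[of \<mu> u] by linarith
  finally have "ennreal (c * exp (- \<gamma> * T) * prob S) \<le> ennreal (L2_norm \<mu> u)"
    using c by (simp add: emeasure_eq_measure ennreal_mult ennreal_leI)
  then have "c * exp (- \<gamma> * T) * prob S \<le> L2_norm \<mu> u"
    by (simp add: L2_norm_nonneg)
  then show ?thesis
    using c unfolding S_def[symmetric] by (simp add: exp_minus field_simps)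
qed

lemma deviation_bound:
  assumes w: "w \<in> L2 \<mu>" and t: "0 \<le> t" and \<epsilon>: "0 < \<epsilon>"
  shows "prob {\<omega> \<in> space P. \<epsilon> \<le> w (X t \<omega>)} \<le> (L2_norm \<mu> w)\<^sup>2 / \<epsilon>\<^sup>2"
proof -
  let ?S = "{\<omega> \<in> space P. \<epsilon> \<le> w (X t \<omega>)}"
  have S: "?S \<in> events"
    by (rule exceedance_event[OF w t])
  have wE [measurable]: "w \<in> borel_measurable E"
    using L2_measurable[OF w] by (simp add: borel_measurable_mu)
  have "ennreal (\<epsilon>\<^sup>2 * prob ?S) = (\<integral>\<^sup>+\<omega>. ennreal (\<epsilon>\<^sup>2) * indicator ?S \<omega> \<partial>P)"
    using S by (simp add: nn_integral_cmult_indicator emeasure_eq_measure ennreal_mult)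
  also have "\<dots> \<le> (\<integral>\<^sup>+\<omega>. ennreal ((w (X t \<omega>))\<^sup>2) \<partial>P)"
    using \<epsilon> by (intro nn_integral_mono) (auto split: split_indicator intro!: ennreal_leI power_mono)
  also have "\<dots> = (\<integral>\<^sup>+x. ennreal ((w x)\<^sup>2) \<partial>\<mu>)"
    by (rule nn_integral_X[OF t]) measurable
  also have "\<dots> = ennreal ((L2_norm \<mu> w)\<^sup>2)"
    by (rule L2_nn_integral_sq[OF w])
  finally have "\<epsilon>\<^sup>2 * prob ?S \<le> (L2_norm \<mu> w)\<^sup>2"
    by (subst (asm) ennreal_le_iff) auto
  then show ?thesis
    using \<epsilon> by (simp add: field_simps)
qed

text \<open>
  If the supremum over \<open>[0,T]\<close> is at least \<open>l\<close>, then for every \<open>l' < l\<close> some \<open>g(X\<^sub>t)\<close> exceeds \<open>l'\<close>, and by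
  separability so does \<open>g(X\<^sub>t)\<close> for some \<open>t\<close> in the countable separating set. That event is the
  increasing union of the exceedance events of finite sets of times. Lowering the level to
  \<open>l'\<close> costs nothing in the limit, because the bound is continuous in the level.
\<close>

lemma sup_le_of_finite:
  assumes g: "g \<in> L2 \<mu>" and sep: "separable_process P {0..T} (\<lambda>t \<omega>. g (X t \<omega>))"
    and T: "0 \<le> T" and l: "0 < l"
    and bound: "\<And>F l. finite F \<Longrightarrow> F \<subseteq> {0..T} \<Longrightarrow> 0 < l \<Longrightarrow>
      prob {\<omega> \<in> space P. \<exists>t\<in>F. l \<le> g (X t \<omega>)} \<le> b / l"
  shows "measure (completion P) {\<omega> \<in> space P. (SUP t\<in>{0..T}. ereal (g (X t \<omega>))) \<ge> ereal l} \<le> b / l"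
proof -
  define S where "S = {\<omega> \<in> space P. (SUP t\<in>{0..T}. ereal (g (X t \<omega>))) \<ge> ereal l}"
  interpret Pc: prob_space "completion P"
    by (rule prob_space_completion)
  obtain D where D: "countable D" "D \<subseteq> {0..T}"
    and ae: "AE \<omega> in P. \<forall>t\<in>{0..T}. \<exists>s. (\<forall>n::nat. s n \<in> D) \<and> s \<longlonglongrightarrow> t \<and>
         (\<lambda>n. g (X (s n) \<omega>)) \<longlonglongrightarrow> g (X t \<omega>)"
    using sep unfolding separable_process_def by (elim exE conjE) rule
  have "D \<noteq> {}"
  proof
    assume "D = {}"
    then have "AE \<omega> in P. False"
      using ae T by (auto elim!: eventually_mono)
    then show False
      by simp
  qed
  have below: "measure (completion P) S \<le> b / l'" if l': "0 < l'" "l' < l" for l'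
  proof -
    define A where "A n = {\<omega> \<in> space P. \<exists>t\<in>from_nat_into D ` {..<n}. l' \<le> g (X t \<omega>)}" for n
    have sub: "from_nat_into D ` {..<n} \<subseteq> {0..T}" for n
      using from_nat_into[OF \<open>D \<noteq> {}\<close>] D(2) by auto
    have A: "A n \<in> events" for n
      unfolding A_def using sub[of n] by (intro exceedance_event_finite g) auto
    have "incseq A"
      by (rule incseq_SucI) (auto simp: A_def)
    then have "(\<lambda>n. prob (A n)) \<longlonglongrightarrow> prob (\<Union>n. A n)"
      using A by (intro finite_Lim_measure_incseq) auto
    then have le: "prob (\<Union>n. A n) \<le> b / l'"
    proof (rule LIMSEQ_le_const2)
      have "prob (A n) \<le> b / l'" for n
        unfolding A_def using sub[of n] l'(1) by (intro bound) auto
      then show "\<exists>N. \<forall>n\<ge>N. prob (A n) \<le> b / l'"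
        by blast
    qed
    have "AE \<omega> in P. \<omega> \<in> S \<longrightarrow> \<omega> \<in> (\<Union>n. A n)"
      using ae
    proof eventually_elim
      case (elim \<omega>)
      show ?case
      proof
        assume S: "\<omega> \<in> S"
        then have "ereal l' < (SUP t\<in>{0..T}. ereal (g (X t \<omega>)))"
          using l' by (auto simp: S_def intro: less_le_trans[of "ereal l'" "ereal l"])
        then obtain t where t: "t \<in> {0..T}" "l' < g (X t \<omega>)"
          by (auto simp: less_SUP_iff)
        then obtain s where s: "\<forall>n::nat. s n \<in> D" "(\<lambda>n. g (X (s n) \<omega>)) \<longlonglongrightarrow> g (X t \<omega>)"
          using elim by blast
        have "\<forall>\<^sub>F n in sequentially. l' < g (X (s n) \<omega>)"
          by (rule order_tendstoD(1)[OF s(2) t(2)])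
        then obtain n where n: "l' < g (X (s n) \<omega>)"
          by (auto dest: eventually_happens)
        obtain k where "from_nat_into D k = s n"
          using from_nat_into_surj[OF D(1)] s(1) by blast
        then have "\<omega> \<in> A (Suc k)"
          using n S by (auto simp: A_def S_def intro!: bexI[of _ k])
        then show "\<omega> \<in> (\<Union>n. A n)"
          by blast
      qed
    qed
    then have "measure (completion P) S \<le> measure (completion P) (\<Union>n. A n)"
      using A by (intro Pc.finite_measure_mono_AE AE_completion) auto
    also have "\<dots> = prob (\<Union>n. A n)"
      using A by (intro measure_completion) auto
    finally show ?thesis
      using le by simp
  qed
  have "((\<lambda>l'. b / l') \<longlongrightarrow> b / l) (at_left l)"
    using l by (intro tendsto_intros) auto
  moreover have "\<forall>\<^sub>F l' in at_left l. measure (completion P) S \<le> b / l'"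
    using eventually_at_left_real[OF l] by eventually_elim (auto intro: below)
  ultimately have "measure (completion P) S \<le> b / l"
    by (intro tendsto_lowerbound) auto
  then show ?thesis
    by (simp add: S_def)
qed

end

context sectorial_markov_process
begin

text \<open>
  An exceedance of \<open>l\<close> by \<open>g\<close> at a time in \<open>F\<close> entails one of \<open>l - \<epsilon>\<close> by the penalised solution \<open>u\<close>, or one
  of \<open>\<epsilon>\<close> by \<open>max 0 (g - u)\<close>. The first has the desired probability; the second, by Chebyshev and
  stationarity at each of the finitely many times, is of order \<open>1 / (\<alpha> \<epsilon>\<^sup>2)\<close>. The limit \<open>\<alpha> \<rightarrow> \<infinity>\<close> has to be
  taken before \<open>\<epsilon> \<rightarrow> 0\<close>.
\<close>

lemma finite_maximal:
  assumes gg: "(g, g') \<in> core_closure" and T: "0 < T" and F: "finite F" "F \<subseteq> {0..T}" and l: "0 < l"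
  shows "prob {\<omega> \<in> space P. \<exists>t\<in>F. l \<le> g (X t \<omega>)}
    \<le> exp 1 * sqrt ((L2_norm \<mu> g)\<^sup>2 - T * K * L2_inner \<mu> g g') / l"
proof -
  note gL2 = core_closure_L2(1)[OF gg]
  define b where "b = sqrt ((L2_norm \<mu> g)\<^sup>2 - T * K * L2_inner \<mu> g g')"
  define m where "m = (L2_norm \<mu> g)\<^sup>2 / T - K * L2_inner \<mu> g g'"
  have Fpos: "F \<subseteq> {0..}"
    using F by auto
  have step: "prob {\<omega> \<in> space P. \<exists>t\<in>F. l \<le> g (X t \<omega>)}
      \<le> exp 1 * b / (l - \<epsilon>) + real (card F) * (m / (2 * \<alpha>) / \<epsilon>\<^sup>2)"
    if \<alpha>: "0 < \<alpha>" and \<epsilon>: "0 < \<epsilon>" "\<epsilon> < l" for \<alpha> \<epsilon>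
  proof -
    have \<gamma>: "0 < 1 / T"
      using T by simp
    obtain u v where uv: "(u, v) \<in> core_closure"
      and eq: "AE x in \<mu>. 1 / T * u x - v x = \<alpha> * max 0 (g x - u x)"
      using penalised_obstacle[OF \<gamma> \<alpha> gL2] by blast
    note uL2 = core_closure_L2(1)[OF uv]
    let ?w = "\<lambda>x. max 0 (g x - u x)"
    have w: "?w \<in> L2 \<mu>"
      by (intro L2_max L2_zero L2_diff gL2 uL2)
    have "1 / T * (L2_norm \<mu> u)\<^sup>2 + 2 * \<alpha> * (L2_norm \<mu> ?w)\<^sup>2
        \<le> 1 / T * (L2_norm \<mu> g)\<^sup>2 - K * L2_inner \<mu> g g'"
      by (rule obstacle_energy[OF \<gamma> uv gg eq])
    then have energy: "(L2_norm \<mu> u)\<^sup>2 / T + 2 * \<alpha> * (L2_norm \<mu> ?w)\<^sup>2 \<le> m"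
      by (simp add: m_def)
    have "(L2_norm \<mu> u)\<^sup>2 / T \<le> m"
      using energy \<alpha> by (smt (verit) mult_nonneg_nonneg zero_le_power2)
    then have "(L2_norm \<mu> u)\<^sup>2 \<le> (L2_norm \<mu> g)\<^sup>2 - T * K * L2_inner \<mu> g g'"
      using T by (simp add: m_def field_simps)
    then have ub: "L2_norm \<mu> u \<le> b"
      unfolding b_def by (rule real_le_rsqrt)
    have wb: "(L2_norm \<mu> ?w)\<^sup>2 \<le> m / (2 * \<alpha>)"
    proof -
      have "0 \<le> (L2_norm \<mu> u)\<^sup>2 / T"
        using T by simp
      then show ?thesis
        using energy \<alpha> by (simp add: field_simps)
    qed
    have pos: "AE x in \<mu>. 0 \<le> 1 / T * u x - v x"
      using eq by eventually_elim (use \<alpha> in simp)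
    have "{\<omega> \<in> space P. \<exists>t\<in>F. l \<le> g (X t \<omega>)} \<subseteq>
        {\<omega> \<in> space P. \<exists>t\<in>F. l - \<epsilon> \<le> u (X t \<omega>)} \<union> (\<Union>t\<in>F. {\<omega> \<in> space P. \<epsilon> \<le> ?w (X t \<omega>)})"
    proof
      fix \<omega> assume "\<omega> \<in> {\<omega> \<in> space P. \<exists>t\<in>F. l \<le> g (X t \<omega>)}"
      then obtain t where t: "\<omega> \<in> space P" "t \<in> F" "l \<le> g (X t \<omega>)"
        by auto
      then have "l - \<epsilon> \<le> u (X t \<omega>) \<or> \<epsilon> \<le> ?w (X t \<omega>)"
        by linarith
      with t show "\<omega> \<in> {\<omega> \<in> space P. \<exists>t\<in>F. l - \<epsilon> \<le> u (X t \<omega>)}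
          \<union> (\<Union>t\<in>F. {\<omega> \<in> space P. \<epsilon> \<le> ?w (X t \<omega>)})"
        by blast
    qed
    then have "prob {\<omega> \<in> space P. \<exists>t\<in>F. l \<le> g (X t \<omega>)} \<le>
        prob ({\<omega> \<in> space P. \<exists>t\<in>F. l - \<epsilon> \<le> u (X t \<omega>)} \<union> (\<Union>t\<in>F. {\<omega> \<in> space P. \<epsilon> \<le> ?w (X t \<omega>)}))"
      using F Fpos
      by (intro finite_measure_mono sets.Un sets.finite_UN exceedance_event_finite exceedance_event uL2 w) auto
    also have "\<dots> \<le> prob {\<omega> \<in> space P. \<exists>t\<in>F. l - \<epsilon> \<le> u (X t \<omega>)}
        + prob (\<Union>t\<in>F. {\<omega> \<in> space P. \<epsilon> \<le> ?w (X t \<omega>)})"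
      using F Fpos
      by (intro measure_Un_le sets.finite_UN exceedance_event_finite exceedance_event uL2 w) auto
    also have "prob {\<omega> \<in> space P. \<exists>t\<in>F. l - \<epsilon> \<le> u (X t \<omega>)} \<le> exp (1 / T * T) / (l - \<epsilon>) * L2_norm \<mu> u"
      using excessive_of_nonneg[OF uv \<gamma> pos] \<gamma> \<epsilon> by (intro excessive_maximal uL2 F) auto
    also have "exp (1 / T * T) / (l - \<epsilon>) * L2_norm \<mu> u \<le> exp 1 / (l - \<epsilon>) * b"
      using T \<epsilon> ub by (intro mult_mono) (auto simp: L2_norm_nonneg)
    also have "prob (\<Union>t\<in>F. {\<omega> \<in> space P. \<epsilon> \<le> ?w (X t \<omega>)}) \<le> (\<Sum>t\<in>F. prob {\<omega> \<in> space P. \<epsilon> \<le> ?w (X t \<omega>)})"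
      using F Fpos by (intro measure_UNION_le exceedance_event w) auto
    also have "\<dots> \<le> (\<Sum>t\<in>F. m / (2 * \<alpha>) / \<epsilon>\<^sup>2)"
    proof (rule sum_mono)
      fix t assume "t \<in> F"
      then have "prob {\<omega> \<in> space P. \<epsilon> \<le> ?w (X t \<omega>)} \<le> (L2_norm \<mu> ?w)\<^sup>2 / \<epsilon>\<^sup>2"
        using Fpos \<epsilon> by (intro deviation_bound w) auto
      also have "\<dots> \<le> m / (2 * \<alpha>) / \<epsilon>\<^sup>2"
        by (intro divide_right_mono wb) simp
      finally show "prob {\<omega> \<in> space P. \<epsilon> \<le> ?w (X t \<omega>)} \<le> m / (2 * \<alpha>) / \<epsilon>\<^sup>2" .
    qed
    finally show ?thesis
      by simp
  qed
  have no_error: "prob {\<omega> \<in> space P. \<exists>t\<in>F. l \<le> g (X t \<omega>)} \<le> exp 1 * b / (l - \<epsilon>)"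
    if \<epsilon>: "0 < \<epsilon>" "\<epsilon> < l" for \<epsilon>
  proof -
    have "(\<lambda>n. m / 2 * inverse (real (Suc n)) / \<epsilon>\<^sup>2) \<longlonglongrightarrow> m / 2 * 0 / \<epsilon>\<^sup>2"
      using \<epsilon> by (intro tendsto_intros LIMSEQ_inverse_real_of_nat) auto
    then have "(\<lambda>n. exp 1 * b / (l - \<epsilon>) + real (card F) * (m / 2 * inverse (real (Suc n)) / \<epsilon>\<^sup>2))
        \<longlonglongrightarrow> exp 1 * b / (l - \<epsilon>) + real (card F) * (m / 2 * 0 / \<epsilon>\<^sup>2)"
      by (intro tendsto_add tendsto_mult tendsto_const)
    then have "(\<lambda>n. exp 1 * b / (l - \<epsilon>) + real (card F) * (m / 2 * inverse (real (Suc n)) / \<epsilon>\<^sup>2))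
        \<longlonglongrightarrow> exp 1 * b / (l - \<epsilon>)"
      by simp
    then show ?thesis
    proof (rule LIMSEQ_le_const)
      have "prob {\<omega> \<in> space P. \<exists>t\<in>F. l \<le> g (X t \<omega>)}
          \<le> exp 1 * b / (l - \<epsilon>) + real (card F) * (m / 2 * inverse (real (Suc n)) / \<epsilon>\<^sup>2)" for n
      proof -
        have "m / (2 * real (Suc n)) / \<epsilon>\<^sup>2 = m / 2 * inverse (real (Suc n)) / \<epsilon>\<^sup>2"
          by (simp only: divide_inverse inverse_mult_distrib mult.assoc)
        then show ?thesis
          using step[OF of_nat_0_less_iff[THEN iffD2, OF zero_less_Suc] \<epsilon>, of n] by (simp only:)
      qed
      then show "\<exists>N. \<forall>n\<ge>N. prob {\<omega> \<in> space P. \<exists>t\<in>F. l \<le> g (X t \<omega>)}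
          \<le> exp 1 * b / (l - \<epsilon>) + real (card F) * (m / 2 * inverse (real (Suc n)) / \<epsilon>\<^sup>2)"
        by blast
    qed
  qed
  have "((\<lambda>\<epsilon>. exp 1 * b / (l - \<epsilon>)) \<longlongrightarrow> exp 1 * b / (l - 0)) (at_right 0)"
    using l by (intro tendsto_intros) auto
  moreover have "\<forall>\<^sub>F \<epsilon> in at_right 0. prob {\<omega> \<in> space P. \<exists>t\<in>F. l \<le> g (X t \<omega>)} \<le> exp 1 * b / (l - \<epsilon>)"
    using eventually_at_right_real[OF l] by eventually_elim (auto intro: no_error)
  ultimately have "prob {\<omega> \<in> space P. \<exists>t\<in>F. l \<le> g (X t \<omega>)} \<le> exp 1 * b / (l - 0)"
    by (intro tendsto_lowerbound) auto
  then show ?thesis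
    by (simp add: b_def)
qed

lemma maximal_inequality:
  assumes g: "g \<in> Domain L" and T: "0 < T" and l: "0 < l"
    and sep: "separable_process P {0..T} (\<lambda>t \<omega>. g (X t \<omega>))"
  shows "measure (completion P) {\<omega> \<in> space P. (SUP t\<in>{0..T}. ereal (g (X t \<omega>))) \<ge> ereal l}
    \<le> exp 1 / l * sqrt (L2_inner \<mu> g g + T * (K\<^sup>2 + 1) * dirichlet_form \<mu> L g)"
proof -
  obtain g' where gg': "(g, g') \<in> L"
    using g by auto
  then have gg: "(g, g') \<in> core_closure"
    by (rule generator_core_closure)
  have D: "dirichlet_form \<mu> L g = - L2_inner \<mu> g g'"
    unfolding dirichlet_form_def L2_inner_uminus_right
    using generator_op_app(2)[OF gg' generator_L2(1)[OF gg']] by simp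
  have "measure (completion P) {\<omega> \<in> space P. (SUP t\<in>{0..T}. ereal (g (X t \<omega>))) \<ge> ereal l}
      \<le> exp 1 * sqrt ((L2_norm \<mu> g)\<^sup>2 - T * K * L2_inner \<mu> g g') / l"
    using T by (intro sup_le_of_finite sep l core_closure_L2(1)[OF gg] finite_maximal[OF gg]) auto
  also have "\<dots> \<le> exp 1 * sqrt (L2_inner \<mu> g g + T * (K\<^sup>2 + 1) * dirichlet_form \<mu> L g) / l"
  proof -
    have "K \<le> K\<^sup>2 + 1"
    proof -
      have "0 \<le> (K - 1)\<^sup>2" by simp
      then show ?thesis
        using K_pos unfolding power2_diff by simp
    qed
    then have "T * K * dirichlet_form \<mu> L g \<le> T * (K\<^sup>2 + 1) * dirichlet_form \<mu> L g"
      using T core_closure_dissipative[OF gg] by (intro mult_right_mono mult_left_mono) (auto simp: D)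
    then show ?thesis
      using l by (intro divide_right_mono mult_left_mono real_sqrt_le_mono) (auto simp: D L2_norm_sq)
  qed
  finally show ?thesis
    by simp
qed

end

theorem theoremC2:
  fixes T :: real
  assumes "T > 0"
  shows "\<exists>C0>0. \<forall>(E :: 'a measure) (\<kappa> :: real \<Rightarrow> 'a \<Rightarrow> 'a measure) (\<mu> :: 'a measure)
      (P :: 'w measure) (X :: real \<Rightarrow> 'w \<Rightarrow> 'a) (C :: ('a \<Rightarrow> real) set) (K :: real).
    markov_process E \<kappa> P X \<longrightarrow>
    invariant_measure E \<kappa> \<mu> \<longrightarrow>
    distr P E (X 0) = \<mu> \<longrightarrow>
    strongly_continuous_L2 \<mu> \<kappa> \<longrightarrow>
    is_core \<mu> (L2_generator \<mu> \<kappa>) C \<longrightarrow>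
    is_core \<mu> (L2_adjoint \<mu> (L2_generator \<mu> \<kappa>)) C \<longrightarrow>
    K > 0 \<longrightarrow>
    sector_condition \<mu> (L2_generator \<mu> \<kappa>) C K \<longrightarrow>
    (\<forall>g\<in>Domain (L2_generator \<mu> \<kappa>). \<forall>l>0.
      separable_process P {0..T} (\<lambda>t \<omega>. g (X t \<omega>)) \<longrightarrow>
      measure (completion P) {\<omega> \<in> space P. (SUP t\<in>{0..T}. ereal (g (X t \<omega>))) \<ge> ereal l}
        \<le> C0 / l * sqrt (L2_inner \<mu> g g
            + T * (K\<^sup>2 + 1) * dirichlet_form \<mu> (L2_generator \<mu> \<kappa>) g))"
proof (rule exI[of _ "exp 1"], intro conjI allI impI ballI)
  show "exp 1 > (0::real)"
    by simp
  fix E :: "'a measure" and \<kappa> :: "real \<Rightarrow> 'a \<Rightarrow> 'a measure" and \<mu> :: "'a measure"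
    and P :: "'w measure" and X :: "real \<Rightarrow> 'w \<Rightarrow> 'a" and C :: "('a \<Rightarrow> real) set" and K l :: real
    and g :: "'a \<Rightarrow> real"
  assume mp: "markov_process E \<kappa> P X" and rest: "invariant_measure E \<kappa> \<mu>" "distr P E (X 0) = \<mu>"
    "is_core \<mu> (L2_generator \<mu> \<kappa>) C" "is_core \<mu> (L2_adjoint \<mu> (L2_generator \<mu> \<kappa>)) C" "K > 0"
    "sector_condition \<mu> (L2_generator \<mu> \<kappa>) C K"
    and g: "g \<in> Domain (L2_generator \<mu> \<kappa>)" "l > 0"
      "separable_process P {0..T} (\<lambda>t \<omega>. g (X t \<omega>))"
  interpret markov_process E \<kappa> P X
    by (rule mp)
  interpret sectorial_markov_process E \<kappa> P X \<mu> C K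
    by unfold_locales (fact rest)+
  show "measure (completion P) {\<omega> \<in> space P. (SUP t\<in>{0..T}. ereal (g (X t \<omega>))) \<ge> ereal l}
      \<le> exp 1 / l * sqrt (L2_inner \<mu> g g
          + T * (K\<^sup>2 + 1) * dirichlet_form \<mu> (L2_generator \<mu> \<kappa>) g)"
    by (rule maximal_inequality[OF g(1) assms g(2,3)])
qed

end
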